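(* Let $n\ge1$ and let $S,T$ be Young tableaux of the same shape on the alphabet $\{1,\dots,n\}$. Then the bitableaux correspondence isomorphism $\mathcal K^{-1}:\mathbb C[M_{n,n}]\to\mathbf U(gl(n))$ and its inverse, the Koszul map $\mathcal K:\mathbf U(gl(n))\to\mathbb C[M_{n,n}]$, satisfy $$\mathcal K^{-1}\big((S|\boxed{T})\big)=[S|\boxed{T}],\qquad \mathcal K\big([S|\boxed{T}]\big)=(S|\boxed{T}).$$
   Context: **Bitableaux in the polynomial algebra.** $\mathbb C[M_{n,n}]$ is the polynomial algebra in commuting variables $(i|j)$, $1\le i,j\le n$. For words of equal length $p$, $(i_1\cdots i_p|j_1\cdots j_p)=(-1)^{\binom p2}\det\big((i_r|j_s)\big)_{r,s=1,\dots,p}$. A Young tableau of shape $\lambda\vdash h$ over an alphabet is an arbitrary filling of the diagram of $\lambda$; its cells are numbered $1,\dots,h$ row by row from left to right, top to bottom, and $S(k)$ is the entry in cell $k$. For tableaux $S,T$ on $\{1,\dots,n\}$ of the same shape with row words $\omega_1,\dots,\omega_p$ and $\varpi_1,\dots,\varpi_p$, $$(S|T)=(-1)^{\sum_{k=2}^p\ell(\omega_k)(\ell(\varpi_1)+\cdots+\ell(\varpi_{k-1}))}(\omega_1|\varpi_1)\cdots(\omega_p|\varpi_p),$$ $\ell$ denoting word length. The right symmetrized bitableau is $(S|\boxed{T})=\sum_{\overline T}(S|\overline T)$, the sum over all tableaux $\overline T$ obtained by permuting the cells within each column of $T$ (one summand for each tuple of column permutations, so repeated entries in a column give multiplicities).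 **Virtual variables.** Let $A_0=\{\alpha_1,\dots,\alpha_{m_0}\}$, $A_1=\{\beta_1,\dots,\beta_{m_1}\}$, $L=\{1,\dots,n\}$ be disjoint sets of symbols ($m_0,m_1$ sufficiently large), with parities $|\alpha_s|=0$, $|\beta_t|=|i|=1$ in $\mathbb Z_2$. $gl(m_0|m_1+n)$ is the complex Lie superalgebra with basis $e_{a,b}$, $a,b\in A_0\cup A_1\cup L$, $|e_{a,b}|=|a|+|b|$, and superbracket $[e_{a,b},e_{c,d}]=\delta_{bc}e_{a,d}-(-1)^{(|a|+|b|)(|c|+|d|)}\delta_{ad}e_{c,b}$; $gl(n)$ is its Lie subalgebra spanned by $e_{ij}=e_{i,j}$, $i,j\in L$. A product $e_{a_m,b_m}\cdots e_{a_1,b_1}$ in $\mathbf U(gl(m_0|m_1+n))$ is irregular if there are $i\le m$ and $\gamma\in A_0\cup A_1$ with $\#\{j\le i: b_j=\gamma\}>\#\{j<i: a_j=\gamma\}$. $\mathbf{Irr}$ is the left ideal generated by irregular products. It is known that $\mathbf U(gl(n))\cap\mathbf{Irr}=0$ and that $Virt(m_0+m_1,n)=\mathbf U(gl(n))\oplus\mathbf{Irr}$ is a subalgebra in which $\mathbf{Irr}$ is a two-sided ideal; $\mathfrak p:Virt(m_0+m_1,n)\to\mathbf U(gl(n))$ is the projection with kernel $\mathbf{Irr}$. **Capelli and Young–Capelli bitableaux.** For tableaux $S,T$ of the same shape over $A_0\cup A_1\cup L$ put $e_{S,T}=e_{S(1),T(1)}\cdots e_{S(h),T(h)}$. $C^*_\lambda$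 is the tableau of shape $\lambda$ all of whose entries in row $r$ equal $\alpha_r$, and $D^*_\lambda$ is the tableau of shape $\lambda$ all of whose entries in column $c$ equal $\beta_c$. For tableaux $S,T$ of shape $\lambda$ on $\{1,\dots,n\}$, $$[S|T]=\mathfrak p\big(e_{S,C^*_\lambda}\,e_{C^*_\lambda,T}\big),\qquad [S|\boxed{T}]=\mathfrak p\big(e_{S,C^*_\lambda}\,e_{C^*_\lambda,D^*_\lambda}\,e_{D^*_\lambda,T}\big)\in\mathbf U(gl(n))$$ (the arguments of $\mathfrak p$ lie in $Virt(m_0+m_1,n)$). **The maps $\mathcal K^{-1}$ and $\mathcal K$.** It is known that there is a unique linear map $\mathcal K^{-1}:\mathbb C[M_{n,n}]\to\mathbf U(gl(n))$ with $\mathcal K^{-1}((S|T))=[S|T]$ for all pairs of tableaux $S,T$ of the same shape on $\{1,\dots,n\}$, and that it is a vector space isomorphism; $\mathcal K$ is its inverse (it coincides with the map introduced by Koszul). *)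

theory Defs
  imports
    Complex_Main
    "HOL-Library.FuncSet"
    "HOL-Library.Poly_Mapping"
    "HOL-Combinatorics.Permutations"
    "HOL-Algebra.QuotRing"
    "Jordan_Normal_Form.Determinant"
    "Jordan_Normal_Form.VS_Connect"
begin

section \<open>Young tableaux\<close>

text \<open>A shape is the list of its row lengths, a tableau the list of its rows; both are
  0-based, so the mathematical cell $(r, c)$ is \<open>T ! (r - 1) ! (c - 1)\<close>, and \<open>concat T\<close> lists
  the entries \<open>S(1), \<dots>, S(h)\<close> in the row-by-row numbering of the cells.
  The empty shape (of the empty partition of 0) is included.\<close>

definition is_shape :: "nat list \<Rightarrow> bool" where
  "is_shape l \<longleftrightarrow> sorted_wrt (\<ge>) l \<and> 0 \<notin> set l"

definition shape :: "'a list list \<Rightarrow> nat list" where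
  "shape T = map length T"

definition tableaux :: "'a set \<Rightarrow> 'a list list set" where
  "tableaux A = {T. is_shape (shape T) \<and> (\<forall>w \<in> set T. set w \<subseteq> A)}"

definition nrows :: "nat list \<Rightarrow> nat" where
  "nrows l = length l"

definition ncols :: "nat list \<Rightarrow> nat" where
  "ncols l = (case l of [] \<Rightarrow> 0 | k # _ \<Rightarrow> k)"

definition col_height :: "nat list \<Rightarrow> nat \<Rightarrow> nat" where
  "col_height l c = card {r. r < nrows l \<and> c < l ! r}"

text \<open>\<open>\<sigma> c\<close> is the permutation applied to the cells of column \<open>c\<close>.\<close>

definition col_perms :: "nat list \<Rightarrow> (nat \<Rightarrow> nat \<Rightarrow> nat) set" where
  "col_perms l = (\<Pi>\<^sub>E c \<in> {..<ncols l}. {p. p permutes {..<col_height l c}})"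

definition permute_cols :: "(nat \<Rightarrow> nat \<Rightarrow> nat) \<Rightarrow> 'a list list \<Rightarrow> 'a list list" where
  "permute_cols \<sigma> T =
     map (\<lambda>r. map (\<lambda>c. T ! (\<sigma> c r) ! c) [0..<length (T ! r)]) [0..<length T]"


section \<open>Bitableaux in the polynomial algebra\<close>

type_synonym mpoly = "((nat \<times> nat) \<Rightarrow>\<^sub>0 nat) \<Rightarrow>\<^sub>0 complex"

text \<open>The algebra of polynomials in the variables $(i|j)$ with $1 \le i, j \le n$.\<close>

definition poly_alg :: "nat \<Rightarrow> (complex, mpoly) module" where
  "poly_alg n =
     \<lparr>carrier = {f. \<forall>m \<in> Poly_Mapping.keys f. Poly_Mapping.keys m \<subseteq> {1..n} \<times> {1..n}},
      mult = (*), one = 1, zero = 0, add = (+),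
      smult = (\<lambda>c f. Poly_Mapping.single 0 c * f)\<rparr>"

definition matvar :: "nat \<Rightarrow> nat \<Rightarrow> mpoly" where
  "matvar i j = Poly_Mapping.single (Poly_Mapping.single (i, j) 1) 1"

definition biword :: "nat list \<Rightarrow> nat list \<Rightarrow> mpoly" where
  "biword u v = (-1) ^ (length u choose 2) *
     det (mat (length u) (length u) (\<lambda>(r, s). matvar (u ! r) (v ! s)))"

definition bitableau :: "nat list list \<Rightarrow> nat list list \<Rightarrow> mpoly" where
  "bitableau S T =
     (-1) ^ (\<Sum>k \<in> {1..<length S}. length (S ! k) * (\<Sum>i<k. length (T ! i))) *
     (\<Prod>k<length S. biword (S ! k) (T ! k))"

definition right_sym_bitableau :: "nat list list \<Rightarrow> nat list list \<Rightarrow> mpoly" where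
  "right_sym_bitableau S T = (\<Sum>\<sigma> \<in> col_perms (shape T). bitableau S (permute_cols \<sigma> T))"


section \<open>Enveloping superalgebras\<close>

text \<open>\<open>'g free_word \<Rightarrow>\<^sub>0 complex\<close> with convolution product is the free associative algebra
  (the tensor algebra of the space with basis \<open>'g\<close>).\<close>

datatype 'g free_word = Word (unWord: "'g list")

instantiation free_word :: (type) monoid_add
begin

definition zero_free_word :: "'a free_word" where
  "0 = Word []"

definition plus_free_word :: "'a free_word \<Rightarrow> 'a free_word \<Rightarrow> 'a free_word" where
  "u + v = Word (unWord u @ unWord v)"

instance
  by standard (simp_all add: zero_free_word_def plus_free_word_def)

end

type_synonym 'g free_elt = "'g free_word \<Rightarrow>\<^sub>0 complex"

definition free_alg :: "'g set \<Rightarrow> (complex, 'g free_elt) module" where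
  "free_alg B =
     \<lparr>carrier = {f. \<forall>w \<in> Poly_Mapping.keys f. set (unWord w) \<subseteq> B},
      mult = (*), one = 1, zero = 0, add = (+),
      smult = (\<lambda>c f. Poly_Mapping.single 0 c * f)\<rparr>"

definition free_gen :: "'g \<Rightarrow> 'g free_elt" where
  "free_gen x = Poly_Mapping.single (Word [x]) 1"

text \<open>The inclusion of a vector (a formal combination of basis elements) in degree 1.\<close>

definition free_lin :: "('g \<Rightarrow>\<^sub>0 complex) \<Rightarrow> 'g free_elt" where
  "free_lin v = (\<Sum>x \<in> Poly_Mapping.keys v.
     Poly_Mapping.single 0 (Poly_Mapping.lookup v x) * free_gen x)"

text \<open>A Lie superalgebra is given by a basis \<open>B\<close>, the parities \<open>par\<close> of the basis elements
  (natural numbers read modulo 2) and the superbracket \<open>br\<close> of basis elements.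
  Its enveloping algebra is the free algebra modulo the two-sided ideal generated by
  $xy - (-1)^{|x||y|} yx - [x,y]$.\<close>

definition env_ideal ::
    "'g set \<Rightarrow> ('g \<Rightarrow> nat) \<Rightarrow> ('g \<Rightarrow> 'g \<Rightarrow> ('g \<Rightarrow>\<^sub>0 complex)) \<Rightarrow> 'g free_elt set" where
  "env_ideal B par br = genideal (free_alg B)
     {free_gen x * free_gen y - (-1) ^ (par x * par y) * (free_gen y * free_gen x)
        - free_lin (br x y) | x y. x \<in> B \<and> y \<in> B}"

definition env_alg ::
    "'g set \<Rightarrow> ('g \<Rightarrow> nat) \<Rightarrow> ('g \<Rightarrow> 'g \<Rightarrow> ('g \<Rightarrow>\<^sub>0 complex)) \<Rightarrow>
     (complex, 'g free_elt set) module" where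
  "env_alg B par br =
     (let F = free_alg B; J = env_ideal B par br; Q = F Quot J in
      \<lparr>carrier = carrier Q, mult = mult Q, one = one Q, zero = zero Q, add = add Q,
       smult = (\<lambda>c X. mult Q (J +>\<^bsub>F\<^esub> Poly_Mapping.single 0 c) X)\<rparr>)"


section \<open>The enveloping algebra of gl(m0|m1+n) and virtual variables\<close>

datatype letter = Alpha nat | Beta nat | Proper nat

fun letter_parity :: "letter \<Rightarrow> nat" where
  "letter_parity (Alpha _) = 0"
| "letter_parity (Beta _) = 1"
| "letter_parity (Proper _) = 1"

definition virtual_letters :: "nat \<Rightarrow> nat \<Rightarrow> letter set" where
  "virtual_letters m0 m1 = Alpha ` {1..m0} \<union> Beta ` {1..m1}"

definition all_letters :: "nat \<Rightarrow> nat \<Rightarrow> nat \<Rightarrow> letter set" where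
  "all_letters m0 m1 n = virtual_letters m0 m1 \<union> Proper ` {1..n}"

text \<open>The pair \<open>(a, b)\<close> stands for the basis element $e_{a,b}$.\<close>

definition gl_basis :: "nat \<Rightarrow> nat \<Rightarrow> nat \<Rightarrow> (letter \<times> letter) set" where
  "gl_basis m0 m1 n = all_letters m0 m1 n \<times> all_letters m0 m1 n"

definition gl_parity :: "letter \<times> letter \<Rightarrow> nat" where
  "gl_parity = (\<lambda>(a, b). letter_parity a + letter_parity b)"

definition gl_bracket ::
    "letter \<times> letter \<Rightarrow> letter \<times> letter \<Rightarrow> ((letter \<times> letter) \<Rightarrow>\<^sub>0 complex)" where
  "gl_bracket = (\<lambda>(a, b) (c, d).
     (if b = c then Poly_Mapping.single (a, d) 1 else 0)
     - (if a = d then Poly_Mapping.single (c, b) ((-1) ^ (gl_parity (a, b) * gl_parity (c, d)))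
        else 0))"

type_synonym U_elt = "(letter \<times> letter) free_elt set"

definition U_ideal :: "nat \<Rightarrow> nat \<Rightarrow> nat \<Rightarrow> (letter \<times> letter) free_elt set" where
  "U_ideal m0 m1 n = env_ideal (gl_basis m0 m1 n) gl_parity gl_bracket"

definition U_super :: "nat \<Rightarrow> nat \<Rightarrow> nat \<Rightarrow> (complex, U_elt) module" where
  "U_super m0 m1 n = env_alg (gl_basis m0 m1 n) gl_parity gl_bracket"

text \<open>$gl(n)$ is $gl(0|0+n)$: all its basis elements have even parity.\<close>

definition U_gl :: "nat \<Rightarrow> (complex, U_elt) module" where
  "U_gl n = U_super 0 0 n"

text \<open>The map induced by the inclusion $gl(n) \subseteq gl(m_0|m_1+n)$: it enlarges the coset
  of \<open>f\<close> modulo the relations of $gl(n)$ to the coset of \<open>f\<close> modulo those of $gl(m_0|m_1+n)$.\<close>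

definition U_incl :: "nat \<Rightarrow> nat \<Rightarrow> nat \<Rightarrow> U_elt \<Rightarrow> U_elt" where
  "U_incl m0 m1 n X = U_ideal m0 m1 n <+>\<^bsub>free_alg (gl_basis m0 m1 n)\<^esub> X"

definition U_gen :: "nat \<Rightarrow> nat \<Rightarrow> nat \<Rightarrow> letter \<times> letter \<Rightarrow> U_elt" where
  "U_gen m0 m1 n x = U_ideal m0 m1 n +>\<^bsub>free_alg (gl_basis m0 m1 n)\<^esub> free_gen x"

text \<open>The product, in list order, of the generators $e_{a,b}$ for \<open>(a, b)\<close> in the list.\<close>

definition U_prod :: "nat \<Rightarrow> nat \<Rightarrow> nat \<Rightarrow> (letter \<times> letter) list \<Rightarrow> U_elt" where
  "U_prod m0 m1 n xs = foldr (\<lambda>x u. U_gen m0 m1 n x \<otimes>\<^bsub>U_super m0 m1 n\<^esub> u) xs \<one>\<^bsub>U_super m0 m1 n\<^esub>"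

text \<open>The word \<open>[(a\<^sub>1, b\<^sub>1), \<dots>, (a\<^sub>m, b\<^sub>m)]\<close> describes the product
  $e_{a_m,b_m} \cdots e_{a_1,b_1}$, hence the reversal below.\<close>

definition irregular_word :: "nat \<Rightarrow> nat \<Rightarrow> (letter \<times> letter) list \<Rightarrow> bool" where
  "irregular_word m0 m1 xs \<longleftrightarrow>
     (\<exists>i \<in> {1..length xs}. \<exists>\<gamma> \<in> virtual_letters m0 m1.
        card {j \<in> {1..i}. snd (xs ! (j - 1)) = \<gamma>} > card {j \<in> {1..<i}. fst (xs ! (j - 1)) = \<gamma>})"

definition irregular_products :: "nat \<Rightarrow> nat \<Rightarrow> nat \<Rightarrow> U_elt set" where
  "irregular_products m0 m1 n =
     {U_prod m0 m1 n (rev xs) | xs. set xs \<subseteq> gl_basis m0 m1 n \<and> irregular_word m0 m1 xs}"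

definition left_ideal :: "'a set \<Rightarrow> ('a, 'b) ring_scheme \<Rightarrow> bool" where
  "left_ideal I R \<longleftrightarrow> additive_subgroup I R \<and> (\<forall>x \<in> carrier R. \<forall>a \<in> I. x \<otimes>\<^bsub>R\<^esub> a \<in> I)"

definition Irr :: "nat \<Rightarrow> nat \<Rightarrow> nat \<Rightarrow> U_elt set" where
  "Irr m0 m1 n =
     \<Inter> {I. left_ideal I (U_super m0 m1 n) \<and> irregular_products m0 m1 n \<subseteq> I}"

text \<open>The projection of $\mathbf U(gl(n)) \oplus \mathbf{Irr}$ to the first summand.
  It is unspecified outside of this subalgebra.\<close>

definition virt_proj :: "nat \<Rightarrow> nat \<Rightarrow> nat \<Rightarrow> U_elt \<Rightarrow> U_elt" where
  "virt_proj m0 m1 n x =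
     (THE u. u \<in> carrier (U_gl n) \<and> x \<ominus>\<^bsub>U_super m0 m1 n\<^esub> U_incl m0 m1 n u \<in> Irr m0 m1 n)"


section \<open>Capelli and Young-Capelli bitableaux\<close>

definition tab_prod ::
    "nat \<Rightarrow> nat \<Rightarrow> nat \<Rightarrow> letter list list \<Rightarrow> letter list list \<Rightarrow> U_elt" where
  "tab_prod m0 m1 n S T = U_prod m0 m1 n (zip (concat S) (concat T))"

definition proper_tab :: "nat list list \<Rightarrow> letter list list" where
  "proper_tab T = map (map Proper) T"

definition C_tab :: "nat list \<Rightarrow> letter list list" where
  "C_tab l = map (\<lambda>r. replicate (l ! r) (Alpha (Suc r))) [0..<nrows l]"

definition D_tab :: "nat list \<Rightarrow> letter list list" where
  "D_tab l = map (\<lambda>k. map (\<lambda>c. Beta (Suc c)) [0..<k]) l"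

definition capelli_bitableau ::
    "nat \<Rightarrow> nat \<Rightarrow> nat \<Rightarrow> nat list list \<Rightarrow> nat list list \<Rightarrow> U_elt" where
  "capelli_bitableau m0 m1 n S T = virt_proj m0 m1 n
     (tab_prod m0 m1 n (proper_tab S) (C_tab (shape S))
      \<otimes>\<^bsub>U_super m0 m1 n\<^esub> tab_prod m0 m1 n (C_tab (shape S)) (proper_tab T))"

definition young_capelli_bitableau ::
    "nat \<Rightarrow> nat \<Rightarrow> nat \<Rightarrow> nat list list \<Rightarrow> nat list list \<Rightarrow> U_elt" where
  "young_capelli_bitableau m0 m1 n S T = virt_proj m0 m1 n
     (tab_prod m0 m1 n (proper_tab S) (C_tab (shape S))
      \<otimes>\<^bsub>U_super m0 m1 n\<^esub> tab_prod m0 m1 n (C_tab (shape S)) (D_tab (shape S))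
      \<otimes>\<^bsub>U_super m0 m1 n\<^esub> tab_prod m0 m1 n (D_tab (shape S)) (proper_tab T))"

text \<open>No fixed $m_0$ suffices for all shapes, so ``sufficiently large'' depends on the shape:
  the letters occurring in \<open>C_tab l\<close> and \<open>D_tab l\<close> must be available.\<close>

definition enough_virtual :: "nat \<Rightarrow> nat \<Rightarrow> nat list \<Rightarrow> bool" where
  "enough_virtual m0 m1 l \<longleftrightarrow> nrows l \<le> m0 \<and> ncols l \<le> m1"


section \<open>The ambient algebras are well-defined\<close>

lemma ring_free_alg: "ring (free_alg B)"
proof (rule ringI)
  show "abelian_group (free_alg B)"
  proof (rule abelian_groupI)
    fix x y assume "x \<in> carrier (free_alg B)" "y \<in> carrier (free_alg B)"
    then show "x \<oplus>\<^bsub>free_alg B\<^esub> y \<in> carrier (free_alg B)"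
      using keys_add[of x y] by (auto simp: free_alg_def)
  next
    fix x assume "x \<in> carrier (free_alg B)"
    then show "\<exists>y\<in>carrier (free_alg B). y \<oplus>\<^bsub>free_alg B\<^esub> x = \<zero>\<^bsub>free_alg B\<^esub>"
      by (intro bexI[of _ "- x"]) (auto simp: free_alg_def)
  qed (auto simp: free_alg_def ac_simps)
  have cl: "f * g \<in> carrier (free_alg B)"
    if f: "f \<in> carrier (free_alg B)" and g: "g \<in> carrier (free_alg B)" for f g
  proof -
    have "set (unWord w) \<subseteq> B" if w: "w \<in> Poly_Mapping.keys (f * g)" for w
    proof -
      from subsetD[OF keys_mult w] obtain a b
        where "w = a + b" "a \<in> Poly_Mapping.keys f" "b \<in> Poly_Mapping.keys g"
        by auto
      then show ?thesis
        using f g by (auto simp: free_alg_def plus_free_word_def)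
    qed
    then show ?thesis by (simp add: free_alg_def)
  qed
  show "monoid (free_alg B)"
  proof (rule monoidI)
    show "x \<otimes>\<^bsub>free_alg B\<^esub> y \<in> carrier (free_alg B)"
      if "x \<in> carrier (free_alg B)" "y \<in> carrier (free_alg B)" for x y
      using cl[OF that] by (simp add: free_alg_def)
    show "\<one>\<^bsub>free_alg B\<^esub> \<in> carrier (free_alg B)"
      by (simp add: free_alg_def zero_free_word_def del: single_one flip: single_one)
  qed (simp_all add: free_alg_def mult.assoc)
qed (auto simp: free_alg_def algebra_simps)

lemma cring_poly_alg: "cring (poly_alg n)"
proof (rule cringI)
  show "abelian_group (poly_alg n)"
  proof (rule abelian_groupI)
    fix x y assume "x \<in> carrier (poly_alg n)" "y \<in> carrier (poly_alg n)"
    then show "x \<oplus>\<^bsub>poly_alg n\<^esub> y \<in> carrier (poly_alg n)"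
      using keys_add[of x y] unfolding poly_alg_def by fastforce
  next
    fix x assume "x \<in> carrier (poly_alg n)"
    then show "\<exists>y\<in>carrier (poly_alg n). y \<oplus>\<^bsub>poly_alg n\<^esub> x = \<zero>\<^bsub>poly_alg n\<^esub>"
      by (intro bexI[of _ "- x"]) (auto simp: poly_alg_def)
  qed (auto simp: poly_alg_def ac_simps)
  have cl: "f * g \<in> carrier (poly_alg n)"
    if f: "f \<in> carrier (poly_alg n)" and g: "g \<in> carrier (poly_alg n)" for f g
  proof -
    have "Poly_Mapping.keys m \<subseteq> {1..n} \<times> {1..n}" if m: "m \<in> Poly_Mapping.keys (f * g)" for m
    proof -
      from subsetD[OF keys_mult m] obtain a b
        where "m = a + b" "a \<in> Poly_Mapping.keys f" "b \<in> Poly_Mapping.keys g"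
        by auto
      then show ?thesis
        using f g keys_add[of a b] unfolding poly_alg_def by fastforce
    qed
    then show ?thesis by (simp add: poly_alg_def)
  qed
  show "Group.comm_monoid (poly_alg n)"
  proof (rule comm_monoidI)
    show "x \<otimes>\<^bsub>poly_alg n\<^esub> y \<in> carrier (poly_alg n)"
      if "x \<in> carrier (poly_alg n)" "y \<in> carrier (poly_alg n)" for x y
      using cl[OF that] by (simp add: poly_alg_def)
    show "\<one>\<^bsub>poly_alg n\<^esub> \<in> carrier (poly_alg n)"
      by (simp add: poly_alg_def)
  qed (simp_all add: poly_alg_def ac_simps)
qed (auto simp: poly_alg_def algebra_simps)

lemma single_zero_in_free_alg: "Poly_Mapping.single 0 c \<in> carrier (free_alg B)"
  by (auto simp: free_alg_def zero_free_word_def)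

lemma single_zero_in_poly_alg: "Poly_Mapping.single 0 c \<in> carrier (poly_alg n)"
  by (auto simp: poly_alg_def)

lemma vectorspace_poly_alg: "vectorspace class_ring (poly_alg n)"
proof -
  interpret A: cring "poly_alg n" by (rule cring_poly_alg)
  have "module class_ring (poly_alg n)"
  proof (rule moduleI)
    show "cring (class_ring :: complex ring)"
      using class_field[where 'a = complex] by (simp add: field_def domain_def)
    show "abelian_group (poly_alg n)" ..
    show "c \<odot>\<^bsub>poly_alg n\<^esub> x \<in> carrier (poly_alg n)" if "x \<in> carrier (poly_alg n)" for c x
      using A.m_closed[OF single_zero_in_poly_alg[of c] that] by (simp add: poly_alg_def)
    show "(c \<otimes>\<^bsub>class_ring\<^esub> d) \<odot>\<^bsub>poly_alg n\<^esub> x =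
        c \<odot>\<^bsub>poly_alg n\<^esub> (d \<odot>\<^bsub>poly_alg n\<^esub> x)" for c d x
      using mult_single[of "0 :: (nat \<times> nat) \<Rightarrow>\<^sub>0 nat" c 0 d]
      by (simp add: poly_alg_def flip: mult.assoc)
  qed (simp_all add: poly_alg_def distrib_left distrib_right single_add)
  then show ?thesis
    using class_field[where 'a = complex] by (simp add: vectorspace_def)
qed

context
  fixes B :: "'g set" and par :: "'g \<Rightarrow> nat" and br :: "'g \<Rightarrow> 'g \<Rightarrow> ('g \<Rightarrow>\<^sub>0 complex)"
  assumes br_closed: "\<And>x y. x \<in> B \<Longrightarrow> y \<in> B \<Longrightarrow> Poly_Mapping.keys (br x y) \<subseteq> B"
begin

lemma ideal_env_ideal: "ideal (env_ideal B par br) (free_alg B)"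
proof -
  interpret F: ring "free_alg B" by (rule ring_free_alg)
  have gen: "free_gen x \<in> carrier (free_alg B)" if "x \<in> B" for x
    using that by (simp add: free_alg_def free_gen_def)
  have sum: "sum f A \<in> carrier (free_alg B)" if "\<And>x. x \<in> A \<Longrightarrow> f x \<in> carrier (free_alg B)" 
    for f and A :: "'g set"
    using that
  proof (induction A rule: infinite_finite_induct)
    case (insert y A)
    have "f y \<in> carrier (free_alg B)" "sum f A \<in> carrier (free_alg B)"
      by (rule insert.prems, simp) (rule insert.IH, rule insert.prems, simp)
    from F.a_closed[OF this] show ?case
      using insert.hyps by (simp add: free_alg_def)
  qed (simp_all add: free_alg_def)
  show ?thesis
    unfolding env_ideal_def
  proof (rule F.genideal_ideal)
    have "free_gen x * free_gen y - (- 1) ^ (par x * par y) * (free_gen y * free_gen x) 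
            - free_lin (br x y) \<in> carrier (free_alg B)" if xy: "x \<in> B" "y \<in> B" for x y
    proof -
      have m: "f * g \<in> carrier (free_alg B)" "f + g \<in> carrier (free_alg B)"
        if "f \<in> carrier (free_alg B)" "g \<in> carrier (free_alg B)" for f g
        using F.m_closed[OF that] F.a_closed[OF that] by (simp_all add: free_alg_def)
      have neg: "- f \<in> carrier (free_alg B)" if "f \<in> carrier (free_alg B)" for f
        using that by (simp add: free_alg_def)
      have lin: "free_lin (br x y) \<in> carrier (free_alg B)"
        unfolding free_lin_def
        by (intro sum m single_zero_in_free_alg gen) (use br_closed xy in auto)
      have pw: "(- 1) ^ k \<in> carrier (free_alg B)" for k
      proof (induction k)
        case 0
        show ?case
          using F.one_closed by (simp add: free_alg_def)
      next
        case (Suc k)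
        have one: "1 \<in> carrier (free_alg B)"
          using F.one_closed by (simp add: free_alg_def)
        show ?case
          unfolding power_Suc by (rule m(1)[OF neg[OF one] Suc])
      qed
      show ?thesis
        unfolding diff_conv_add_uminus by (intro m neg lin pw gen xy)
    qed
    then show "{free_gen x * free_gen y - (- 1) ^ (par x * par y) * (free_gen y * free_gen x) 
            - free_lin (br x y) |x y. x \<in> B \<and> y \<in> B} \<subseteq> carrier (free_alg B)"
      by blast
  qed
qed

lemma env_alg_simps:
  "carrier (env_alg B par br) = carrier (free_alg B Quot env_ideal B par br)"
  "mult (env_alg B par br) = mult (free_alg B Quot env_ideal B par br)"
  "one (env_alg B par br) = one (free_alg B Quot env_ideal B par br)"
  "zero (env_alg B par br) = zero (free_alg B Quot env_ideal B par br)"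
  "add (env_alg B par br) = add (free_alg B Quot env_ideal B par br)"
  "smult (env_alg B par br) = (\<lambda>c. mult (free_alg B Quot env_ideal B par br)
     (env_ideal B par br +>\<^bsub>free_alg B\<^esub> Poly_Mapping.single 0 c))"
  by (simp_all add: env_alg_def Let_def)

lemma ring_env_alg: "ring (env_alg B par br)"
proof -
  interpret ideal "env_ideal B par br" "free_alg B" by (rule ideal_env_ideal)
  interpret Q: ring "free_alg B Quot env_ideal B par br" by (rule quotient_is_ring)
  show ?thesis
  proof (rule ringI)
    show "abelian_group (env_alg B par br)"
      by (rule abelian_groupI, unfold env_alg_simps)
        (erule (2) Q.a_closed Q.a_assoc | erule (1) Q.a_closed Q.a_comm | rule Q.zero_closed
          | erule Q.l_zero | erule Q.add.l_inv_ex[simplified])+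
    show "monoid (env_alg B par br)"
      by (rule monoidI) (auto simp: env_alg_simps Q.m_assoc)
  qed (auto simp: env_alg_simps Q.l_distr Q.r_distr)
qed

lemma vectorspace_env_alg: "vectorspace class_ring (env_alg B par br)"
proof -
  interpret ideal "env_ideal B par br" "free_alg B" by (rule ideal_env_ideal)
  interpret Q: ring "free_alg B Quot env_ideal B par br" by (rule quotient_is_ring)
  interpret E: ring "env_alg B par br" by (rule ring_env_alg)
  interpret h: ring_hom_ring "free_alg B" "free_alg B Quot env_ideal B par br"
    "(+>\<^bsub>free_alg B\<^esub>) (env_ideal B par br)"
    by (rule rcos_ring_hom_ring)
  let ?s = "\<lambda>c. env_ideal B par br +>\<^bsub>free_alg B\<^esub> Poly_Mapping.single 0 c"
  have s: "?s c \<in> carrier (free_alg B Quot env_ideal B par br)" for c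
    by (rule h.hom_closed) (rule single_zero_in_free_alg)
  have add: "?s (c + d) = ?s c \<oplus>\<^bsub>free_alg B Quot env_ideal B par br\<^esub> ?s d" for c d
    using h.hom_add[OF single_zero_in_free_alg[of c] single_zero_in_free_alg[of d]]
    by (simp add: free_alg_def single_add)
  have mult: "?s (c * d) = ?s c \<otimes>\<^bsub>free_alg B Quot env_ideal B par br\<^esub> ?s d" for c d
    using h.hom_mult[OF single_zero_in_free_alg[of c] single_zero_in_free_alg[of d]]
    by (simp add: free_alg_def mult_single)
  have one: "?s 1 = \<one>\<^bsub>free_alg B Quot env_ideal B par br\<^esub>"
    using h.hom_one by (simp add: free_alg_def)
  have "module class_ring (env_alg B par br)"
  proof (rule moduleI)
    show "cring (class_ring :: complex ring)"
      using class_field[where 'a = complex] by (simp add: field_def domain_def)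
    show "abelian_group (env_alg B par br)" ..
    show "\<one>\<^bsub>class_ring\<^esub> \<odot>\<^bsub>env_alg B par br\<^esub> x = x" if "x \<in> carrier (env_alg B par br)" for x
      using that Q.l_one unfolding env_alg_simps by (simp only: one monoid.simps)
  qed (simp_all add: env_alg_simps add mult s Q.l_distr Q.r_distr Q.m_assoc
      del: h.hom_add h.hom_mult h.hom_one)
  then show ?thesis
    using class_field[where 'a = complex] by (simp add: vectorspace_def)
qed

end

lemma gl_bracket_closed:
  assumes "x \<in> gl_basis m0 m1 n" "y \<in> gl_basis m0 m1 n"
  shows "Poly_Mapping.keys (gl_bracket x y) \<subseteq> gl_basis m0 m1 n"
proof -
  have "Poly_Mapping.keys (f - g) \<subseteq> A" if "Poly_Mapping.keys f \<subseteq> A" "Poly_Mapping.keys g \<subseteq> A"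
    for f g :: "(letter \<times> letter) \<Rightarrow>\<^sub>0 complex" and A
    using that keys_diff[of f g] by blast
  moreover obtain a b c d where "x = (a, b)" "y = (c, d)"
    by (cases x, cases y)
  ultimately show ?thesis
    using assms by (simp add: gl_bracket_def gl_basis_def)
qed

lemma ring_U_super: "ring (U_super m0 m1 n)"
  unfolding U_super_def by (rule ring_env_alg) (rule gl_bracket_closed)

lemma vectorspace_U_super: "vectorspace class_ring (U_super m0 m1 n)"
  unfolding U_super_def by (rule vectorspace_env_alg) (rule gl_bracket_closed)


section \<open>The bitableaux correspondence and the Koszul map\<close>

text \<open>Membership in \<open>extensional\<close> only fixes the values outside of the carrier, as needed for
  uniqueness.\<close>

definition bitableaux_corr :: "nat \<Rightarrow> mpoly \<Rightarrow> U_elt" where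
  "bitableaux_corr n =
     (THE \<Phi>. linear_map class_ring (poly_alg n) (U_gl n) \<Phi>
        \<and> \<Phi> \<in> extensional (carrier (poly_alg n))
        \<and> (\<forall>S \<in> tableaux {1..n}. \<forall>T \<in> tableaux {1..n}. shape S = shape T \<longrightarrow>
             (\<forall>m0 m1. enough_virtual m0 m1 (shape S) \<longrightarrow>
                \<Phi> (bitableau S T) = capelli_bitableau m0 m1 n S T)))"

definition koszul_map :: "nat \<Rightarrow> U_elt \<Rightarrow> mpoly" where
  "koszul_map n = inv_into (carrier (poly_alg n)) (bitableaux_corr n)"

end

theory Submission
  imports Defs
begin

text \<open>The left module \<open>U/Irr\<close> has a vacuum vector killed by all \<open>e\<^sub>a\<^sub>,\<^sub>\<gamma>\<close> with \<open>\<gamma>\<close> virtual, and is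
  isomorphic to the supersymmetric algebra in the variables \<open>(a|j)\<close>, \<open>j\<close> proper: \<open>e\<^sub>a\<^sub>,\<^sub>b\<close> acts as the
  superpolarization sending the row letter \<open>b\<close> to \<open>a\<close>, plus multiplication by \<open>(a|b)\<close> when \<open>b\<close> is proper.
  Evaluating on the vacuum restricts to the Koszul map on \<open>U(gl(n))\<close>, its inverse is normal ordering; this
  gives both the injectivity behind the projection \<open>virt_proj\<close> and the isomorphism with the polynomials.
  Under this identification \<open>[S|T]\<close> becomes the result of polarizing the monomial of \<open>C\<close> over \<open>T\<close> by
  the letters of \<open>S\<close>, which is a Laplace expansion of \<open>(S|T)\<close>. In \<open>[S|T]\<close> with symmetrized columns, the
  operators of \<open>C\<close> over \<open>D\<close> first replace the monomial of \<open>D\<close> over \<open>T\<close> by the sum of the monomials of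
  \<open>C\<close> over all column permutations of \<open>T\<close>, and the claim follows by linearity.\<close>

text \<open>All computation takes place on representatives in the free algebra. Acting on the vacuum
  and normal ordering become linear self-maps \<open>vac\<close> and \<open>nord\<close> of it; on
  the span of words in the variables \<open>(a|j)\<close> they are mutually inverse on the nose.
  Only their effect on relations is controlled modulo an ideal: \<open>vac\<close> sends the
  relations of the enveloping algebra to supercommutators, and \<open>nord\<close> sends
  supercommutators back to relations. This exchange does the work of a Poincare-Birkhoff-Witt
  theorem.

  The obstacle is that vanishing is detected with virtual letters present but has to be concluded
  without them. The map \<open>symb\<close>, which sets every variable with a virtual letter to
  zero, bridges the gap: it kills the large supercommutator ideal, and its kernel on proper words is
  the small one. Since U(gl(n)) is the case \<open>m0 = m1 = 0\<close>, each general statement also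
  serves there.

  Both \<open>virt_proj\<close> and \<open>bitableaux_corr\<close> are definite descriptions, so
  existence and uniqueness come before any evaluation; the witness for the second is
  \<open>corr\<close>, which lifts a polynomial to a sum of words and normally orders it.\<close>

abbreviation cst :: "complex \<Rightarrow> 'a::monoid_add \<Rightarrow>\<^sub>0 complex" where
  "cst c \<equiv> Poly_Mapping.single 0 c"

lemma poly_mapping_eq_sum_single:
  fixes f :: "'a \<Rightarrow>\<^sub>0 complex"
  shows "f = (\<Sum>k \<in> Poly_Mapping.keys f. Poly_Mapping.single k (Poly_Mapping.lookup f k))"
proof (rule poly_mapping_eqI)
  fix k
  show "Poly_Mapping.lookup f k =
      Poly_Mapping.lookup (\<Sum>k\<in>Poly_Mapping.keys f. Poly_Mapping.single k (Poly_Mapping.lookup f k)) k"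
    by (simp add: lookup_sum lookup_single when_def sum.delta in_keys_iff)
qed

lemma poly_mapping_single_induct [case_names single add]:
  fixes f :: "'a \<Rightarrow>\<^sub>0 complex"
  assumes single: "\<And>k c. P (Poly_Mapping.single k c)"
    and add: "\<And>f g. P f \<Longrightarrow> P g \<Longrightarrow> P (f + g)"
  shows "P f"
proof -
  have "P (\<Sum>k \<in> K. Poly_Mapping.single k (Poly_Mapping.lookup f k))" for K
  proof (induction K rule: infinite_finite_induct)
    case (insert k K)
    then show ?case by (simp add: add single)
  \<comment> \<open>The empty sum is a \<open>single\<close> with coefficient 0, so no separate case
    for zero appears in the rule.\<close>
  qed (use single[of undefined 0] in simp_all)
  then show ?thesis
    using poly_mapping_eq_sum_single[of f] by metis
qed

lemma cst_commute: "cst c * f = f * cst c"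
  by (induction f rule: poly_mapping_single_induct) (simp_all add: mult_single mult.commute algebra_simps)

section \<open>Linear extension of functions on basis elements\<close>

definition lin :: "('a \<Rightarrow> ('k::monoid_add \<Rightarrow>\<^sub>0 complex)) \<Rightarrow> ('a \<Rightarrow>\<^sub>0 complex) \<Rightarrow> ('k \<Rightarrow>\<^sub>0 complex)" where
  "lin g f = (\<Sum>w \<in> Poly_Mapping.keys f. cst (Poly_Mapping.lookup f w) * g w)"

lemma lin_superset:
  assumes "finite K" "Poly_Mapping.keys f \<subseteq> K"
  shows "lin g f = (\<Sum>w \<in> K. cst (Poly_Mapping.lookup f w) * g w)"
  unfolding lin_def using assms
  by (intro sum.mono_neutral_left) (auto simp: in_keys_iff)

lemma lin_zero [simp]: "lin g 0 = 0"
  by (simp add: lin_def)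

lemma lin_add: "lin g (f + h) = lin g f + lin g h"
proof -
  let ?K = "Poly_Mapping.keys f \<union> Poly_Mapping.keys h"
  have "finite ?K" by simp
  then show ?thesis
    using keys_add[of f h] by (simp add: lin_superset[of ?K] lookup_add single_add distrib_right sum.distrib)
qed

lemma lin_single: "lin g (Poly_Mapping.single w c) = cst c * g w"
  by (cases "c = 0") (simp_all add: lin_def)

lemma lin_cst: "lin g (cst c * f) = cst c * lin g f"
proof (induction f rule: poly_mapping_single_induct)
  case (single k d)
  show ?case
    by (simp add: mult_single lin_single flip: mult.assoc)
qed (simp add: lin_add distrib_left)

lemma lin_uminus: "lin g (- f) = - lin g f"
proof -
  have "lin g (- f) + lin g f = lin g (- f + f)"
    by (rule lin_add[symmetric])
  then show ?thesis
    by (simp add: eq_neg_iff_add_eq_0)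
qed

lemma lin_diff: "lin g (f - h) = lin g f - lin g h"
  using lin_add[of g f "- h"] by (simp add: lin_uminus)

lemma lin_sum: "lin g (sum f I) = (\<Sum>i \<in> I. lin g (f i))"
  by (induction I rule: infinite_finite_induct) (simp_all add: lin_add)

lemma lin_cong: "(\<And>w. w \<in> Poly_Mapping.keys f \<Longrightarrow> g w = h w) \<Longrightarrow> lin g f = lin h f"
  by (simp add: lin_def)

lemmas lin_simps = lin_add lin_diff lin_uminus lin_cst lin_sum

section \<open>Superpolarizations of the free algebra\<close>

type_synonym gl = "letter \<times> letter"

definition gens :: "'g list \<Rightarrow> 'g free_elt" where
  "gens xs = Poly_Mapping.single (Word xs) 1"

lemma gens_Nil: "gens [] = 1"
  by (simp add: gens_def zero_free_word_def flip: single_one)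

lemma gens_append: "gens (xs @ ys) = gens xs * gens ys"
  by (simp add: gens_def mult_single plus_free_word_def)

lemma gens_Cons: "gens (x # xs) = free_gen x * gens xs"
  by (simp add: gens_def mult_single plus_free_word_def free_gen_def)

lemma free_gen_eq_gens: "free_gen x = gens [x]"
  by (simp add: gens_def free_gen_def)

lemma single_eq_gens: "Poly_Mapping.single w c = cst c * gens (unWord w)"
  by (simp add: gens_def mult_single)

lemma lin_gens: "lin g (gens xs) = g (Word xs)"
  by (simp add: gens_def lin_single)

lemma free_elt_induct [case_names one gen add cst]:
  fixes f :: "'g free_elt"
  assumes "P 1" "\<And>x f. P f \<Longrightarrow> P (free_gen x * f)"
    "\<And>f g. P f \<Longrightarrow> P g \<Longrightarrow> P (f + g)" "\<And>c f. P f \<Longrightarrow> P (cst c * f)"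
  shows "P f"
proof (induction f rule: poly_mapping_single_induct)
  case (single w c)
  have "P (gens v)" for v :: "'g list"
  proof (induction v)
    case Nil
    show ?case unfolding gens_Nil by (rule assms)
  next
    case (Cons x v)
    show ?case unfolding gens_Cons by (rule assms(2)[OF Cons])
  qed
  then show ?case
    by (subst single_eq_gens) (rule assms(4))
qed (rule assms(3))

text \<open>The Koszul sign is an element of the free algebra, so that it multiplies expressions
  directly; \<open>ksign_cases\<close> reduces sign bookkeeping to its two values.\<close>

definition ksign :: "gl \<Rightarrow> gl \<Rightarrow> gl free_elt" where
  "ksign x y = (-1) ^ (gl_parity x * gl_parity y)"

lemma ksign_cases: "ksign x y = 1 \<or> ksign x y = -1"
  by (simp add: ksign_def minus_one_power_iff)

lemma ksign_sym: "ksign x y = ksign y x"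
  by (simp add: ksign_def mult.commute)

text \<open>The contracted letter contributes its parity twice, so the contracted generator has the
  sum of the two parities modulo 2.\<close>

lemma gl_parity_contract:
  "snd x = fst y \<Longrightarrow> even (gl_parity (fst x, snd y) + gl_parity x + gl_parity y)"
  by (auto simp: gl_parity_def split: prod.splits)

lemma ksign_contract:
  assumes "snd x = fst y"
  shows "ksign z (fst x, snd y) = ksign z x * ksign z y" "ksign (fst x, snd y) z = ksign x z * ksign y z"
proof -
  show "ksign z (fst x, snd y) = ksign z x * ksign z y"
    using gl_parity_contract[OF assms] unfolding ksign_def
    by (auto simp: minus_one_power_iff)
  then show "ksign (fst x, snd y) z = ksign x z * ksign y z"
    by (simp add: ksign_sym)
qed

text \<open>A generator \<open>(c, d)\<close> is read as the variable \<open>(c|d)\<close>, and only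
  its row letter is acted on. This is the first half of the superbracket, the natural action on row
  letters.\<close>

definition act :: "gl \<Rightarrow> gl \<Rightarrow> gl free_elt" where
  "act x y = (if snd x = fst y then free_gen (fst x, snd y) else 0)"

primrec polar_word :: "gl \<Rightarrow> gl list \<Rightarrow> gl free_elt" where
  "polar_word x [] = 0"
| "polar_word x (y # w) = act x y * gens w + ksign x y * (free_gen y * polar_word x w)"

definition polar :: "gl \<Rightarrow> gl free_elt \<Rightarrow> gl free_elt" where
  "polar x = lin (\<lambda>w. polar_word x (unWord w))"

lemma polar_gens: "polar x (gens w) = polar_word x w"
  by (simp add: polar_def lin_gens)

lemma polar_one [simp]: "polar x 1 = 0"
  using polar_gens[of x "[]"] by (simp add: gens_Nil)

lemma polar_zero [simp]: "polar x 0 = 0"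
  by (simp add: polar_def)

lemma polar_linear:
  "polar x (f + g) = polar x f + polar x g" "polar x (f - g) = polar x f - polar x g" "polar x (- f) = - polar x f"
  "polar x (cst c * f) = cst c * polar x f" "polar x (sum h I) = (\<Sum>i\<in>I. polar x (h i))"
  by (simp_all add: polar_def lin_simps)

lemma gen_cst: "free_gen x * (cst c * f) = cst c * (free_gen x * f)"
  by (metis cst_commute mult.assoc)

lemma act_cst: "act x y * (cst c * f) = cst c * (act x y * f)"
  by (simp add: act_def gen_cst)

lemma ksign_cst: "ksign x y * (cst c * f) = cst c * (ksign x y * f)"
  using ksign_cases[of x y] by auto

lemma polar_gen: "polar x (free_gen y * f) = act x y * f + ksign x y * (free_gen y * polar x f)"
proof (induction f rule: poly_mapping_single_induct)
  case (single w c)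
  show ?case
    apply (subst (1 2 3) single_eq_gens[of w c])
    unfolding gen_cst polar_linear act_cst ksign_cst
    by (simp add: gens_Cons[symmetric] polar_gens distrib_left)
qed (simp add: polar_linear algebra_simps)

lemma polar_act: "polar x (act y z * f) = (if snd y = fst z then act x (fst y, snd z) * f 
   + ksign x y * (ksign x z * (act y z * polar x f)) else 0)"
  by (auto simp: act_def polar_gen ksign_contract mult.assoc)

lemma polar_ksign: "polar x (ksign y z * f) = ksign y z * polar x f"
  using ksign_cases[of y z] by (auto simp: polar_linear)

text \<open>Polarizations represent the Lie superalgebra: a supercommutator of superderivations is a
  superderivation, so it is determined on generators, where it is the natural action of the bracket.
  The induction peels off one generator \<open>z\<close>; once signs and coincidences of letters are
  fixed, each case is plain algebra.\<close>

lemma polar_commute: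
  "polar x (polar y f) = ksign x y * polar y (polar x f) + (if snd x = fst y then polar (fst x, snd y) f else 0)
     - (if fst x = snd y then ksign x y * polar (fst y, snd x) f else 0)"
proof (induction f rule: free_elt_induct)
  case (gen z f)
  have "snd x = fst y \<Longrightarrow> ksign (fst x, snd y) z = ksign x z * ksign y z"
    "fst x = snd y \<Longrightarrow> ksign (fst y, snd x) z = ksign x z * ksign y z"
    using ksign_cases[of x z] ksign_cases[of y z] by (auto simp: ksign_contract)
  then show ?case
    unfolding polar_gen polar_linear polar_act polar_ksign gen ksign_sym[of y x]
    using ksign_cases[of x y] ksign_cases[of x z] ksign_cases[of y z]
    by (elim disjE; cases "snd x = fst y"; cases "fst x = snd y"; cases "snd y = fst z";
        cases "snd x = fst z"; simp add: act_def algebra_simps)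
next
  case (add f g)
  show ?case
    unfolding polar_linear add by (simp add: algebra_simps)
next
  case (cst c f)
  show ?case
    unfolding polar_linear cst by (simp add: algebra_simps ksign_cst)
qed simp

section \<open>The supercommutator ideal\<close>

text \<open>The degree bounds in \<open>deg_le\<close> and \<open>scomm\<close> serve as induction measures: normal ordering of
  \<open>free_gen x * f\<close> recurses on \<open>polar x f\<close>, which is not a part of \<open>f\<close> but has the same degree.\<close>

inductive deg_le :: "gl set \<Rightarrow> nat \<Rightarrow> gl free_elt \<Rightarrow> bool" for A where
  deg_le_cst: "deg_le A k (cst c)"
| deg_le_gen: "x \<in> A \<Longrightarrow> deg_le A k f \<Longrightarrow> deg_le A (Suc k) (free_gen x * f)"
| deg_le_add: "deg_le A k f \<Longrightarrow> deg_le A k g \<Longrightarrow> deg_le A k (f + g)"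

lemma deg_le_zero: "deg_le A k 0"
  using deg_le_cst[of A k 0] by simp

lemma deg_le_one: "deg_le A k 1"
  using deg_le_cst[of A k 1] by simp

lemma deg_le_scale: "deg_le A k f \<Longrightarrow> deg_le A k (cst c * f)"
proof (induction rule: deg_le.induct)
  case (deg_le_cst k d)
  show ?case by (simp add: mult_single deg_le.deg_le_cst)
next
  case (deg_le_gen x k f)
  then show ?case by (metis gen_cst deg_le.deg_le_gen)
qed (simp add: distrib_left deg_le.deg_le_add)

lemma deg_le_uminus: "deg_le A k f \<Longrightarrow> deg_le A k (- f)"
  using deg_le_scale[of A k f "-1"] by (simp add: single_uminus)

lemma deg_le_diff: "deg_le A k f \<Longrightarrow> deg_le A k g \<Longrightarrow> deg_le A k (f - g)"
  using deg_le_add[OF _ deg_le_uminus, of A k f g] by simp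

lemma deg_le_ksign: "deg_le A k f \<Longrightarrow> deg_le A k (ksign x y * f)"
  using ksign_cases[of x y] by (auto intro: deg_le_uminus)

lemma deg_le_Suc: "deg_le A k f \<Longrightarrow> deg_le A (Suc k) f"
  by (induction rule: deg_le.induct) (auto intro: deg_le.intros)

lemma deg_le_mono: "deg_le A k f \<Longrightarrow> k \<le> m \<Longrightarrow> deg_le A m f"
  by (induction m rule: nat_induct) (auto intro: deg_le_Suc simp: le_Suc_eq)

lemma deg_le_subset: "deg_le A k f \<Longrightarrow> A \<subseteq> B \<Longrightarrow> deg_le B k f"
  by (induction rule: deg_le.induct) (auto intro: deg_le.intros)

lemma deg_le_mult: "deg_le A k f \<Longrightarrow> deg_le A m g \<Longrightarrow> deg_le A (k + m) (f * g)"
proof (induction rule: deg_le.induct)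
  case (deg_le_cst k c)
  then show ?case by (auto intro: deg_le_scale deg_le_mono)
next
  case (deg_le_gen x k f)
  then show ?case by (auto intro: deg_le.deg_le_gen simp: mult.assoc)
qed (auto simp: distrib_right intro: deg_le.deg_le_add)

lemma deg_le_gens: "set w \<subseteq> A \<Longrightarrow> deg_le A (length w) (gens w)"
  by (induction w) (auto simp: gens_Nil gens_Cons intro: deg_le_one deg_le_gen)

lemma carrier_free_alg_iff: "f \<in> carrier (free_alg A) \<longleftrightarrow> (\<exists>k. deg_le A k f)"
proof
  assume f: "f \<in> carrier (free_alg A)"
  have "\<exists>k. deg_le A k (sum (\<lambda>k. Poly_Mapping.single k (Poly_Mapping.lookup f k)) K)"
    if "K \<subseteq> Poly_Mapping.keys f" for K
    using finite_subset[OF that finite_keys] that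
  proof (induction K rule: finite_induct)
    case empty
    then show ?case by (auto intro: deg_le_zero)
  next
    case (insert w K)
    then obtain k where k: "deg_le A k (sum (\<lambda>k. Poly_Mapping.single k (Poly_Mapping.lookup f k)) K)"
      by auto
    have "set (unWord w) \<subseteq> A"
      using insert.prems f by (auto simp: free_alg_def)
    then have w: "deg_le A (length (unWord w)) (Poly_Mapping.single w (Poly_Mapping.lookup f w))"
      by (subst single_eq_gens) (intro deg_le_scale deg_le_gens)
    show ?case
      using deg_le_add[OF deg_le_mono[OF k] deg_le_mono[OF w], of "max k (length (unWord w))"] insert.hyps
      by (auto simp: add.commute)
  qed
  from this[of "Poly_Mapping.keys f"] show "\<exists>k. deg_le A k f"
    using poly_mapping_eq_sum_single[of f] by simp
next
  interpret F: ring "free_alg A" by (rule ring_free_alg)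
  assume "\<exists>k. deg_le A k f"
  then obtain k where "deg_le A k f" ..
  then show "f \<in> carrier (free_alg A)"
  proof (induction rule: deg_le.induct)
    case (deg_le_cst k c)
    show ?case by (rule single_zero_in_free_alg)
  next
    case (deg_le_gen x k f)
    have "free_gen x \<in> carrier (free_alg A)"
      using deg_le_gen by (simp add: free_alg_def free_gen_def)
    from F.m_closed[OF this deg_le_gen.IH] show ?case by (simp add: free_alg_def)
  next
    case (deg_le_add k f g)
    from F.a_closed[OF deg_le_add.IH] show ?case by (simp add: free_alg_def)
  qed
qed

lemma free_alg_induct [consumes 1, case_names cst gen add]:
  fixes A :: "gl set"
  assumes "f \<in> carrier (free_alg A)"
    and "\<And>c. P (cst c)"
    and "\<And>x f. x \<in> A \<Longrightarrow> f \<in> carrier (free_alg A) \<Longrightarrow> P f \<Longrightarrow> P (free_gen x * f)"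
    and "\<And>f g. f \<in> carrier (free_alg A) \<Longrightarrow> g \<in> carrier (free_alg A) \<Longrightarrow> P f \<Longrightarrow> P g \<Longrightarrow> P (f + g)"
  shows "P f"
proof -
  from assms(1) obtain k where "deg_le A k f"
    by (auto simp: carrier_free_alg_iff)
  then show ?thesis
    by (induction rule: deg_le.induct) (blast intro: assms(2-) carrier_free_alg_iff[THEN iffD2])+
qed

lemma deg_le_strong_induct [consumes 1, case_names cst gen add]:
  assumes "deg_le A k f"
    and cst: "\<And>k c. P k (cst c)"
    and gen: "\<And>k x f. x \<in> A \<Longrightarrow> (\<And>g. deg_le A k g \<Longrightarrow> P k g) \<Longrightarrow> deg_le A k f \<Longrightarrow> P (Suc k) (free_gen x * f)"
    and add: "\<And>k f g. P k f \<Longrightarrow> P k g \<Longrightarrow> P k (f + g)"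
  shows "P k f"
proof -
  have "\<forall>f. deg_le A k f \<longrightarrow> P k f"
  proof (induction k)
    case 0
    have "P 0 f" if "deg_le A k f" "k = 0" for k f
      using that by (induction rule: deg_le.induct) (auto intro: cst add)
    then show ?case by blast
  next
    case (Suc k)
    have "P (Suc k) f" if "deg_le A m f" "m = Suc k" for m f
      using that by (induction rule: deg_le.induct) (use Suc in \<open>auto intro: cst add gen\<close>)
    then show ?case by blast
  qed
  then show ?thesis using assms(1) by blast
qed

definition scommutator :: "gl \<Rightarrow> gl \<Rightarrow> gl free_elt \<Rightarrow> gl free_elt" where
  "scommutator x y f = free_gen x * (free_gen y * f) - ksign x y * (free_gen y * (free_gen x * f))"

inductive scomm :: "gl set \<Rightarrow> nat \<Rightarrow> gl free_elt \<Rightarrow> bool" for A where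
  scomm_zero: "scomm A k 0"
| scomm_scommutator: "x \<in> A \<Longrightarrow> y \<in> A \<Longrightarrow> deg_le A k f \<Longrightarrow> scomm A (Suc (Suc k)) (scommutator x y f)"
| scomm_gen: "x \<in> A \<Longrightarrow> scomm A k f \<Longrightarrow> scomm A (Suc k) (free_gen x * f)"
| scomm_cst: "scomm A k f \<Longrightarrow> scomm A k (cst c * f)"
| scomm_add: "scomm A k f \<Longrightarrow> scomm A k g \<Longrightarrow> scomm A k (f + g)"

lemma scomm_uminus: "scomm A k f \<Longrightarrow> scomm A k (- f)"
  using scomm_cst[of A k f "-1"] by (simp add: single_uminus)

lemma scomm_ksign: "scomm A k f \<Longrightarrow> scomm A k (ksign x y * f)"
  using ksign_cases[of x y] by (auto intro: scomm_uminus)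

lemma scomm_Suc: "scomm A k f \<Longrightarrow> scomm A (Suc k) f"
  by (induction rule: scomm.induct) (auto intro: scomm.intros deg_le_Suc)

lemma scomm_mono: "scomm A k f \<Longrightarrow> k \<le> m \<Longrightarrow> scomm A m f"
  by (induction m rule: nat_induct) (auto intro: scomm_Suc simp: le_Suc_eq)

text \<open>Only left multiplication is built into the inductive definition. Right multiplication is
  absorbed by the last argument of \<open>scommutator\<close>, which makes the set a two-sided
  ideal.\<close>

lemma scomm_right: "scomm A k f \<Longrightarrow> deg_le A m g \<Longrightarrow> scomm A (k + m) (f * g)"
proof (induction rule: scomm.induct)
  case (scomm_scommutator x y k f)
  have "scommutator x y f * g = scommutator x y (f * g)"
    using ksign_cases[of x y] by (auto simp: scommutator_def algebra_simps)
  moreover have "scomm A (Suc (Suc (k + m))) (scommutator x y (f * g))"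
    using scomm_scommutator by (intro scomm.scomm_scommutator deg_le_mult) auto
  ultimately show ?case by simp
next
  case (scomm_gen x k f)
  then show ?case by (auto intro: scomm.scomm_gen simp: mult.assoc)
next
  case (scomm_cst k f c)
  then show ?case by (auto intro: scomm.scomm_cst simp: mult.assoc)
qed (auto simp: distrib_right intro: scomm.scomm_add scomm.scomm_zero)

text \<open>This keeps \<open>polar x\<close> inside the free algebra on \<open>A\<close>. It holds
  for \<open>proper_basis\<close> because a polarization never touches column letters.\<close>

definition stable :: "gl \<Rightarrow> gl set \<Rightarrow> bool" where
  "stable x A \<longleftrightarrow> (\<forall>y \<in> A. snd x = fst y \<longrightarrow> (fst x, snd y) \<in> A)"

lemma deg_le_act: "stable x A \<Longrightarrow> y \<in> A \<Longrightarrow> deg_le A k f \<Longrightarrow> deg_le A (Suc k) (act x y * f)"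
  by (auto simp: act_def stable_def intro: deg_le_gen deg_le_zero)

lemma deg_le_polar: "deg_le A k f \<Longrightarrow> stable x A \<Longrightarrow> deg_le A k (polar x f)"
proof (induction rule: deg_le.induct)
  case (deg_le_cst k c)
  have "polar x (cst c) = 0"
    using polar_linear(4)[of x c 1] by simp
  then show ?case by (simp add: deg_le_zero)
next
  case (deg_le_gen y k f)
  then show ?case
    unfolding polar_gen by (intro deg_le_add deg_le_act deg_le_ksign deg_le.deg_le_gen) auto
qed (auto simp: polar_linear intro: deg_le.deg_le_add)

text \<open>A superderivation can hit either variable or \<open>f\<close>, and each of the three
  results is again a supercommutator up to sign. Hence it descends to the supersymmetric
  algebra.\<close>

lemma polar_scommutator: "polar z (scommutator x y f) = (if snd z = fst x then scommutator (fst z, snd x) y f else 0)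
    + (if snd z = fst y then ksign z x * scommutator x (fst z, snd y) f else 0)
    + ksign z x * (ksign z y * scommutator x y (polar z f))"
proof -
  have "snd z = fst x \<Longrightarrow> ksign (fst z, snd x) y = ksign z y * ksign x y"
    "snd z = fst y \<Longrightarrow> ksign x (fst z, snd y) = ksign z x * ksign x y"
    using ksign_cases[of z y] ksign_cases[of x y] by (auto simp: ksign_contract ksign_sym[of x z])
  then show ?thesis
    unfolding scommutator_def polar_gen polar_linear polar_act polar_ksign
    using ksign_cases[of x y] ksign_cases[of z x] ksign_cases[of z y]
    by (elim disjE; cases "snd z = fst x"; cases "snd z = fst y"; 
        simp add: act_def algebra_simps polar_gen)
qed

lemma scomm_polar: "scomm A k f \<Longrightarrow> stable z A \<Longrightarrow> scomm A k (polar z f)"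
proof (induction rule: scomm.induct)
  case (scomm_scommutator x y k f)
  have "scomm A (Suc (Suc k)) (if snd z = fst x then scommutator (fst z, snd x) y f else 0)"
    "scomm A (Suc (Suc k)) (if snd z = fst y then ksign z x * scommutator x (fst z, snd y) f else 0)"
    using scomm_scommutator by (auto simp: stable_def intro!: scomm.scomm_scommutator scomm_ksign scomm_zero)
  moreover have "scomm A (Suc (Suc k)) (ksign z x * (ksign z y * scommutator x y (polar z f)))"
    using scomm_scommutator by (auto intro!: scomm_ksign scomm.scomm_scommutator deg_le_polar)
  ultimately show ?case
    unfolding polar_scommutator by (intro scomm_add)
next
  case (scomm_gen x k f)
  have "scomm A (Suc k) (act z x * f)"
    using scomm_gen by (auto simp: act_def stable_def intro: scomm.scomm_gen scomm_zero)
  then show ?case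
    unfolding polar_gen using scomm_gen by (intro scomm_add scomm_ksign scomm.scomm_gen) auto
qed (auto simp: polar_linear intro: scomm.intros)

section \<open>The symbol: from the free algebra to polynomials\<close>

fun symb_var :: "gl \<Rightarrow> mpoly" where
  "symb_var (Proper i, Proper j) = matvar i j"
| "symb_var _ = 0"

text \<open>The algebra homomorphism that evaluates \<open>(i|j)\<close> at the matrix variable and
  every variable with a virtual letter at zero. Elements of U(gl(n)) create no virtual letters on
  the vacuum, so nothing is lost on them.\<close>

definition symb :: "gl free_elt \<Rightarrow> mpoly" where
  "symb = lin (\<lambda>w. prod_list (map symb_var (unWord w)))"

lemma symb_linear:
  "symb (f + g) = symb f + symb g" "symb (f - g) = symb f - symb g" "symb (- f) = - symb f"
  "symb (cst c * f) = cst c * symb f" "symb (sum h I) = (\<Sum>i\<in>I. symb (h i))"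
  by (simp_all add: symb_def lin_simps)

lemma symb_gens: "symb (gens w) = prod_list (map symb_var w)"
  by (simp add: symb_def lin_gens)

lemma symb_zero [simp]: "symb 0 = 0"
  by (simp add: symb_def)

lemma symb_one [simp]: "symb 1 = 1"
  using symb_gens[of "[]"] by (simp add: gens_Nil)

lemma symb_gen: "symb (free_gen x * f) = symb_var x * symb f"
proof (induction f rule: free_elt_induct)
  case one
  show ?case using symb_gens[of "[x]"] by (simp add: free_gen_eq_gens)
next
  case (gen y f)
  show ?case
  proof (induction f rule: poly_mapping_single_induct)
    case (single w c)
    show ?case
      apply (subst (1 2) single_eq_gens[of w c])
      unfolding gen_cst symb_linear
      by (simp add: gens_Cons[symmetric] symb_gens mult.left_commute)
  qed (simp add: symb_linear distrib_left)
qed (simp_all add: symb_linear distrib_left gen_cst mult.left_commute)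

lemma symb_mult: "symb (f * g) = symb f * symb g"
  by (induction f rule: free_elt_induct)
    (simp_all add: symb_gen symb_linear distrib_right mult.assoc)

lemma symb_ksign: "symb (ksign x y * f) = (-1) ^ (gl_parity x * gl_parity y) * symb f"
  by (auto simp: ksign_def minus_one_power_iff symb_linear)

text \<open>Two proper variables are both even, so their supercommutator is a commutator and
  vanishes among polynomials; if one of the variables has a virtual letter, both terms
  vanish.\<close>

lemma symb_scomm: "scomm A k f \<Longrightarrow> symb f = 0"
proof (induction rule: scomm.induct)
  case (scomm_scommutator x y k f)
  have "symb_var x = 0 \<or> symb_var y = 0 \<or> (even (gl_parity x) \<and> even (gl_parity y))"
    by (cases x rule: symb_var.cases; cases y rule: symb_var.cases; simp add: gl_parity_def)
  then show ?case
    by (auto simp: scommutator_def symb_linear symb_ksign symb_gen minus_one_power_iff mult.left_commute)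
qed (simp_all add: symb_linear symb_gen)

section \<open>Action on the vacuum and normal ordering\<close>

definition vac_op :: "gl \<Rightarrow> gl free_elt \<Rightarrow> gl free_elt" where
  "vac_op x f = (if snd x \<in> range Proper then free_gen x * f else 0) + polar x f"

lemma vac_op_linear:
  "vac_op x (f + g) = vac_op x f + vac_op x g" "vac_op x (f - g) = vac_op x f - vac_op x g" "vac_op x (- f) = - vac_op x f"
  "vac_op x (cst c * f) = cst c * vac_op x f" "vac_op x (sum h I) = (\<Sum>i\<in>I. vac_op x (h i))"
  by (auto simp: vac_op_def polar_linear algebra_simps gen_cst sum.distrib sum_distrib_left)

lemma vac_op_zero [simp]: "vac_op x 0 = 0"
  by (simp add: vac_op_def)

text \<open>Two multiplications fail to supercommute by \<open>scommutator x y f\<close>, a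
  polarization and a multiplication give multiplication by the contracted variable, and two
  polarizations are covered by \<open>polar_commute\<close>. Only the first is a defect, so the
  operators represent the Lie superalgebra modulo supercommutators.\<close>

lemma vac_op_commute:
  "vac_op x (vac_op y f) - ksign x y * vac_op y (vac_op x f) =
     (if snd x = fst y then vac_op (fst x, snd y) f else 0)
     - (if fst x = snd y then ksign x y * vac_op (fst y, snd x) f else 0)
     + (if snd x \<in> range Proper \<and> snd y \<in> range Proper then scommutator x y f else 0)"
  unfolding vac_op_def polar_linear
  using polar_commute[of x y f] ksign_cases[of x y]
  by (cases "snd x = fst y"; cases "fst x = snd y"; cases "snd x \<in> range Proper";
      cases "snd y \<in> range Proper"; elim disjE;
      simp add: polar_gen act_def scommutator_def algebra_simps ksign_sym[of y x])

primrec vac_word :: "gl list \<Rightarrow> gl free_elt" where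
  "vac_word [] = 1"
| "vac_word (x # w) = vac_op x (vac_word w)"

definition vac :: "gl free_elt \<Rightarrow> gl free_elt" where
  "vac = lin (\<lambda>w. vac_word (unWord w))"

lemma vac_linear:
  "vac (f + g) = vac f + vac g" "vac (f - g) = vac f - vac g" "vac (- f) = - vac f"
  "vac (cst c * f) = cst c * vac f" "vac (sum h I) = (\<Sum>i\<in>I. vac (h i))"
  by (simp_all add: vac_def lin_simps)

lemma vac_zero [simp]: "vac 0 = 0"
  by (simp add: vac_def)

lemma vac_gens: "vac (gens w) = vac_word w"
  by (simp add: vac_def lin_gens)

lemma vac_one [simp]: "vac 1 = 1"
  using vac_gens[of "[]"] by (simp add: gens_Nil)

lemma vac_cst [simp]: "vac (cst c) = cst c"
  using vac_linear(4)[of c 1] by simp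

lemma vac_gen: "vac (free_gen x * f) = vac_op x (vac f)"
proof (induction f rule: poly_mapping_single_induct)
  case (single w c)
  show ?case
    apply (subst (1 2) single_eq_gens[of w c])
    unfolding gen_cst vac_linear vac_op_linear
    by (simp add: gens_Cons[symmetric] vac_gens)
qed (simp add: vac_linear vac_op_linear distrib_left)

lemma vac_ksign: "vac (ksign y z * f) = ksign y z * vac f"
  using ksign_cases[of y z] by (auto simp: vac_linear)

text \<open>A defining relation of the enveloping algebra times a right factor, written so that its
  distance from a supercommutator is visible; \<open>rel_eq\<close> matches it with the generators
  of \<open>env_ideal\<close>.\<close>

definition rel :: "gl \<Rightarrow> gl \<Rightarrow> gl free_elt \<Rightarrow> gl free_elt" where
  "rel x y f = scommutator x y f - (if snd x = fst y then free_gen (fst x, snd y) * f else 0)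
     + (if fst x = snd y then ksign x y * (free_gen (fst y, snd x) * f) else 0)"

lemma free_lin_gl_bracket:
  "free_lin (gl_bracket x y) = (if snd x = fst y then free_gen (fst x, snd y) else 0)
     - (if fst x = snd y then ksign x y * free_gen (fst y, snd x) else 0)"
proof -
  have "free_lin v = lin free_gen v" for v :: "gl \<Rightarrow>\<^sub>0 complex"
    by (simp add: free_lin_def lin_def)
  moreover have "cst ((-1) ^ k) = (-1 :: gl free_elt) ^ k" for k
    by (simp add: minus_one_power_iff single_uminus)
  ultimately show ?thesis
    by (cases x; cases y) (auto simp: gl_bracket_def lin_diff lin_single ksign_def)
qed

lemma rel_eq: "rel x y f = (free_gen x * free_gen y
   - (-1) ^ (gl_parity x * gl_parity y) * (free_gen y * free_gen x)
   - free_lin (gl_bracket x y)) * f"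
  using ksign_cases[of x y]
  by (auto simp: rel_def scommutator_def free_lin_gl_bracket algebra_simps simp flip: ksign_def)

lemma vac_rel: "vac (rel x y f) =
   (if snd x \<in> range Proper \<and> snd y \<in> range Proper then scommutator x y (vac f) else 0)"
  using vac_op_commute[of x y "vac f"]
  unfolding rel_def scommutator_def vac_linear vac_gen vac_ksign
  by (auto simp: vac_linear vac_gen vac_ksign algebra_simps)

text \<open>The first argument is a recursion bound; it is used at the length of the word.\<close>

primrec nord_word :: "nat \<Rightarrow> gl list \<Rightarrow> gl free_elt" where
  "nord_word 0 w = 1"
| "nord_word (Suc k) w = (case w of [] \<Rightarrow> 1
    | x # v \<Rightarrow> free_gen x * nord_word k v - lin (\<lambda>u. nord_word k (unWord u)) (polar_word x v))"

definition nord :: "gl free_elt \<Rightarrow> gl free_elt" where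
  "nord = lin (\<lambda>w. nord_word (length (unWord w)) (unWord w))"

lemma nord_linear:
  "nord (f + g) = nord f + nord g" "nord (f - g) = nord f - nord g" "nord (- f) = - nord f"
  "nord (cst c * f) = cst c * nord f" "nord (sum h I) = (\<Sum>i\<in>I. nord (h i))"
  by (simp_all add: nord_def lin_simps)

lemma nord_zero [simp]: "nord 0 = 0"
  by (simp add: nord_def)

lemma nord_gens: "nord (gens w) = nord_word (length w) w"
  by (simp add: nord_def lin_gens)

lemma nord_one [simp]: "nord 1 = 1"
  using nord_gens[of "[]"] by (simp add: gens_Nil)

lemma nord_cst [simp]: "nord (cst c) = cst c"
  using nord_linear(4)[of c 1] by simp

text \<open>Polarization changes letters, never lengths. So on every word of
  \<open>polar_word x v\<close> the bound passed down by \<open>nord_word\<close> is again the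
  length of the word.\<close>

lemma length_keys_polar_word: "w \<in> Poly_Mapping.keys (polar_word x v) \<Longrightarrow> length (unWord w) = length v"
proof (induction v arbitrary: w)
  case (Cons y v)
  have gen: "length (unWord u) = Suc m" if "u \<in> Poly_Mapping.keys (free_gen z * f)"
    "\<And>t. t \<in> Poly_Mapping.keys f \<Longrightarrow> length (unWord t) = m" for u z m and f :: "gl free_elt"
    using subsetD[OF keys_mult that(1)] that(2) by (auto simp: free_gen_def plus_free_word_def)
  have "w \<in> Poly_Mapping.keys (act x y * gens v) \<or> w \<in> Poly_Mapping.keys (ksign x y * (free_gen y * polar_word x v))"
    using subsetD[OF keys_add] Cons.prems by fastforce
  then show ?case
  proof
    assume "w \<in> Poly_Mapping.keys (act x y * gens v)"
    then have "w \<in> Poly_Mapping.keys (free_gen (fst x, snd y) * gens v)"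
      by (auto simp: act_def split: if_splits)
    then show ?thesis
      using gen[of w _ "gens v" "length v"] by (simp add: gens_def)
  next
    assume "w \<in> Poly_Mapping.keys (ksign x y * (free_gen y * polar_word x v))"
    then have "w \<in> Poly_Mapping.keys (free_gen y * polar_word x v)"
      using ksign_cases[of x y] by auto
    then show ?thesis
      using gen[of w y "polar_word x v" "length v"] Cons.IH by simp
  qed
qed simp

text \<open>The recursion is forced by inverting \<open>vac\<close>: for a proper column letter,
  acting on \<open>vac (nord f)\<close> gives a multiplication plus a polarization, and the
  subtracted term removes the polarization.\<close>

lemma nord_gen: "nord (free_gen x * f) = free_gen x * nord f - nord (polar x f)"
proof (induction f rule: poly_mapping_single_induct)
  case (single w c)
  have "lin (\<lambda>u. nord_word (length v) (unWord u)) (polar_word x v) = nord (polar_word x v)" for v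
    unfolding nord_def by (intro lin_cong) (simp add: length_keys_polar_word)
  then show ?case
    apply (subst (1 2 3) single_eq_gens[of w c])
    unfolding gen_cst nord_linear polar_linear
    by (simp add: gens_Cons[symmetric] nord_gens polar_gens gen_cst right_diff_distrib)
qed (simp add: nord_linear polar_linear distrib_left)

lemma nord_ksign: "nord (ksign y z * f) = ksign y z * nord f"
  using ksign_cases[of y z] by (auto simp: nord_linear)

lemma nord_polar_commute:
  "nord (polar x (polar y f)) = ksign x y * nord (polar y (polar x f))
     + (if snd x = fst y then nord (polar (fst x, snd y) f) else 0)
     - (if fst x = snd y then ksign x y * nord (polar (fst y, snd x) f) else 0)"
  by (subst polar_commute) (simp add: nord_linear nord_ksign)

text \<open>An exact identity in the free algebra: the mixed terms, where one generator multiplies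
  and the other polarizes, cancel; the double polarizations combine through
  \<open>polar_commute\<close>; the contractions supply the bracket terms of
  \<open>rel\<close>.\<close>

lemma nord_scommutator: "nord (scommutator x y f) = rel x y (nord f)"
  using nord_polar_commute[of x y f] ksign_cases[of x y]
  unfolding rel_def scommutator_def nord_linear nord_ksign
  apply (cases "snd x = fst y"; cases "fst x = snd y"; elim disjE)
  apply (simp_all add: nord_gen nord_linear polar_gen act_def algebra_simps ksign_sym[of y x])
  done

lemma nord_vac:
  assumes "f \<in> carrier (free_alg A)" "\<And>x. x \<in> A \<Longrightarrow> snd x \<in> range Proper"
  shows "nord (vac f) = f"
  using assms(1)
proof (induction rule: free_alg_induct)
  case (gen x f)
  then show ?case
    using assms(2)[of x] by (simp add: vac_gen vac_op_def nord_linear nord_gen)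
qed (simp_all add: vac_linear nord_linear)

lemma deg_le_vac_op:
  assumes "deg_le A k f" "stable x A" "snd x \<in> range Proper \<Longrightarrow> x \<in> A"
  shows "deg_le A (Suc k) (vac_op x f)"
  unfolding vac_op_def using assms by (auto intro!: deg_le_add deg_le_gen deg_le_Suc[OF deg_le_polar] deg_le_zero)

text \<open>Here \<open>nord (polar x f)\<close> has to be inverted too, so the set of variables
  must be closed under polarizations and the induction must reach every element of the degree of
  \<open>f\<close>.\<close>

lemma vac_nord:
  assumes "deg_le A k f" "\<And>x. x \<in> A \<Longrightarrow> snd x \<in> range Proper" "\<And>x. x \<in> A \<Longrightarrow> stable x A"
  shows "vac (nord f) = f"
  using assms(1)
proof (induction rule: deg_le_strong_induct)
  case (gen k x f)
  then have "vac (nord (polar x f)) = polar x f" "vac (nord f) = f"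
    using deg_le_polar[OF gen.hyps(2) assms(3)[OF gen.hyps(1)]] by auto
  then show ?case
    using assms(2)[OF gen.hyps(1)] by (simp add: nord_gen vac_linear vac_gen vac_op_def)
qed (simp_all add: vac_linear nord_linear)

lemma deg_le_nord:
  assumes "deg_le A k f" "\<And>x. x \<in> A \<Longrightarrow> stable x A"
  shows "deg_le A k (nord f)"
  using assms(1)
proof (induction rule: deg_le_strong_induct)
  case (gen k x f)
  have "deg_le A (Suc k) (nord (polar x f))"
    by (intro deg_le_Suc gen.IH deg_le_polar gen.hyps assms)
  then show ?case
    unfolding nord_gen using gen by (intro deg_le_diff deg_le_gen) auto
qed (auto simp: nord_linear intro: deg_le_cst deg_le_add)

text \<open>Common frame for \<open>U_ideal\<close> and \<open>Irr_pre\<close>. The latter is a left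
  ideal, yet it contains each defining relation times any right factor, and this is what the normal
  ordering arguments use.\<close>

locale left_submodule =
  fixes B :: "gl set" and J :: "gl free_elt set"
  assumes zero: "0 \<in> J"
    and add: "\<And>f g. f \<in> J \<Longrightarrow> g \<in> J \<Longrightarrow> f + g \<in> J"
    and cst: "\<And>c f. f \<in> J \<Longrightarrow> cst c * f \<in> J"
    and gen: "\<And>x f. x \<in> B \<Longrightarrow> f \<in> J \<Longrightarrow> free_gen x * f \<in> J"
    and rel: "\<And>x y f. x \<in> B \<Longrightarrow> y \<in> B \<Longrightarrow> f \<in> carrier (free_alg B) \<Longrightarrow> rel x y f \<in> J"
begin

lemma uminus: "f \<in> J \<Longrightarrow> - f \<in> J"
  using cst[of f "-1"] by (simp add: single_uminus)

lemma diff: "f \<in> J \<Longrightarrow> g \<in> J \<Longrightarrow> f - g \<in> J"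
  using add[OF _ uminus, of f g] by simp

lemma ksign: "f \<in> J \<Longrightarrow> ksign x y * f \<in> J"
  using ksign_cases[of x y] by (auto intro: uminus)

text \<open>A supercommutator goes to a relation by \<open>nord_scommutator\<close>. For
  \<open>free_gen x * f\<close> the extra term \<open>polar x f\<close> is not a part of
  \<open>f\<close>, but it has a smaller degree bound than the product; hence the outer induction on
  \<open>k\<close>.\<close>

lemma nord_scomm:
  assumes "scomm A k f" "A \<subseteq> B" "\<And>x. x \<in> A \<Longrightarrow> stable x A"
  shows "nord f \<in> J"
proof -
  have "\<forall>f. scomm A k f \<longrightarrow> nord f \<in> J"
  proof (induction k rule: less_induct)
    case (less k)
    have "scomm A m f \<Longrightarrow> m \<le> k \<Longrightarrow> nord f \<in> J" for m f
    proof (induction rule: scomm.induct)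
      case (scomm_scommutator x y k f)
      then show ?case
        unfolding nord_scommutator using assms(2) deg_le_subset[OF deg_le_nord[OF scomm_scommutator(3) assms(3)] assms(2)]
        by (intro rel) (auto simp: carrier_free_alg_iff)
    next
      case (scomm_gen x m f)
      have "nord (polar x f) \<in> J"
        using less[of m] scomm_gen scomm_polar[OF scomm_gen(2) assms(3)[OF scomm_gen.hyps(1)]] by simp
      then show ?case
        unfolding nord_gen using scomm_gen assms(2) by (intro diff gen) auto
    qed (auto simp: nord_linear intro: zero add cst)
    then show ?case by blast
  qed
  then show ?thesis using assms(1) by blast
qed

text \<open>Modulo \<open>J\<close>, a generator with column letter outside \<open>P\<close> acts on
  normally ordered elements as a pure polarization: it is commuted to the right end, where it lies
  in \<open>J\<close>, and the contractions met on the way add up to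
  \<open>polar x f\<close>.\<close>

lemma nord_virtual:
  assumes "B = L \<times> L" "P \<subseteq> L"
    and virt: "\<And>x. x \<in> B \<Longrightarrow> snd x \<notin> P \<Longrightarrow> free_gen x \<in> J"
    and "deg_le (L \<times> P) k f" "x \<in> B" "snd x \<notin> P"
  shows "free_gen x * nord f - nord (polar x f) \<in> J"
  using assms(4-6)
proof (induction arbitrary: x rule: deg_le_strong_induct)
  case (cst k c)
  have "polar x (cst c) = 0"
    using polar_linear(4)[of x c 1] by simp
  then show ?case
    using gen_cst[of x c 1] virt[OF cst] left_submodule.cst[OF left_submodule_axioms] by simp
next
  case (gen k y f)
  let ?e = "\<lambda>x f. free_gen x * nord f - nord (polar x f)"
  have y: "y \<in> B" "snd y \<in> P" "stable y (L \<times> P)"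
    using gen.hyps assms(1,2) by (auto simp: stable_def)
  have "L \<times> P \<subseteq> B"
    using assms(1,2) by auto
  moreover have "deg_le (L \<times> P) k (nord f)"
    by (rule deg_le_nord[OF gen.hyps(2)]) (auto simp: stable_def)
  ultimately have "nord f \<in> carrier (free_alg B)"
    unfolding carrier_free_alg_iff using deg_le_subset by blast
  moreover have "?e x (polar y f) \<in> J" "?e x f \<in> J"
    using gen deg_le_polar[OF gen.hyps(2) y(3)] by auto
  moreover have "(if fst x = snd y then ksign x y * ?e (fst y, snd x) f else 0) \<in> J"
    using gen y assms(1) by (auto intro!: ksign zero gen.IH)
  ultimately have "rel x y (nord f) + ksign x y * (free_gen y * ?e x f) - ?e x (polar y f)
     - (if fst x = snd y then ksign x y * ?e (fst y, snd x) f else 0) \<in> J"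
    using gen.prems y
    by (elim diff[OF diff[OF left_submodule.add[OF left_submodule_axioms rel
        ksign[OF left_submodule.gen[OF left_submodule_axioms]]]]]) auto
  \<comment> \<open>The defect of \<open>free_gen y * f\<close> is one relation plus defects of
    \<open>f\<close> and \<open>polar y f\<close>. The contracted generator
    \<open>(fst y, snd x)\<close> keeps its column letter outside \<open>P\<close>, so the induction
    hypothesis covers it; the contraction \<open>(fst x, snd y)\<close> cancels exactly by
    \<open>nord_gen\<close>.\<close>
  also have "rel x y (nord f) + ksign x y * (free_gen y * ?e x f) - ?e x (polar y f)
     - (if fst x = snd y then ksign x y * ?e (fst y, snd x) f else 0) = ?e x (free_gen y * f)"
    using nord_polar_commute[of x y f] ksign_cases[of x y]
    by (cases "snd x = fst y"; cases "fst x = snd y"; elim disjE;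
      simp add: rel_def scommutator_def nord_gen nord_linear polar_gen act_def algebra_simps)
  finally show ?case .
next
  case (add k f g)
  from left_submodule.add[OF left_submodule_axioms add.IH[OF add.prems]] show ?case
    by (simp add: nord_linear polar_linear algebra_simps)
qed

end

section \<open>Irregular products\<close>

text \<open>The grading by the number of occurrences of \<open>\<gamma>\<close> as a row letter. The
  index is an integer and 0 has every weight, so removing a letter that is not there shows up as a
  negative weight, which forces the value 0.\<close>

inductive letter_weight :: "letter \<Rightarrow> int \<Rightarrow> gl free_elt \<Rightarrow> bool" for \<gamma> where
  letter_weight_zero: "letter_weight \<gamma> k 0"
| letter_weight_cst: "letter_weight \<gamma> 0 (cst c)"
| letter_weight_gen: "letter_weight \<gamma> k f \<Longrightarrow> letter_weight \<gamma> (k + of_bool (fst x = \<gamma>)) (free_gen x * f)"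
| letter_weight_add: "letter_weight \<gamma> k f \<Longrightarrow> letter_weight \<gamma> k g \<Longrightarrow> letter_weight \<gamma> k (f + g)"

lemma letter_weight_uminus: "letter_weight \<gamma> k f \<Longrightarrow> letter_weight \<gamma> k (- f)"
proof (induction rule: letter_weight.induct)
  case (letter_weight_cst c)
  have "- cst c = (cst (- c) :: gl free_elt)" by (simp add: single_uminus)
  then show ?case by (metis letter_weight.letter_weight_cst)
next
  case (letter_weight_gen k f x)
  then show ?case using letter_weight.letter_weight_gen[of \<gamma> k "- f" x] by simp
next
  case (letter_weight_add k f g)
  then show ?case using letter_weight.letter_weight_add[of \<gamma> k "- f" "- g"] by (simp add: add.commute)
qed (auto intro: letter_weight.letter_weight_zero)

lemma letter_weight_ksign: "letter_weight \<gamma> k f \<Longrightarrow> letter_weight \<gamma> k (ksign x y * f)"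
  using ksign_cases[of x y] by (auto intro: letter_weight_uminus)

lemma letter_weight_negative: "letter_weight \<gamma> k f \<Longrightarrow> k < 0 \<Longrightarrow> f = 0"
  by (induction rule: letter_weight.induct) (auto simp: of_bool_def split: if_splits)

lemma polar_cst [simp]: "polar x (cst c) = 0"
  using polar_linear(4)[of x c 1] by simp

lemma letter_weight_polar:
  "letter_weight \<gamma> k f \<Longrightarrow> letter_weight \<gamma> (k + of_bool (fst x = \<gamma>) - of_bool (snd x = \<gamma>)) (polar x f)"
proof (induction rule: letter_weight.induct)
  case (letter_weight_gen k f y)
  let ?m = "k + of_bool (fst y = \<gamma>) + of_bool (fst x = \<gamma>) - of_bool (snd x = \<gamma>)"
  have "letter_weight \<gamma> ?m (act x y * f)"
    using letter_weight.letter_weight_gen[OF letter_weight_gen.hyps, of "(fst x, snd y)"] by (auto simp: act_def intro: letter_weight.letter_weight_zero)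
  moreover have "letter_weight \<gamma> ?m (ksign x y * (free_gen y * polar x f))"
    using letter_weight.letter_weight_gen[OF letter_weight_gen.IH, of y] by (intro letter_weight_ksign) (simp add: algebra_simps)
  ultimately show ?case
    unfolding polar_gen by (rule letter_weight.letter_weight_add)
qed (auto simp: polar_linear intro: letter_weight.intros)

lemma polar_letter_weight_nonpos: "letter_weight \<gamma> k f \<Longrightarrow> k \<le> 0 \<Longrightarrow> snd x = \<gamma> \<Longrightarrow> polar x f = 0"
proof (induction rule: letter_weight.induct)
  case (letter_weight_gen k f y)
  show ?case
  proof (cases "fst y = \<gamma>")
    case True
    then have "f = 0" using letter_weight_negative[OF letter_weight_gen.hyps] letter_weight_gen.prems by simp
    then show ?thesis by simp
  next
    case False
    then show ?thesis using letter_weight_gen by (simp add: polar_gen act_def)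
  qed
qed (simp_all add: polar_linear)

text \<open>The multiplication part occurs only if \<open>snd x\<close> is proper, hence different
  from \<open>\<gamma>\<close>; so both parts of \<open>vac_op x\<close> shift the weight by the
  same amount.\<close>

lemma letter_weight_vac_op:
  assumes "letter_weight \<gamma> k f" "\<gamma> \<notin> range Proper"
  shows "letter_weight \<gamma> (k + of_bool (fst x = \<gamma>) - of_bool (snd x = \<gamma>)) (vac_op x f)"
proof (cases "snd x \<in> range Proper")
  case True
  then have "snd x \<noteq> \<gamma>" using assms(2) by auto
  then show ?thesis
    using True letter_weight_gen[OF assms(1), of x] letter_weight_polar[OF assms(1), of x] by (auto simp: vac_op_def intro: letter_weight_add)
next
  case False
  then show ?thesis using letter_weight_polar[OF assms(1), of x] by (simp add: vac_op_def)
qed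

lemma letter_weight_vac_word:
  assumes "\<gamma> \<notin> range Proper"
  shows "letter_weight \<gamma> (int (length (filter (\<lambda>x. fst x = \<gamma>) xs)) - int (length (filter (\<lambda>x. snd x = \<gamma>) xs)))
    (vac_word (rev xs))"
proof (induction xs rule: rev_induct)
  case Nil
  show ?case using letter_weight_cst[of \<gamma> 1] by simp
next
  case (snoc x xs)
  show ?case
    using letter_weight_vac_op[OF snoc assms, of x]
    by (cases "fst x = \<gamma>"; cases "snd x = \<gamma>"; simp add: algebra_simps)
qed

lemma vac_word_append_zero: "vac_word v = 0 \<Longrightarrow> vac_word (u @ v) = 0"
  by (induction u) simp_all

text \<open>The factor at the position \<open>i\<close> of the definition need not itself remove
  \<open>\<gamma>\<close>. But some factor removes it while the balance before it is not positive:
  otherwise every removal would be preceded by a surplus of creations, against the count at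
  \<open>i\<close>.\<close>

lemma irregular_word_decomp:
  assumes "irregular_word m0 m1 xs"
  obtains ys x zs \<gamma> where "xs = ys @ x # zs" "\<gamma> \<in> virtual_letters m0 m1" "snd x = \<gamma>"
    "length (filter (\<lambda>x. fst x = \<gamma>) ys) \<le> length (filter (\<lambda>x. snd x = \<gamma>) ys)"
proof -
  have card: "card {j \<in> {1..i}. P (xs ! (j - 1))} = length (filter P (take i xs))"
    if "i \<le> length xs" for i and P
  proof -
    have "{j \<in> {1..i}. P (xs ! (j - 1))} = Suc ` {j. j < length (take i xs) \<and> P (take i xs ! j)}"
    proof (intro equalityI subsetI)
      fix j assume "j \<in> {j \<in> {1..i}. P (xs ! (j - 1))}"
      then show "j \<in> Suc ` {j. j < length (take i xs) \<and> P (take i xs ! j)}"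
        using that by (intro image_eqI[of _ _ "j - 1"]) auto
    qed (use that in auto)
    then show ?thesis
      by (simp add: card_image length_filter_conv_card)
  qed
  obtain i \<gamma> where i: "1 \<le> i" "i \<le> length xs" "\<gamma> \<in> virtual_letters m0 m1"
    "card {j \<in> {1..i}. snd (xs ! (j - 1)) = \<gamma>} > card {j \<in> {1..<i}. fst (xs ! (j - 1)) = \<gamma>}"
    using assms by (auto simp: irregular_word_def)
  let ?f = "\<lambda>ys. length (filter (\<lambda>x. fst x = \<gamma>) ys)"
  let ?s = "\<lambda>ys. length (filter (\<lambda>x. snd x = \<gamma>) ys)"
  have "{1..<i} = {1..i - 1}"
    using i(1) by auto
  then have lt: "?f (take (i - 1) xs) < ?s (take i xs)"
    using i(4) card[of i "\<lambda>x. snd x = \<gamma>"] card[of "i - 1" "\<lambda>x. fst x = \<gamma>"] i(1,2) by simp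
  have "\<exists>j < length xs. snd (xs ! j) = \<gamma> \<and> ?f (take j xs) \<le> ?s (take j xs)"
  proof (rule ccontr)
    assume neg: "\<not> ?thesis"
    \<comment> \<open>The creations are counted one position earlier, to contradict
      \<open>lt\<close>; at \<open>j = 0\<close> truncated subtraction makes both prefixes
      empty.\<close>
    have "?s (take j xs) \<le> ?f (take (j - 1) xs)" if "j \<le> length xs" for j
      using that
    proof (induction j)
      case (Suc j)
      have mono: "?f (take (j - 1) xs) \<le> ?f (take j xs)"
      proof (cases j)
        case (Suc l)
        then show ?thesis using \<open>Suc j \<le> length xs\<close> by (simp add: take_Suc_conv_app_nth)
      qed simp
      show ?case
        using Suc mono neg by (cases "snd (xs ! j) = \<gamma>") (auto simp: take_Suc_conv_app_nth not_le)
    qed simp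
    with lt i(2) show False by (meson not_le)
  qed
  then obtain j where j: "j < length xs" "snd (xs ! j) = \<gamma>" "?f (take j xs) \<le> ?s (take j xs)"
    by blast
  show ?thesis
    using that[OF id_take_nth_drop[OF j(1)] i(3) j(2,3)] .
qed

lemma virtual_letters_not_Proper: "\<gamma> \<in> virtual_letters m0 m1 \<Longrightarrow> \<gamma> \<notin> range Proper"
  by (auto simp: virtual_letters_def)

text \<open>Before the critical factor the weight of \<open>\<gamma>\<close> is at most 0. That
  factor has a virtual column letter, so it is a pure polarization and finds nothing to
  replace.\<close>

lemma vac_word_irregular:
  assumes "irregular_word m0 m1 xs"
  shows "vac_word (rev xs) = 0"
proof -
  from assms obtain ys x zs \<gamma> where *: "xs = ys @ x # zs" "\<gamma> \<in> virtual_letters m0 m1" "snd x = \<gamma>"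
    "length (filter (\<lambda>x. fst x = \<gamma>) ys) \<le> length (filter (\<lambda>x. snd x = \<gamma>) ys)"
    by (rule irregular_word_decomp)
  have np: "\<gamma> \<notin> range Proper"
    using *(2) by (rule virtual_letters_not_Proper)
  have "vac_word (x # rev ys) = 0"
    using polar_letter_weight_nonpos[OF letter_weight_vac_word[OF np, of ys], of x] * np by (simp add: vac_op_def)
  then show ?thesis
    using vac_word_append_zero[of "x # rev ys" "rev zs"] *(1) by simp
qed

section \<open>Variables with proper column letter\<close>

definition proper_basis :: "nat \<Rightarrow> nat \<Rightarrow> nat \<Rightarrow> gl set" where
  "proper_basis m0 m1 n = all_letters m0 m1 n \<times> Proper ` {1..n}"

lemma proper_basis_subset: "proper_basis m0 m1 n \<subseteq> gl_basis m0 m1 n"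
  by (auto simp: proper_basis_def gl_basis_def all_letters_def)

lemma snd_proper_basis: "x \<in> proper_basis m0 m1 n \<Longrightarrow> snd x \<in> range Proper"
  by (auto simp: proper_basis_def)

lemma stable_proper_basis: "x \<in> gl_basis m0 m1 n \<Longrightarrow> stable x (proper_basis m0 m1 n)"
  by (auto simp: stable_def proper_basis_def gl_basis_def)

lemma gl_basis_Proper: "x \<in> gl_basis m0 m1 n \<Longrightarrow> snd x \<in> range Proper \<Longrightarrow> x \<in> proper_basis m0 m1 n"
  by (auto simp: proper_basis_def gl_basis_def all_letters_def virtual_letters_def)

text \<open>Without virtual letters every generator is a variable. Through this identity the general
  statements specialize at \<open>0 0\<close> to U(gl(n)).\<close>

lemma gl_basis_0: "gl_basis 0 0 n = proper_basis 0 0 n"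
  by (auto simp: proper_basis_def gl_basis_def all_letters_def virtual_letters_def)

lemma gl_basis_0_subset: "gl_basis 0 0 n \<subseteq> gl_basis m0 m1 n"
  by (auto simp: gl_basis_def all_letters_def virtual_letters_def)

lemma proper_basis_0_subset: "proper_basis 0 0 n \<subseteq> proper_basis m0 m1 n"
  by (auto simp: proper_basis_def all_letters_def virtual_letters_def)

lemma carrier_mono: "A \<subseteq> B \<Longrightarrow> carrier (free_alg A) \<subseteq> carrier (free_alg B)"
  by (auto simp: free_alg_def)

lemma free_alg_closed:
  fixes A :: "'g set"
  shows "f \<in> carrier (free_alg A) \<Longrightarrow> g \<in> carrier (free_alg A) \<Longrightarrow> f + g \<in> carrier (free_alg A)"
    "f \<in> carrier (free_alg A) \<Longrightarrow> g \<in> carrier (free_alg A) \<Longrightarrow> f * g \<in> carrier (free_alg A)"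
    "f \<in> carrier (free_alg A) \<Longrightarrow> - f \<in> carrier (free_alg A)"
    "f \<in> carrier (free_alg A) \<Longrightarrow> g \<in> carrier (free_alg A) \<Longrightarrow> f - g \<in> carrier (free_alg A)"
    "0 \<in> carrier (free_alg A)" "1 \<in> carrier (free_alg A)" "cst c \<in> carrier (free_alg A)"
    "x \<in> A \<Longrightarrow> free_gen x \<in> carrier (free_alg A)"
    "set w \<subseteq> A \<Longrightarrow> gens w \<in> carrier (free_alg A)"
proof -
  interpret F: ring "free_alg A" by (rule ring_free_alg)
  show 1: "f + g \<in> carrier (free_alg A)" if "f \<in> carrier (free_alg A)" "g \<in> carrier (free_alg A)" for f g
    using F.a_closed[OF that] by (simp add: free_alg_def)
  show "f * g \<in> carrier (free_alg A)" if "f \<in> carrier (free_alg A)" "g \<in> carrier (free_alg A)"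
    using F.m_closed[OF that] by (simp add: free_alg_def)
  show 2: "- f \<in> carrier (free_alg A)" if "f \<in> carrier (free_alg A)" for f
    using that by (simp add: free_alg_def)
  show "f - g \<in> carrier (free_alg A)" if "f \<in> carrier (free_alg A)" "g \<in> carrier (free_alg A)"
    using 1[OF that(1) 2[OF that(2)]] by simp
  show "0 \<in> carrier (free_alg A)" "1 \<in> carrier (free_alg A)"
    using F.zero_closed F.one_closed by (simp_all add: free_alg_def)
  show "cst c \<in> carrier (free_alg A)" by (rule single_zero_in_free_alg)
  show "x \<in> A \<Longrightarrow> free_gen x \<in> carrier (free_alg A)" "set w \<subseteq> A \<Longrightarrow> gens w \<in> carrier (free_alg A)"
    by (simp_all add: free_alg_def free_gen_def gens_def)
qed

lemma free_alg_simps: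
  "mult (free_alg A) = (*)" "one (free_alg A) = 1" "zero (free_alg A) = 0" "add (free_alg A) = (+)"
  by (simp_all add: free_alg_def)

lemma free_alg_minus: "f \<in> carrier (free_alg A) \<Longrightarrow> \<ominus>\<^bsub>free_alg A\<^esub> f = - f"
proof -
  interpret F: ring "free_alg A" by (rule ring_free_alg)
  show "f \<in> carrier (free_alg A) \<Longrightarrow> \<ominus>\<^bsub>free_alg A\<^esub> f = - f"
    by (intro F.minus_equality) (auto simp: free_alg_simps free_alg_closed)
qed

section \<open>Cosets, \<open>Irr\<close> and supercommutators in terms of representatives\<close>

context
  fixes m0 m1 n :: nat
begin

abbreviation "BB \<equiv> gl_basis m0 m1 n"
abbreviation "AA \<equiv> proper_basis m0 m1 n"
abbreviation "FF \<equiv> free_alg BB"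
abbreviation "II \<equiv> U_ideal m0 m1 n"
abbreviation "UU \<equiv> U_super m0 m1 n"

definition ucoset :: "gl free_elt \<Rightarrow> U_elt" where
  "ucoset f = II +>\<^bsub>FF\<^esub> f"

lemma ideal_U_ideal: "ideal II FF"
  unfolding U_ideal_def by (rule ideal_env_ideal) (rule gl_bracket_closed)

interpretation I: ideal II FF by (rule ideal_U_ideal)
interpretation U: ring UU by (rule ring_U_super)

lemma U_ideal_closed:
  "f \<in> II \<Longrightarrow> f \<in> carrier FF" "0 \<in> II"
  "f \<in> II \<Longrightarrow> g \<in> II \<Longrightarrow> f + g \<in> II" "f \<in> II \<Longrightarrow> - f \<in> II" "f \<in> II \<Longrightarrow> g \<in> II \<Longrightarrow> f - g \<in> II"
  "f \<in> II \<Longrightarrow> g \<in> carrier FF \<Longrightarrow> g * f \<in> II" "f \<in> II \<Longrightarrow> g \<in> carrier FF \<Longrightarrow> f * g \<in> II"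
proof -
  show cl: "f \<in> II \<Longrightarrow> f \<in> carrier FF" for f by (rule I.Icarr)
  show "0 \<in> II" using additive_subgroup.zero_closed[OF I.is_additive_subgroup] by (simp add: free_alg_simps)
  show add: "f \<in> II \<Longrightarrow> g \<in> II \<Longrightarrow> f + g \<in> II" for f g
    using additive_subgroup.a_closed[OF I.is_additive_subgroup] by (simp add: free_alg_simps)
  show neg: "f \<in> II \<Longrightarrow> - f \<in> II" for f
    using additive_subgroup.a_inv_closed[OF I.is_additive_subgroup] cl by (simp add: free_alg_minus)
  show "f \<in> II \<Longrightarrow> g \<in> II \<Longrightarrow> f - g \<in> II"
    using add[OF _ neg, of f g] by simp
  show "f \<in> II \<Longrightarrow> g \<in> carrier FF \<Longrightarrow> g * f \<in> II" "f \<in> II \<Longrightarrow> g \<in> carrier FF \<Longrightarrow> f * g \<in> II"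
    using I.I_l_closed I.I_r_closed by (simp_all add: free_alg_simps)
qed

lemma rel_mem_U_ideal:
  assumes "x \<in> BB" "y \<in> BB" "f \<in> carrier FF"
  shows "rel x y f \<in> II"
proof -
  let ?G = "{free_gen x * free_gen y - (-1) ^ (gl_parity x * gl_parity y) * (free_gen y * free_gen x)
        - free_lin (gl_bracket x y) | x y. x \<in> BB \<and> y \<in> BB}"
  have "r \<in> II" if "r \<in> ?G" for r
    using that unfolding U_ideal_def env_ideal_def genideal_def by blast
  moreover have "free_gen x * free_gen y - (-1) ^ (gl_parity x * gl_parity y)
      * (free_gen y * free_gen x) - free_lin (gl_bracket x y) \<in> ?G"
    using assms(1,2) by blast
  ultimately show ?thesis
    unfolding rel_eq using assms(3) by (intro U_ideal_closed(7))
qed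

lemma left_submodule_U_ideal: "left_submodule BB II"
  by unfold_locales (auto intro: U_ideal_closed rel_mem_U_ideal free_alg_closed)

lemma U_ideal_minimal:
  assumes K: "ideal K FF" and rel: "\<And>x y. x \<in> BB \<Longrightarrow> y \<in> BB \<Longrightarrow> rel x y 1 \<in> K"
  shows "II \<subseteq> K"
proof -
  show ?thesis
    unfolding U_ideal_def env_ideal_def
    using rel by (intro I.genideal_minimal K) (auto simp: rel_eq)
qed

lemma ucoset_eq_image: "ucoset f = (\<lambda>h. h + f) ` II"
  by (auto simp: ucoset_def a_r_coset_def' free_alg_simps)

lemma ucoset_eq_iff: "ucoset f = ucoset g \<longleftrightarrow> f - g \<in> II"
proof
  assume "ucoset f = ucoset g"
  moreover have "f \<in> ucoset f"
    using U_ideal_closed(2) by (force simp: ucoset_eq_image)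
  ultimately show "f - g \<in> II"
    by (auto simp: ucoset_eq_image)
next
  have "ucoset f \<subseteq> ucoset g" if "f - g \<in> II" for f g
  proof
    fix h assume "h \<in> ucoset f"
    then obtain i where "i \<in> II" "h = i + f" by (auto simp: ucoset_eq_image)
    then show "h \<in> ucoset g"
      using U_ideal_closed(3)[OF \<open>i \<in> II\<close> that]
      by (auto simp: ucoset_eq_image intro!: image_eqI[of _ _ "i + (f - g)"])
  qed
  moreover assume "f - g \<in> II"
  moreover from this have "g - f \<in> II"
    using U_ideal_closed(4)[of "f - g"] by simp
  ultimately show "ucoset f = ucoset g" by blast
qed

lemma carrier_U: "carrier UU = ucoset ` carrier FF"
  unfolding U_super_def env_alg_def U_ideal_def[symmetric] Let_def
  by (auto simp: FactRing_def A_RCOSETS_def' ucoset_def)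

lemma ucoset_mem: "f \<in> carrier FF \<Longrightarrow> ucoset f \<in> carrier UU"
  by (simp add: carrier_U)

lemma ucoset_mult: "f \<in> carrier FF \<Longrightarrow> g \<in> carrier FF \<Longrightarrow> ucoset f \<otimes>\<^bsub>UU\<^esub> ucoset g = ucoset (f * g)"
  unfolding U_super_def env_alg_def U_ideal_def[symmetric] Let_def
  using I.rcoset_mult_add[of f g] by (simp add: FactRing_def ucoset_def free_alg_simps)

lemma ucoset_add: "f \<in> carrier FF \<Longrightarrow> g \<in> carrier FF \<Longrightarrow> ucoset f \<oplus>\<^bsub>UU\<^esub> ucoset g = ucoset (f + g)"
  unfolding U_super_def env_alg_def U_ideal_def[symmetric] Let_def
  using I.a_rcos_sum[of f g] by (simp add: FactRing_def ucoset_def free_alg_simps)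

lemma ucoset_one: "\<one>\<^bsub>UU\<^esub> = ucoset 1"
  unfolding U_super_def env_alg_def U_ideal_def[symmetric] Let_def
  by (simp add: FactRing_def ucoset_def free_alg_simps)

lemma ucoset_zero: "\<zero>\<^bsub>UU\<^esub> = ucoset 0"
  unfolding U_super_def env_alg_def U_ideal_def[symmetric] Let_def
  by (auto simp: FactRing_def ucoset_eq_image)

lemma ucoset_smult: "f \<in> carrier FF \<Longrightarrow> c \<odot>\<^bsub>UU\<^esub> ucoset f = ucoset (cst c * f)"
  using ucoset_mult[of "cst c" f]
  unfolding U_super_def env_alg_def U_ideal_def[symmetric] Let_def
  by (simp add: ucoset_def single_zero_in_free_alg)

lemma ucoset_minus:
  assumes "f \<in> carrier FF" "g \<in> carrier FF"
  shows "ucoset f \<ominus>\<^bsub>UU\<^esub> ucoset g = ucoset (f - g)"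
proof -
  have "\<ominus>\<^bsub>UU\<^esub> ucoset g = ucoset (- g)"
    using assms by (intro U.minus_equality) (auto simp: ucoset_add ucoset_zero ucoset_mem free_alg_closed)
  then show ?thesis
    using ucoset_add[of f "- g"] assms by (simp add: U.minus_eq free_alg_closed)
qed

lemma U_prod_eq: "set xs \<subseteq> BB \<Longrightarrow> U_prod m0 m1 n xs = ucoset (gens xs)"
proof (induction xs)
  case Nil
  show ?case by (simp add: U_prod_def ucoset_one gens_Nil)
next
  case (Cons x xs)
  have "U_prod m0 m1 n (x # xs) = ucoset (free_gen x) \<otimes>\<^bsub>UU\<^esub> U_prod m0 m1 n xs"
    by (simp add: U_prod_def U_gen_def ucoset_def)
  then show ?case
    using Cons by (simp add: ucoset_mult free_alg_closed gens_Cons)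
qed

text \<open>The preimage of \<open>Irr\<close> in the free algebra. It contains
  \<open>U_ideal\<close>, so a congruence modulo \<open>Irr\<close> becomes membership of a
  difference of representatives.\<close>

definition Irr_pre :: "gl free_elt set" where
  "Irr_pre = {f \<in> carrier FF. ucoset f \<in> Irr m0 m1 n}"

lemma Irr_pre_iff: "f \<in> Irr_pre \<longleftrightarrow> f \<in> carrier FF \<and>
   (\<forall>K. left_ideal K UU \<longrightarrow> irregular_products m0 m1 n \<subseteq> K \<longrightarrow> ucoset f \<in> K)"
  by (auto simp: Irr_pre_def Irr_def)

lemma left_ideal_closed:
  assumes "left_ideal K UU"
  shows "\<And>f g. f \<in> carrier FF \<Longrightarrow> g \<in> carrier FF \<Longrightarrow> ucoset f \<in> K \<Longrightarrow> ucoset g \<in> K \<Longrightarrow> ucoset (f + g) \<in> K"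
    "\<And>f g. f \<in> carrier FF \<Longrightarrow> g \<in> carrier FF \<Longrightarrow> ucoset g \<in> K \<Longrightarrow> ucoset (f * g) \<in> K"
    "ucoset 0 \<in> K"
proof -
  interpret additive_subgroup K UU using assms by (simp add: left_ideal_def)
  show "f \<in> carrier FF \<Longrightarrow> g \<in> carrier FF \<Longrightarrow> ucoset f \<in> K \<Longrightarrow> ucoset g \<in> K \<Longrightarrow> ucoset (f + g) \<in> K" for f g
    using a_closed[of "ucoset f" "ucoset g"] by (simp add: ucoset_add)
  show "f \<in> carrier FF \<Longrightarrow> g \<in> carrier FF \<Longrightarrow> ucoset g \<in> K \<Longrightarrow> ucoset (f * g) \<in> K" for f g
    using assms ucoset_mem[of f] unfolding left_ideal_def by (metis ucoset_mult)
  show "ucoset 0 \<in> K" using zero_closed by (simp add: ucoset_zero)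
qed

lemma U_ideal_subset_Irr_pre: "II \<subseteq> Irr_pre"
proof
  fix f assume "f \<in> II"
  then have "ucoset f = ucoset 0" "f \<in> carrier FF"
    by (simp_all add: ucoset_eq_iff U_ideal_closed(1))
  then show "f \<in> Irr_pre"
    by (simp add: Irr_pre_iff left_ideal_closed(3))
qed

lemma left_submodule_Irr_pre: "left_submodule BB Irr_pre"
proof
  show "0 \<in> Irr_pre" using U_ideal_subset_Irr_pre U_ideal_closed(2) by auto
  show "f + g \<in> Irr_pre" if "f \<in> Irr_pre" "g \<in> Irr_pre" for f g
    using that left_ideal_closed(1) by (auto simp: Irr_pre_iff free_alg_closed)
  show "cst c * f \<in> Irr_pre" if "f \<in> Irr_pre" for c f
    using that left_ideal_closed(2) by (auto simp: Irr_pre_iff free_alg_closed)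
  show "free_gen x * f \<in> Irr_pre" if "x \<in> BB" "f \<in> Irr_pre" for x f
    using that left_ideal_closed(2) by (auto simp: Irr_pre_iff free_alg_closed)
  show "rel x y f \<in> Irr_pre" if "x \<in> BB" "y \<in> BB" "f \<in> carrier FF" for x y f
    using rel_mem_U_ideal[OF that] U_ideal_subset_Irr_pre by auto
qed

lemma irregular_mem_Irr_pre:
  assumes "set xs \<subseteq> BB" "irregular_word m0 m1 xs"
  shows "gens (rev xs) \<in> Irr_pre"
proof -
  have "ucoset (gens (rev xs)) \<in> irregular_products m0 m1 n"
    using assms U_prod_eq[of "rev xs"] unfolding irregular_products_def by force
  then show ?thesis
    using assms(1) by (auto simp: Irr_pre_iff free_alg_closed)
qed

lemma virtual_gen_mem_Irr_pre:
  assumes "x \<in> BB" "snd x \<notin> Proper ` {1..n}"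
  shows "free_gen x \<in> Irr_pre"
proof -
  have "snd x \<in> virtual_letters m0 m1"
    using assms by (auto simp: gl_basis_def all_letters_def)
  \<comment> \<open>Irregular at position 1: one removal and no creation before it.\<close>
  then have "irregular_word m0 m1 [x]"
    unfolding irregular_word_def by (intro bexI[of _ 1] bexI[of _ "snd x"]) (auto simp: card_gt_0_iff)
  then show ?thesis
    using irregular_mem_Irr_pre[of "[x]"] assms(1) by (simp add: free_gen_eq_gens)
qed

lemma nord_virtual_Irr_pre:
  assumes "f \<in> carrier (free_alg AA)" "x \<in> BB" "snd x \<notin> range Proper"
  shows "free_gen x * nord f - nord (polar x f) \<in> Irr_pre"
proof -
  obtain k where "deg_le AA k f"
    using assms(1) by (auto simp: carrier_free_alg_iff)
  moreover have "snd x \<notin> Proper ` {1..n}"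
    using assms(3) by auto
  ultimately show ?thesis
    unfolding proper_basis_def using assms(2)
    by (intro left_submodule.nord_virtual[OF left_submodule_Irr_pre gl_basis_def _ virtual_gen_mem_Irr_pre])
      (auto simp: all_letters_def)
qed

text \<open>The kernel of the map from the free algebra on \<open>proper_basis\<close> to the
  supersymmetric algebra, with the degree bounds forgotten.\<close>

definition scomm_ideal :: "gl free_elt set" where
  "scomm_ideal = {f. \<exists>k. scomm AA k f}"

lemma scomm_ideal_closed:
  "0 \<in> scomm_ideal" "f \<in> scomm_ideal \<Longrightarrow> g \<in> scomm_ideal \<Longrightarrow> f + g \<in> scomm_ideal" "f \<in> scomm_ideal \<Longrightarrow> cst c * f \<in> scomm_ideal"
  "f \<in> scomm_ideal \<Longrightarrow> - f \<in> scomm_ideal" "f \<in> scomm_ideal \<Longrightarrow> g \<in> scomm_ideal \<Longrightarrow> f - g \<in> scomm_ideal"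
  "x \<in> AA \<Longrightarrow> f \<in> scomm_ideal \<Longrightarrow> free_gen x * f \<in> scomm_ideal"
  "f \<in> scomm_ideal \<Longrightarrow> g \<in> carrier (free_alg AA) \<Longrightarrow> f * g \<in> scomm_ideal"
  "x \<in> AA \<Longrightarrow> y \<in> AA \<Longrightarrow> f \<in> carrier (free_alg AA) \<Longrightarrow> scommutator x y f \<in> scomm_ideal"
  "x \<in> BB \<Longrightarrow> f \<in> scomm_ideal \<Longrightarrow> polar x f \<in> scomm_ideal"
  "f \<in> scomm_ideal \<Longrightarrow> ksign x y * f \<in> scomm_ideal"
proof -
  show "0 \<in> scomm_ideal" by (auto simp: scomm_ideal_def intro: scomm_zero)
  show add: "f \<in> scomm_ideal \<Longrightarrow> g \<in> scomm_ideal \<Longrightarrow> f + g \<in> scomm_ideal" for f g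
    unfolding scomm_ideal_def mem_Collect_eq using scomm_mono[of AA _ f] scomm_mono[of AA _ g]
    by (metis scomm_add nat_le_linear)
  show neg: "f \<in> scomm_ideal \<Longrightarrow> - f \<in> scomm_ideal" for f by (auto simp: scomm_ideal_def intro: scomm_uminus)
  show "f \<in> scomm_ideal \<Longrightarrow> g \<in> scomm_ideal \<Longrightarrow> f - g \<in> scomm_ideal" for f g
    using add[OF _ neg, of f g] by simp
  show "f \<in> scomm_ideal \<Longrightarrow> cst c * f \<in> scomm_ideal" by (auto simp: scomm_ideal_def intro: scomm_cst)
  show "x \<in> AA \<Longrightarrow> f \<in> scomm_ideal \<Longrightarrow> free_gen x * f \<in> scomm_ideal" by (auto simp: scomm_ideal_def intro: scomm_gen)
  show "f \<in> scomm_ideal \<Longrightarrow> g \<in> carrier (free_alg AA) \<Longrightarrow> f * g \<in> scomm_ideal"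
    by (auto simp: scomm_ideal_def carrier_free_alg_iff intro: scomm_right)
  show "x \<in> AA \<Longrightarrow> y \<in> AA \<Longrightarrow> f \<in> carrier (free_alg AA) \<Longrightarrow> scommutator x y f \<in> scomm_ideal"
    by (auto simp: scomm_ideal_def carrier_free_alg_iff intro: scomm_scommutator)
  show "x \<in> BB \<Longrightarrow> f \<in> scomm_ideal \<Longrightarrow> polar x f \<in> scomm_ideal"
    by (auto simp: scomm_ideal_def intro: scomm_polar stable_proper_basis)
  show "f \<in> scomm_ideal \<Longrightarrow> ksign x y * f \<in> scomm_ideal" by (auto simp: scomm_ideal_def intro: scomm_ksign)
qed

lemma scomm_ideal_vac_op: "x \<in> BB \<Longrightarrow> f \<in> scomm_ideal \<Longrightarrow> vac_op x f \<in> scomm_ideal"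
  unfolding vac_op_def using gl_basis_Proper[of x m0 m1 n] by (auto intro: scomm_ideal_closed(1,2,6,9))

lemma symb_scomm_ideal: "f \<in> scomm_ideal \<Longrightarrow> symb f = 0"
  by (auto simp: scomm_ideal_def symb_scomm)

lemma nord_scomm_ideal: "f \<in> scomm_ideal \<Longrightarrow> nord f \<in> II"
  unfolding scomm_ideal_def
  using left_submodule.nord_scomm[OF left_submodule_U_ideal _ proper_basis_subset] stable_proper_basis
    proper_basis_subset by blast

lemma vac_mem: "f \<in> carrier FF \<Longrightarrow> vac f \<in> carrier (free_alg AA)"
proof (induction rule: free_alg_induct)
  case (gen x f)
  then obtain k where "deg_le AA k (vac f)"
    by (auto simp: carrier_free_alg_iff)
  then have "deg_le AA (Suc k) (vac_op x (vac f))"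
    using gen by (intro deg_le_vac_op) (auto intro: stable_proper_basis gl_basis_Proper)
  then show ?case
    by (auto simp: vac_gen carrier_free_alg_iff)
qed (auto simp: vac_linear free_alg_closed)

lemma nord_mem: "f \<in> carrier (free_alg AA) \<Longrightarrow> nord f \<in> carrier (free_alg AA)"
  unfolding carrier_free_alg_iff
  using deg_le_nord[of AA _ f] stable_proper_basis proper_basis_subset by blast

lemma vac_left_scomm_ideal: "f \<in> carrier FF \<Longrightarrow> vac g \<in> scomm_ideal \<Longrightarrow> vac (f * g) \<in> scomm_ideal"
proof (induction rule: free_alg_induct)
  case (gen x f)
  then show ?case by (auto simp: mult.assoc vac_gen intro: scomm_ideal_vac_op)
qed (auto simp: vac_linear distrib_right intro: scomm_ideal_closed)

lemma vac_U_ideal: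
  assumes "f \<in> II"
  shows "vac f \<in> scomm_ideal"
proof -
  \<comment> \<open>The elements that \<open>vac\<close> sends into \<open>scomm_ideal\<close> form
    only a left ideal, while minimality of \<open>U_ideal\<close> is among two-sided ideals.
    Quantifying over right factors \<open>g\<close> gives the annihilator of the whole
    module.\<close>
  let ?K = "{f \<in> carrier FF. \<forall>g \<in> carrier FF. vac (f * g) \<in> scomm_ideal}"
  have "ideal ?K FF"
  proof (rule idealI)
    show "ring FF" by (rule ring_free_alg)
    show "subgroup ?K (add_monoid FF)"
    proof (rule I.add.subgroupI)
      show "?K \<noteq> {}" using scomm_ideal_closed(1) free_alg_closed(5)[of BB] by force
      show "\<ominus>\<^bsub>FF\<^esub> f \<in> ?K" if "f \<in> ?K" for f
        using that by (auto simp: free_alg_minus free_alg_closed vac_linear intro: scomm_ideal_closed)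
      show "f \<oplus>\<^bsub>FF\<^esub> g \<in> ?K" if "f \<in> ?K" "g \<in> ?K" for f g
        using that by (auto simp: free_alg_simps free_alg_closed vac_linear distrib_right intro: scomm_ideal_closed)
    qed auto
    show "x \<otimes>\<^bsub>FF\<^esub> f \<in> ?K" "f \<otimes>\<^bsub>FF\<^esub> x \<in> ?K" if "f \<in> ?K" "x \<in> carrier FF" for f x
      using that by (auto simp: free_alg_simps free_alg_closed mult.assoc intro: vac_left_scomm_ideal)
  qed
  moreover have "rel x y 1 \<in> ?K" if "x \<in> BB" "y \<in> BB" for x y
  proof -
    have "rel x y 1 * g = rel x y g" for g by (simp add: rel_eq)
    moreover have "rel x y 1 \<in> carrier FF"
      using that by (intro U_ideal_closed(1) rel_mem_U_ideal free_alg_closed)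
    ultimately show ?thesis
      using that by (auto simp: vac_rel gl_basis_Proper vac_mem intro!: scomm_ideal_closed)
  qed
  ultimately have "f \<in> ?K"
    using U_ideal_minimal assms by blast
  then show ?thesis
    using free_alg_closed(6)[of BB] by force
qed

text \<open>\<open>vac\<close> is zero on irregular products, and left multiplication preserves the
  elements it sends into \<open>scomm_ideal\<close>. So the cosets of such elements form one of the
  left ideals whose intersection is \<open>Irr\<close>.\<close>

lemma vac_Irr_pre:
  assumes "f \<in> Irr_pre"
  shows "vac f \<in> scomm_ideal"
proof -
  let ?K = "ucoset ` {f \<in> carrier FF. vac f \<in> scomm_ideal}"
  \<comment> \<open>Independence of the representative, because \<open>vac\<close> sends
    \<open>U_ideal\<close> into \<open>scomm_ideal\<close>.\<close>
  have mem: "vac f \<in> scomm_ideal" if f: "ucoset f \<in> ?K" for f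
  proof -
    obtain g where g: "vac g \<in> scomm_ideal" "ucoset f = ucoset g"
      using f by auto
    then have "f - g \<in> II"
      by (simp only: ucoset_eq_iff)
    then have "vac (f - g) + vac g \<in> scomm_ideal"
      using g(1) by (rule scomm_ideal_closed(2)[OF vac_U_ideal])
    then show ?thesis by (simp add: vac_linear)
  qed
  have "left_ideal ?K UU"
    unfolding left_ideal_def
  proof (intro conjI ballI)
    show "additive_subgroup ?K UU"
    proof (rule additive_subgroupI, rule U.add.subgroupI)
      show "?K \<subseteq> carrier UU" by (auto simp: ucoset_mem)
      show "?K \<noteq> {}" using scomm_ideal_closed(1) free_alg_closed(5)[of BB] by force
      show "\<ominus>\<^bsub>UU\<^esub> a \<in> ?K" if a: "a \<in> ?K" for a
      proof -
        obtain f where f: "a = ucoset f" "f \<in> carrier FF" "vac f \<in> scomm_ideal" using a by auto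
        have "\<ominus>\<^bsub>UU\<^esub> ucoset f = ucoset (- f)"
          using f by (intro U.minus_equality) (auto simp: ucoset_add ucoset_zero ucoset_mem free_alg_closed)
        then show ?thesis
          using f by (auto simp: vac_linear free_alg_closed intro!: image_eqI[of _ ucoset "- f"] scomm_ideal_closed)
      qed
      show "a \<oplus>\<^bsub>UU\<^esub> b \<in> ?K" if ab: "a \<in> ?K" "b \<in> ?K" for a b
      proof -
        obtain f g where "a = ucoset f" "f \<in> carrier FF" "vac f \<in> scomm_ideal" 
          "b = ucoset g" "g \<in> carrier FF" "vac g \<in> scomm_ideal"
          using ab by auto
        then show ?thesis
          by (auto simp: ucoset_add vac_linear free_alg_closed intro!: image_eqI[of _ ucoset "f + g"] scomm_ideal_closed)
      qed
    qed
    show "u \<otimes>\<^bsub>UU\<^esub> a \<in> ?K" if ua: "u \<in> carrier UU" "a \<in> ?K" for u a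
    proof -
      obtain f g where "a = ucoset f" "f \<in> carrier FF" "vac f \<in> scomm_ideal" "u = ucoset g" "g \<in> carrier FF"
        using ua by (auto simp: carrier_U)
      then show ?thesis
        by (auto simp: ucoset_mult free_alg_closed intro!: image_eqI[of _ ucoset "g * f"] vac_left_scomm_ideal)
    qed
  qed
  moreover have "irregular_products m0 m1 n \<subseteq> ?K"
  proof
    fix u assume "u \<in> irregular_products m0 m1 n"
    then obtain xs where xs: "u = ucoset (gens (rev xs))" "set xs \<subseteq> BB" "irregular_word m0 m1 xs"
      using U_prod_eq by (force simp: irregular_products_def)
    then show "u \<in> ?K"
      by (auto simp: vac_gens vac_word_irregular free_alg_closed intro!: scomm_ideal_closed)
  qed
  ultimately have "ucoset f \<in> ?K"
    using assms by (auto simp: Irr_pre_iff)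
  then show ?thesis by (rule mem)
qed

end

section \<open>The correspondence between polynomials and the enveloping algebra\<close>

lemma U_ideal_0_subset: "U_ideal 0 0 n \<subseteq> U_ideal m0 m1 n"
proof -
  let ?G = "free_alg (gl_basis 0 0 n)" and ?F = "free_alg (gl_basis m0 m1 n)"
  interpret F0: ring ?G by (rule ring_free_alg)
  have sub: "carrier ?G \<subseteq> carrier ?F"
    by (rule carrier_mono[OF gl_basis_0_subset])
  let ?K = "U_ideal m0 m1 n \<inter> carrier ?G"
  have "ideal ?K ?G"
  proof (rule idealI)
    show "ring ?G" by (rule ring_free_alg)
    show "subgroup ?K (add_monoid ?G)"
    proof (rule F0.add.subgroupI)
      show "?K \<noteq> {}"
        using U_ideal_closed(2)[of m0 m1 n] free_alg_closed(5)[of "gl_basis 0 0 n"] by blast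
    qed (auto simp: free_alg_minus free_alg_simps free_alg_closed U_ideal_closed)
    show "x \<otimes>\<^bsub>?G\<^esub> f \<in> ?K" "f \<otimes>\<^bsub>?G\<^esub> x \<in> ?K" if "f \<in> ?K" "x \<in> carrier ?G" for f x
      using that subsetD[OF sub that(2)] by (auto simp: free_alg_simps free_alg_closed intro: U_ideal_closed(6,7))
  qed
  moreover have "rel x y 1 \<in> ?K" if xy: "x \<in> gl_basis 0 0 n" "y \<in> gl_basis 0 0 n" for x y
    using rel_mem_U_ideal[OF xy free_alg_closed(6)] U_ideal_closed(1)[of _ 0 0 n]
      rel_mem_U_ideal[OF subsetD[OF gl_basis_0_subset xy(1)] subsetD[OF gl_basis_0_subset xy(2)] free_alg_closed(6)]
    by blast
  ultimately show ?thesis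
    using U_ideal_minimal[of ?K 0 0 n] by blast
qed

lemma U_incl_ucoset:
  assumes f: "f \<in> carrier (free_alg (gl_basis 0 0 n))"
  shows "U_incl m0 m1 n (ucoset 0 0 n f) = ucoset m0 m1 n f"
proof
  have "i + (h + f) = (i + h) + f" for i h by (simp add: add.assoc)
  then show "U_incl m0 m1 n (ucoset 0 0 n f) \<subseteq> ucoset m0 m1 n f"
    using U_ideal_0_subset[of n m0 m1] U_ideal_closed(3)[of _ m0 m1 n]
    by (force simp: U_incl_def set_add_def' free_alg_simps ucoset_eq_image)
next
  show "ucoset m0 m1 n f \<subseteq> U_incl m0 m1 n (ucoset 0 0 n f)"
    using U_ideal_closed(2)[of 0 0 n]
    by (force simp: U_incl_def set_add_def' free_alg_simps ucoset_eq_image)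
qed

section \<open>Polynomials as a quotient of the free algebra on proper variables\<close>

definition proper_pair :: "nat \<times> nat \<Rightarrow> gl" where
  "proper_pair = (\<lambda>(i, j). (Proper i, Proper j))"

definition mono_of :: "(nat \<times> nat) list \<Rightarrow> (nat \<times> nat) \<Rightarrow>\<^sub>0 nat" where
  "mono_of w = sum_list (map (\<lambda>x. Poly_Mapping.single x 1) w)"

lemma lookup_mono_of: "Poly_Mapping.lookup (mono_of w) x = count (mset w) x"
  by (induction w) (auto simp: mono_of_def lookup_add lookup_single)

lemma keys_mono_of: "Poly_Mapping.keys (mono_of w) = set w"
  by (auto simp: in_keys_iff lookup_mono_of)

lemma mono_of_surj: "\<exists>w. mono_of w = m"
proof -
  have "finite {x. Poly_Mapping.lookup m x > 0}"
    using finite_keys[of m] by (simp add: Poly_Mapping.keys.rep_eq)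
  then obtain M where M: "count M = Poly_Mapping.lookup m"
    by (metis count_Abs_multiset)
  obtain w where "mset w = M" by (metis ex_mset)
  then have "mono_of w = m"
    using M by (intro poly_mapping_eqI) (simp add: lookup_mono_of)
  then show ?thesis ..
qed

text \<open>An arbitrary ordering of the variables of a monomial; the choice disappears modulo
  supercommutators by \<open>scomm_ideal_mset_eq\<close>.\<close>

definition word_of :: "((nat \<times> nat) \<Rightarrow>\<^sub>0 nat) \<Rightarrow> (nat \<times> nat) list" where
  "word_of m = (SOME w. mono_of w = m)"

lemma mono_of_word_of: "mono_of (word_of m) = m"
  unfolding word_of_def using mono_of_surj by (rule someI_ex)

definition poly_lift :: "mpoly \<Rightarrow> gl free_elt" where
  "poly_lift = lin (\<lambda>m. gens (map proper_pair (word_of m)))"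

lemma poly_lift_linear:
  "poly_lift (f + g) = poly_lift f + poly_lift g" "poly_lift (f - g) = poly_lift f - poly_lift g" "poly_lift (- f) = - poly_lift f"
  "poly_lift (cst c * f) = cst c * poly_lift f" "poly_lift (sum h J) = (\<Sum>i\<in>J. poly_lift (h i))"
  by (simp_all add: poly_lift_def lin_simps)

lemma poly_lift_zero [simp]: "poly_lift 0 = 0"
  by (simp add: poly_lift_def)

lemma symb_gens_proper_pair: "symb (gens (map proper_pair w)) = Poly_Mapping.single (mono_of w) 1"
proof (induction w)
  case Nil
  show ?case by (simp add: gens_Nil mono_of_def)
next
  case (Cons x w)
  then show ?case
    by (cases x) (simp add: gens_Cons symb_gen mono_of_def proper_pair_def matvar_def mult_single)
qed

lemma poly_lift_single: "poly_lift (Poly_Mapping.single m c) = cst c * gens (map proper_pair (word_of m))"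
  by (simp add: poly_lift_def lin_single)

lemma symb_poly_lift: "symb (poly_lift f) = f"
proof (induction f rule: poly_mapping_single_induct)
  case (single m c)
  show ?case
    by (simp add: poly_lift_single symb_linear symb_gens_proper_pair mono_of_word_of mult_single)
qed (simp add: poly_lift_linear symb_linear)

lemma proper_basis_0: "proper_basis 0 0 n = proper_pair ` ({1..n} \<times> {1..n})"
  by (auto simp: proper_basis_def proper_pair_def all_letters_def virtual_letters_def)

lemma poly_alg_closed:
  "0 \<in> carrier (poly_alg n)"
  "f \<in> carrier (poly_alg n) \<Longrightarrow> g \<in> carrier (poly_alg n) \<Longrightarrow> f + g \<in> carrier (poly_alg n)"
  "f \<in> carrier (poly_alg n) \<Longrightarrow> - f \<in> carrier (poly_alg n)"
  "f \<in> carrier (poly_alg n) \<Longrightarrow> g \<in> carrier (poly_alg n) \<Longrightarrow> f - g \<in> carrier (poly_alg n)"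
  "f \<in> carrier (poly_alg n) \<Longrightarrow> g \<in> carrier (poly_alg n) \<Longrightarrow> f * g \<in> carrier (poly_alg n)"
  "cst c \<in> carrier (poly_alg n)"
  "i \<in> {1..n} \<Longrightarrow> j \<in> {1..n} \<Longrightarrow> matvar i j \<in> carrier (poly_alg n)"
proof -
  interpret P: cring "poly_alg n" by (rule cring_poly_alg)
  have simps: "mult (poly_alg n) = (*)" "add (poly_alg n) = (+)" "zero (poly_alg n) = 0"
    by (simp_all add: poly_alg_def)
  show "0 \<in> carrier (poly_alg n)" using P.zero_closed by (simp add: simps)
  show 1: "f \<in> carrier (poly_alg n) \<Longrightarrow> g \<in> carrier (poly_alg n) \<Longrightarrow> f + g \<in> carrier (poly_alg n)" for f g
    using P.a_closed[of f g] by (simp add: simps)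
  show 2: "f \<in> carrier (poly_alg n) \<Longrightarrow> - f \<in> carrier (poly_alg n)" for f
    by (simp add: poly_alg_def)
  show "f \<in> carrier (poly_alg n) \<Longrightarrow> g \<in> carrier (poly_alg n) \<Longrightarrow> f - g \<in> carrier (poly_alg n)"
    using 1[OF _ 2, of f g] by simp
  show "f \<in> carrier (poly_alg n) \<Longrightarrow> g \<in> carrier (poly_alg n) \<Longrightarrow> f * g \<in> carrier (poly_alg n)"
    using P.m_closed[of f g] by (simp add: simps)
  show "cst c \<in> carrier (poly_alg n)" by (rule single_zero_in_poly_alg)
  show "i \<in> {1..n} \<Longrightarrow> j \<in> {1..n} \<Longrightarrow> matvar i j \<in> carrier (poly_alg n)"
    by (simp add: poly_alg_def matvar_def)
qed

lemma symb_mem: "f \<in> carrier (free_alg (proper_basis 0 0 n)) \<Longrightarrow> symb f \<in> carrier (poly_alg n)"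
proof (induction rule: free_alg_induct)
  case (cst c)
  have "symb (cst c) = cst c" using symb_linear(4)[of c 1] by simp
  then show ?case by (simp add: poly_alg_closed)
next
  case (gen x f)
  from gen.hyps(1) obtain i j where ij: "x = proper_pair (i, j)" "i \<in> {1..n}" "j \<in> {1..n}"
    unfolding proper_basis_0 by blast
  show ?case
    unfolding symb_gen ij(1) proper_pair_def prod.case symb_var.simps by (intro poly_alg_closed(5,7) ij gen.IH)
qed (auto simp: symb_linear intro: poly_alg_closed)

lemma poly_lift_mem:
  assumes "f \<in> carrier (poly_alg n)"
  shows "poly_lift f \<in> carrier (free_alg (proper_basis 0 0 n))"
proof -
  have "set (map proper_pair (word_of m)) \<subseteq> proper_basis 0 0 n" if "m \<in> Poly_Mapping.keys f" for m
    using that assms keys_mono_of[of "word_of m"]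
    by (auto simp: poly_alg_def proper_basis_0 mono_of_word_of)
  then have word: "cst c * gens (map proper_pair (word_of m)) \<in> carrier (free_alg (proper_basis 0 0 n))"
    if "m \<in> Poly_Mapping.keys f" for m c
    using that by (intro free_alg_closed)
  have "sum g M \<in> carrier (free_alg (proper_basis 0 0 n))"
    if "\<And>m. m \<in> M \<Longrightarrow> g m \<in> carrier (free_alg (proper_basis 0 0 n))"
    for g and M :: "((nat \<times> nat) \<Rightarrow>\<^sub>0 nat) set"
    using that by (induction M rule: infinite_finite_induct) (auto intro: free_alg_closed)
  then show ?thesis
    unfolding poly_lift_def lin_def using word by this
qed

lemma ksign_proper_pair: "ksign (proper_pair x) (proper_pair y) = 1"
  by (cases x; cases y) (simp add: ksign_def proper_pair_def gl_parity_def)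

lemma scomm_ideal_swap_to_front:
  assumes "x \<in> proper_basis 0 0 n" "set u \<subseteq> proper_basis 0 0 n" "set v \<subseteq> proper_basis 0 0 n"
  shows "gens (x # u @ v) - gens (u @ x # v) \<in> scomm_ideal 0 0 n"
  using assms(2)
proof (induction u)
  case Nil
  show ?case by (simp add: scomm_ideal_closed)
next
  case (Cons y u)
  have "scommutator x y (gens (u @ v)) \<in> scomm_ideal 0 0 n"
    using Cons.prems assms by (intro scomm_ideal_closed(8) free_alg_closed) auto
  moreover have "ksign x y = 1"
    using Cons.prems assms by (auto simp: proper_basis_0 ksign_proper_pair)
  moreover have "free_gen y * (gens (x # u @ v) - gens (u @ x # v)) \<in> scomm_ideal 0 0 n"
    using Cons by (intro scomm_ideal_closed(6)) auto
  ultimately have "scommutator x y (gens (u @ v)) + free_gen y * (gens (x # u @ v) - gens (u @ x # v)) \<in> scomm_ideal 0 0 n"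
    by (intro scomm_ideal_closed(2))
  then show ?case
    using \<open>ksign x y = 1\<close> by (simp add: scommutator_def gens_Cons algebra_simps)
qed

lemma scomm_ideal_mset_eq:
  "mset u = mset v \<Longrightarrow> set u \<subseteq> proper_basis 0 0 n \<Longrightarrow> gens u - gens v \<in> scomm_ideal 0 0 n"
proof (induction u arbitrary: v)
  case Nil
  then show ?case by (simp add: scomm_ideal_closed)
next
  case (Cons x u)
  then have "x \<in> set v" by (metis list.set_intros(1) mset_eq_setD)
  then obtain a b where v: "v = a @ x # b" by (meson split_list)
  then have ms: "mset u = mset (a @ b)" using Cons.prems by simp
  then have set: "set (a @ b) \<subseteq> proper_basis 0 0 n"
    using Cons.prems(2) mset_eq_setD[OF ms] by auto
  have "free_gen x * (gens u - gens (a @ b)) \<in> scomm_ideal 0 0 n"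
    using Cons ms by (intro scomm_ideal_closed(6) Cons.IH) auto
  moreover have "gens (x # a @ b) - gens (a @ x # b) \<in> scomm_ideal 0 0 n"
    using Cons.prems(2) set by (intro scomm_ideal_swap_to_front) auto
  ultimately have "free_gen x * (gens u - gens (a @ b)) + (gens (x # a @ b) - gens (a @ x # b)) \<in> scomm_ideal 0 0 n"
    by (rule scomm_ideal_closed(2))
  then show ?case
    by (simp add: v gens_Cons algebra_simps)
qed

text \<open>Proper variables are even, so words differing only in the order of their letters agree
  modulo the ideal. Consequently the kernel of \<open>symb\<close> on proper words is the
  supercommutator ideal at \<open>0 0\<close>.\<close>

lemma scomm_ideal_poly_lift_symb:
  assumes "f \<in> carrier (free_alg (proper_basis 0 0 n))"
  shows "f - poly_lift (symb f) \<in> scomm_ideal 0 0 n"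
proof -
  have word: "gens v - poly_lift (symb (gens v)) \<in> scomm_ideal 0 0 n" if v: "set v \<subseteq> proper_basis 0 0 n" for v
  proof -
    obtain w where w: "v = map proper_pair w"
      using v proper_basis_0 by (metis ex_map_conv imageE subsetD)
    have "mset (word_of (mono_of w)) = mset w"
      by (rule multiset_eqI) (simp flip: lookup_mono_of add: mono_of_word_of)
    then show ?thesis
      using v by (auto simp: w symb_gens_proper_pair poly_lift_single intro!: scomm_ideal_mset_eq)
  qed
  have "(\<Sum>w\<in>W. Poly_Mapping.single w (Poly_Mapping.lookup f w))
      - poly_lift (symb (\<Sum>w\<in>W. Poly_Mapping.single w (Poly_Mapping.lookup f w))) \<in> scomm_ideal 0 0 n"
    if "W \<subseteq> Poly_Mapping.keys f" for W
    using that
  proof (induction W rule: infinite_finite_induct)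
    case (insert w W)
    let ?s = "\<lambda>f. f - poly_lift (symb f)" and ?c = "Poly_Mapping.lookup f w"
    have "set (unWord w) \<subseteq> proper_basis 0 0 n"
      using insert.prems assms by (auto simp: free_alg_def)
    then have "cst ?c * ?s (gens (unWord w)) \<in> scomm_ideal 0 0 n"
      by (intro scomm_ideal_closed(3) word)
    also have "cst ?c * ?s (gens (unWord w)) = ?s (Poly_Mapping.single w ?c)"
      by (subst (1 2) single_eq_gens[of w]) (simp add: symb_linear poly_lift_linear right_diff_distrib)
    finally have "?s (Poly_Mapping.single w ?c)
        + ?s (\<Sum>w\<in>W. Poly_Mapping.single w (Poly_Mapping.lookup f w)) \<in> scomm_ideal 0 0 n"
      using insert by (intro scomm_ideal_closed(2)) auto
    then show ?case
      using insert.hyps by (simp add: symb_linear poly_lift_linear algebra_simps)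
  qed (simp_all add: scomm_ideal_closed)
  from this[of "Poly_Mapping.keys f"] show ?thesis
    using poly_mapping_eq_sum_single[of f] by simp
qed

text \<open>This is the statement that U(gl(n)) meets Irr in 0. The vacuum action places
  \<open>vac f\<close> only in the large supercommutator ideal; \<open>symb\<close> shows that this
  proper element lies in the small one already, and normal ordering returns \<open>f\<close> as an
  element of the small \<open>U_ideal\<close>.\<close>

lemma Irr_pre_inter_gl:
  assumes "f \<in> carrier (free_alg (gl_basis 0 0 n))" "f \<in> Irr_pre m0 m1 n"
  shows "f \<in> U_ideal 0 0 n"
proof -
  have "symb (vac f) = 0"
    using vac_Irr_pre[OF assms(2)] by (rule symb_scomm_ideal)
  then have "vac f \<in> scomm_ideal 0 0 n"
    using scomm_ideal_poly_lift_symb[OF vac_mem[OF assms(1)]] by simp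
  then have "nord (vac f) \<in> U_ideal 0 0 n"
    by (rule nord_scomm_ideal)
  then show ?thesis
    using nord_vac[OF assms(1)] by (auto simp: gl_basis_0 snd_proper_basis)
qed

text \<open>Uniqueness in the description of \<open>virt_proj\<close> is
  \<open>Irr_pre_inter_gl\<close> applied to the difference of two candidates.\<close>

lemma virt_proj_ucoset:
  assumes "f \<in> carrier (free_alg (gl_basis m0 m1 n))" "f0 \<in> carrier (free_alg (gl_basis 0 0 n))"
    and "f - f0 \<in> Irr_pre m0 m1 n"
  shows "virt_proj m0 m1 n (ucoset m0 m1 n f) = ucoset 0 0 n f0"
  unfolding virt_proj_def
proof (rule the_equality)
  have sub: "g \<in> carrier (free_alg (gl_basis m0 m1 n))" if "g \<in> carrier (free_alg (gl_basis 0 0 n))" for g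
    using that carrier_mono[OF gl_basis_0_subset] by blast
  have iff: "ucoset m0 m1 n f \<ominus>\<^bsub>U_super m0 m1 n\<^esub> U_incl m0 m1 n (ucoset 0 0 n g) \<in> Irr m0 m1 n
      \<longleftrightarrow> f - g \<in> Irr_pre m0 m1 n" if "g \<in> carrier (free_alg (gl_basis 0 0 n))" for g
    using that assms(1) sub[OF that] by (simp add: U_incl_ucoset ucoset_minus Irr_pre_def free_alg_closed)
  show "ucoset 0 0 n f0 \<in> carrier (U_gl n) \<and>
      ucoset m0 m1 n f \<ominus>\<^bsub>U_super m0 m1 n\<^esub> U_incl m0 m1 n (ucoset 0 0 n f0) \<in> Irr m0 m1 n"
    using assms iff[OF assms(2)] ucoset_mem[OF assms(2)] by (simp add: U_gl_def)
  show "u = ucoset 0 0 n f0" if u: "u \<in> carrier (U_gl n) \<and>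
      ucoset m0 m1 n f \<ominus>\<^bsub>U_super m0 m1 n\<^esub> U_incl m0 m1 n u \<in> Irr m0 m1 n" for u
  proof -
    obtain g where g: "u = ucoset 0 0 n g" "g \<in> carrier (free_alg (gl_basis 0 0 n))"
      using u by (auto simp: U_gl_def carrier_U)
    then have "(f - f0) - (f - g) \<in> Irr_pre m0 m1 n"
      using u iff assms(3) by (intro left_submodule.diff[OF left_submodule_Irr_pre, of "f - f0"]) auto
    then have "g - f0 \<in> U_ideal 0 0 n"
      using g assms(2) by (intro Irr_pre_inter_gl) (auto intro: free_alg_closed)
    then show ?thesis by (simp add: g ucoset_eq_iff)
  qed
qed

definition corr :: "nat \<Rightarrow> mpoly \<Rightarrow> U_elt" where
  "corr n p = ucoset 0 0 n (nord (poly_lift p))"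

text \<open>Says that \<open>f\<close> represents an element of U(gl(n)) + Irr whose projection has
  Koszul image \<open>p\<close>; any proper representative \<open>g\<close> of \<open>p\<close> may
  serve as witness. In this form the property is additive and depends on \<open>f\<close> only
  modulo \<open>Irr\<close>.\<close>

definition virtual_symbol :: "nat \<Rightarrow> nat \<Rightarrow> nat \<Rightarrow> gl free_elt \<Rightarrow> mpoly \<Rightarrow> bool" where
  "virtual_symbol m0 m1 n f p \<longleftrightarrow> f \<in> carrier (free_alg (gl_basis m0 m1 n)) \<and>
     (\<exists>g \<in> carrier (free_alg (proper_basis 0 0 n)). symb g = p \<and> f - nord g \<in> Irr_pre m0 m1 n)"

lemma nord_mem_gl:
  "g \<in> carrier (free_alg (proper_basis 0 0 n)) \<Longrightarrow> nord g \<in> carrier (free_alg (gl_basis 0 0 n))"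
  using nord_mem[of g 0 0 n] by (simp add: gl_basis_0)

lemma virt_proj_virtual_symbol:
  assumes "virtual_symbol m0 m1 n f p"
  shows "virt_proj m0 m1 n (ucoset m0 m1 n f) = corr n p" "p \<in> carrier (poly_alg n)"
proof -
  from assms obtain g where f: "f \<in> carrier (free_alg (gl_basis m0 m1 n))"
    and g: "g \<in> carrier (free_alg (proper_basis 0 0 n))" "symb g = p" "f - nord g \<in> Irr_pre m0 m1 n"
    by (auto simp: virtual_symbol_def)
  show "p \<in> carrier (poly_alg n)"
    using symb_mem[OF g(1)] g(2) by simp
  have "nord (g - poly_lift (symb g)) \<in> U_ideal 0 0 n"
    by (intro nord_scomm_ideal scomm_ideal_poly_lift_symb g)
  then have "ucoset 0 0 n (nord g) = corr n p"
    by (simp add: corr_def ucoset_eq_iff nord_linear g)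
  then show "virt_proj m0 m1 n (ucoset m0 m1 n f) = corr n p"
    using virt_proj_ucoset[OF f nord_mem_gl[OF g(1)] g(3)] by simp
qed

lemma virtual_symbol_add:
  assumes "virtual_symbol m0 m1 n f p" "virtual_symbol m0 m1 n g q"
  shows "virtual_symbol m0 m1 n (f + g) (p + q)"
proof -
  from assms obtain f' g' where *: "f' \<in> carrier (free_alg (proper_basis 0 0 n))" "symb f' = p"
    "g' \<in> carrier (free_alg (proper_basis 0 0 n))" "symb g' = q"
    "f - nord f' \<in> Irr_pre m0 m1 n" "g - nord g' \<in> Irr_pre m0 m1 n"
    by (auto simp: virtual_symbol_def)
  have "(f - nord f') + (g - nord g') \<in> Irr_pre m0 m1 n"
    using * by (intro left_submodule.add[OF left_submodule_Irr_pre])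
  then show ?thesis
    using * assms unfolding virtual_symbol_def
    by (intro conjI bexI[of _ "f' + g'"]) (auto simp: symb_linear nord_linear algebra_simps intro: free_alg_closed)
qed

lemma virtual_symbol_zero: "virtual_symbol m0 m1 n 0 0"
  unfolding virtual_symbol_def
  by (intro conjI bexI[of _ 0]) (auto simp: free_alg_closed left_submodule.zero[OF left_submodule_Irr_pre])

lemma virtual_symbol_sum:
  "(\<And>i. i \<in> I \<Longrightarrow> virtual_symbol m0 m1 n (f i) (p i)) \<Longrightarrow> virtual_symbol m0 m1 n (sum f I) (sum p I)"
  by (induction I rule: infinite_finite_induct) (auto intro: virtual_symbol_zero virtual_symbol_add)

lemma virtual_symbol_cong:
  assumes "virtual_symbol m0 m1 n f p" "g - f \<in> Irr_pre m0 m1 n" "g \<in> carrier (free_alg (gl_basis m0 m1 n))"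
  shows "virtual_symbol m0 m1 n g p"
proof -
  from assms obtain f' where *: "f' \<in> carrier (free_alg (proper_basis 0 0 n))" "symb f' = p"
    "f - nord f' \<in> Irr_pre m0 m1 n"
    by (auto simp: virtual_symbol_def)
  have "(g - f) + (f - nord f') \<in> Irr_pre m0 m1 n"
    using * assms by (intro left_submodule.add[OF left_submodule_Irr_pre])
  then show ?thesis
    using * assms unfolding virtual_symbol_def
    by (intro conjI bexI[of _ "f'"]) auto
qed

text \<open>\<open>vac\<close> undoes \<open>nord\<close> and \<open>symb\<close> undoes
  \<open>poly_lift\<close>, while \<open>vac\<close> followed by \<open>symb\<close> annihilates
  \<open>U_ideal\<close>.\<close>

lemma corr_inj: "inj_on (corr n) (carrier (poly_alg n))"
proof (rule inj_onI)
  fix p q assume pq: "p \<in> carrier (poly_alg n)" "q \<in> carrier (poly_alg n)" "corr n p = corr n q"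
  let ?g = "poly_lift (p - q)"
  have "nord ?g \<in> U_ideal 0 0 n"
    using pq(3) by (simp add: corr_def ucoset_eq_iff nord_linear poly_lift_linear)
  then have "vac (nord ?g) \<in> scomm_ideal 0 0 n"
    by (rule vac_U_ideal)
  moreover have "?g \<in> carrier (free_alg (proper_basis 0 0 n))"
    using pq by (intro poly_lift_mem poly_alg_closed)
  then obtain k where "deg_le (proper_basis 0 0 n) k ?g"
    unfolding carrier_free_alg_iff by blast
  then have "vac (nord ?g) = ?g"
    by (rule vac_nord) (auto simp: snd_proper_basis intro: stable_proper_basis subsetD[OF proper_basis_subset])
  ultimately have "symb ?g = 0"
    using symb_scomm_ideal by metis
  then show "p = q" by (simp add: symb_poly_lift)
qed

lemma corr_linear_map: "linear_map class_ring (poly_alg n) (U_gl n) (restrict (corr n) (carrier (poly_alg n)))"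
proof -
  interpret P: vectorspace class_ring "poly_alg n" by (rule vectorspace_poly_alg)
  interpret U: vectorspace class_ring "U_gl n" unfolding U_gl_def by (rule vectorspace_U_super)
  have mem: "nord (poly_lift p) \<in> carrier (free_alg (gl_basis 0 0 n))" if "p \<in> carrier (poly_alg n)" for p
    using that by (intro nord_mem_gl poly_lift_mem)
  have smult: "c \<odot>\<^bsub>poly_alg n\<^esub> p = cst c * p" for c p
    by (simp add: poly_alg_def)
  have add: "p \<oplus>\<^bsub>poly_alg n\<^esub> q = p + q" for p q
    by (simp add: poly_alg_def)
  have "restrict (corr n) (carrier (poly_alg n)) \<in> LinearCombinations.module_hom class_ring (poly_alg n) (U_gl n)"
    unfolding LinearCombinations.module_hom_def
    by (auto simp: smult add poly_alg_closed corr_def U_gl_def mem ucoset_mem ucoset_add ucoset_smult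
        poly_lift_linear nord_linear)
  then show ?thesis
    by unfold_locales
qed

section \<open>Capelli bitableaux\<close>

lemma minus_one_power_closed:
  fixes f :: "'a::ring_1"
  assumes "f \<in> K" "\<And>f. f \<in> K \<Longrightarrow> - f \<in> K"
  shows "(-1) ^ k * f \<in> K"
  using assms by (cases "even k") simp_all

lemma minus_one_power_commute: "f * (-1) ^ k = (-1) ^ k * (f :: 'a::ring_1)"
  by (cases "even k") simp_all

lemma polar_minus_one_power: "polar x ((-1) ^ k * f) = (-1) ^ k * polar x f"
  by (cases "even k") (simp_all add: polar_linear)

lemma symb_minus_one_power: "symb ((-1) ^ k * f) = (-1) ^ k * symb f"
  by (cases "even k") (simp_all add: symb_linear)

lemma symb_minus_one [simp]: "symb ((-1) ^ k) = (-1) ^ k"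
  using symb_minus_one_power[of k 1] by simp

definition scong :: "nat \<Rightarrow> nat \<Rightarrow> nat \<Rightarrow> gl free_elt \<Rightarrow> gl free_elt \<Rightarrow> bool" where
  "scong m0 m1 n f g \<longleftrightarrow> f - g \<in> scomm_ideal m0 m1 n"

context
  fixes m0 m1 n :: nat
begin

abbreviation scong' (infix "\<approx>" 50) where "f \<approx> g \<equiv> scong m0 m1 n f g"

lemma scong_refl [simp]: "f \<approx> f"
  by (simp add: scong_def scomm_ideal_closed)

lemma scong_trans [trans]: "f \<approx> g \<Longrightarrow> g \<approx> h \<Longrightarrow> f \<approx> h"
  using scomm_ideal_closed(2)[of "f - g" m0 m1 n "g - h"] by (simp add: scong_def)

lemma scong_add: "f \<approx> g \<Longrightarrow> f' \<approx> g' \<Longrightarrow> f + f' \<approx> g + g'"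
  using scomm_ideal_closed(2)[of "f - g" m0 m1 n "f' - g'"] by (simp add: scong_def algebra_simps)

lemma scong_uminus: "f \<approx> g \<Longrightarrow> - f \<approx> - g"
  using scomm_ideal_closed(4)[of "f - g" m0 m1 n] by (simp add: scong_def)

lemma scong_sign: "f \<approx> g \<Longrightarrow> (-1) ^ k * f \<approx> (-1) ^ k * g"
  by (cases "even k") (simp_all add: scong_uminus)

lemma scong_sum: "(\<And>i. i \<in> I \<Longrightarrow> f i \<approx> g i) \<Longrightarrow> sum f I \<approx> sum g I"
  by (induction I rule: infinite_finite_induct) (auto intro: scong_add)

lemma scong_gen: "x \<in> proper_basis m0 m1 n \<Longrightarrow> f \<approx> g \<Longrightarrow> free_gen x * f \<approx> free_gen x * g"
  using scomm_ideal_closed(6)[of x m0 m1 n "f - g"] by (simp add: scong_def algebra_simps)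

lemma scong_gens: "set w \<subseteq> proper_basis m0 m1 n \<Longrightarrow> f \<approx> g \<Longrightarrow> gens w * f \<approx> gens w * g"
  by (induction w) (auto simp: gens_Nil gens_Cons mult.assoc intro: scong_gen)

lemma scong_right:
  "f \<approx> g \<Longrightarrow> h \<in> carrier (free_alg (proper_basis m0 m1 n)) \<Longrightarrow> f * h \<approx> g * h"
  using scomm_ideal_closed(7)[of "f - g" m0 m1 n h] by (simp add: scong_def algebra_simps)

lemma scong_polar: "x \<in> gl_basis m0 m1 n \<Longrightarrow> f \<approx> g \<Longrightarrow> polar x f \<approx> polar x g"
  using scomm_ideal_closed(9)[of x m0 m1 n "f - g"] by (simp add: scong_def polar_linear)

lemma scong_foldr_polar: "set xs \<subseteq> gl_basis m0 m1 n \<Longrightarrow> f \<approx> g \<Longrightarrow> foldr polar xs f \<approx> foldr polar xs g"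
  by (induction xs) (auto intro: scong_polar)

lemma scong_swap:
  assumes "x \<in> proper_basis m0 m1 n" "y \<in> proper_basis m0 m1 n"
    "f \<in> carrier (free_alg (proper_basis m0 m1 n))"
  shows "free_gen x * (free_gen y * f) \<approx> ksign x y * (free_gen y * (free_gen x * f))"
  using scomm_ideal_closed(8)[OF assms] by (simp add: scong_def scommutator_def)

end

text \<open>Only the letters \<open>Alpha\<close> are even, so \<open>(Proper, Alpha)\<close>,
  \<open>(Alpha, Proper)\<close> and \<open>(Alpha, Beta)\<close> are odd generators, while
  \<open>(Proper, Proper)\<close> and \<open>(Beta, Proper)\<close> are even. The signs of the
  polarizations below come from these parities.\<close>

lemma ksign_simps [simp]:
  "ksign (Proper i, Alpha a) (Alpha b, Proper j) = -1"
  "ksign (Proper i, Alpha a) (Proper b, Proper j) = 1"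
  "ksign (Alpha b, Proper j) (Proper i, Proper k) = 1"
  "ksign (Alpha b, Beta d) (Beta i, Proper k) = 1"
  "ksign (Beta i, Proper k) (Alpha b, Proper j) = 1"
  "ksign (Alpha b, Beta d) (Alpha i, Proper k) = -1"
  "ksign (Alpha b, Proper d) (Alpha i, Proper k) = -1"
  by (simp_all add: ksign_def gl_parity_def)

lemma foldr_polar_linear:
  "foldr polar xs (f + g) = foldr polar xs f + foldr polar xs g"
  "foldr polar xs (sum h I) = (\<Sum>i\<in>I. foldr polar xs (h i))"
  "foldr polar xs ((-1) ^ k * f) = (-1) ^ k * foldr polar xs f"
  by (induction xs) (simp_all add: polar_linear polar_minus_one_power)

lemma polar_mult_right: "polar x g = 0 \<Longrightarrow> polar x (f * g) = polar x f * g"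
  by (induction f rule: free_elt_induct)
    (simp_all add: polar_linear polar_gen mult.assoc distrib_right)

lemma polar_proper_eq_0:
  assumes "f \<in> carrier (free_alg (proper_basis 0 0 n))" "snd x \<notin> range Proper"
  shows "polar x f = 0"
  using assms(1)
proof (induction rule: free_alg_induct)
  case (gen y f)
  then show ?case
    using assms(2) by (auto simp: polar_gen act_def proper_basis_0 proper_pair_def)
qed (simp_all add: polar_linear)

text \<open>A factor in proper variables contains no virtual row letter, hence is a constant for the
  remaining polarizations and splits off.\<close>

lemma foldr_polar_mult_right:
  assumes "g \<in> carrier (free_alg (proper_basis 0 0 n))" "\<And>x. x \<in> set xs \<Longrightarrow> snd x \<notin> range Proper"
  shows "foldr polar xs (f * g) = foldr polar xs f * g"
  using assms(2) by (induction xs) (simp_all add: polar_mult_right polar_proper_eq_0[OF assms(1)])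

section \<open>One row: Laplace expansion\<close>

definition drop_nth :: "nat \<Rightarrow> 'a list \<Rightarrow> 'a list" where
  "drop_nth s xs = take s xs @ drop (Suc s) xs"

lemma drop_nth_simps [simp]: "drop_nth 0 (x # xs) = xs" "drop_nth (Suc s) (x # xs) = x # drop_nth s xs"
  by (simp_all add: drop_nth_def)

lemma length_drop_nth: "s < length xs \<Longrightarrow> length (drop_nth s xs) = length xs - 1"
  by (auto simp: drop_nth_def)

lemma set_drop_nth: "set (drop_nth s xs) \<subseteq> set xs"
  by (auto simp: drop_nth_def dest: in_set_takeD in_set_dropD)

text \<open>Operator and variables are odd, so reaching position \<open>s\<close> costs
  \<open>(-1) ^ s\<close>; the new variable is even and moves to the front without a sign.\<close>

lemma polar_row:
  assumes "i \<in> {1..n}" "a \<in> {1..m0}" "set js \<subseteq> {1..n}"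
  shows "scong m0 m1 n (polar (Proper i, Alpha a) (gens (map (\<lambda>j. (Alpha a, Proper j)) js)))
    (\<Sum>s<length js. (-1) ^ s * (free_gen (Proper i, Proper (js ! s)) *
        gens (map (\<lambda>j. (Alpha a, Proper j)) (drop_nth s js))))"
  using assms(3)
proof (induction js)
  case (Cons j js)
  let ?w = "\<lambda>js. gens (map (\<lambda>j. (Alpha a, Proper j)) js)"
  let ?g = "\<lambda>s. free_gen (Proper i, Proper (js ! s))"
  let ?y = "(Alpha a, Proper j)"
  have y: "?y \<in> proper_basis m0 m1 n"
    using assms(2) Cons.prems by (auto simp: proper_basis_def all_letters_def virtual_letters_def)
  have "polar (Proper i, Alpha a) (?w (j # js)) =
      free_gen (Proper i, Proper j) * ?w js + - (free_gen ?y * polar (Proper i, Alpha a) (?w js))"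
    by (simp add: gens_Cons polar_gen act_def)
  also have "scong m0 m1 n \<dots> (free_gen (Proper i, Proper j) * ?w js
      + - (free_gen ?y * (\<Sum>s<length js. (-1) ^ s * (?g s * ?w (drop_nth s js)))))"
    using Cons y by (intro scong_add scong_uminus scong_gen scong_refl) auto
  also have "\<dots> = free_gen (Proper i, Proper j) * ?w js
      + (\<Sum>s<length js. (-1) ^ Suc s * (free_gen ?y * (?g s * ?w (drop_nth s js))))"
    by (simp add: sum_distrib_left sum_negf mult.assoc[symmetric] minus_one_power_commute)
  also have "scong m0 m1 n \<dots> (free_gen (Proper i, Proper j) * ?w js
      + (\<Sum>s<length js. (-1) ^ Suc s * (?g s * (free_gen ?y * ?w (drop_nth s js)))))"
  proof (intro scong_add scong_sum scong_sign scong_refl)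
    fix s assume "s \<in> {..<length js}"
    then have "js ! s \<in> {1..n}" using Cons.prems by (auto simp: subset_iff)
    moreover have "set (drop_nth s js) \<subseteq> {1..n}"
      using Cons.prems set_drop_nth[of s js] by auto
    ultimately have "(Proper i, Proper (js ! s)) \<in> proper_basis m0 m1 n"
      "set (map (\<lambda>j. (Alpha a, Proper j)) (drop_nth s js)) \<subseteq> proper_basis m0 m1 n"
      using assms(1,2) by (auto simp: proper_basis_def all_letters_def virtual_letters_def)
    then show "scong m0 m1 n (free_gen ?y * (?g s * ?w (drop_nth s js)))
        (?g s * (free_gen ?y * ?w (drop_nth s js)))"
      using scong_swap[OF y _ free_alg_closed(9), of "(Proper i, Proper (js ! s))"
          "map (\<lambda>j. (Alpha a, Proper j)) (drop_nth s js)"] by simp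
  qed
  also have "\<dots> = (\<Sum>s<length (j # js). (-1) ^ s * (free_gen (Proper i, Proper ((j # js) ! s)) *
        ?w (drop_nth s (j # js))))"
    by (simp add: sum.lessThan_Suc_shift gens_Cons del: sum.lessThan_Suc power_Suc) 
  finally show ?case .
qed (simp add: gens_Nil)

text \<open>The first list holds the row letters in order of application, that is, a row of the left
  tableau read backwards, because the rightmost operator acts first. Each step chooses the column
  letter paired with the current row letter.\<close>

primrec row_symbol :: "nat list \<Rightarrow> nat list \<Rightarrow> gl free_elt" where
  "row_symbol [] js = 1"
| "row_symbol (i # is) js = (\<Sum>s<length js. (-1) ^ s *
     (free_gen (Proper i, Proper (js ! s)) * row_symbol is (drop_nth s js)))"

lemma foldr_polar_Proper:
  "foldr polar (map (\<lambda>i. (Proper i, Alpha a)) is) (free_gen (Proper i, Proper j) * f) =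
   free_gen (Proper i, Proper j) * foldr polar (map (\<lambda>i. (Proper i, Alpha a)) is) f"
  by (induction "is") (simp_all add: polar_gen act_def)

lemma foldr_polar_row:
  assumes "a \<in> {1..m0}"
  shows "length is = length js \<Longrightarrow> set is \<subseteq> {1..n} \<Longrightarrow> set js \<subseteq> {1..n} \<Longrightarrow>
    scong m0 m1 n (foldr polar (map (\<lambda>i. (Proper i, Alpha a)) (rev is))
        (gens (map (\<lambda>j. (Alpha a, Proper j)) js))) (row_symbol is js)"
proof (induction "is" arbitrary: js)
  case Nil
  then show ?case by (simp add: gens_Nil)
next
  case (Cons i "is")
  let ?w = "\<lambda>js. gens (map (\<lambda>j. (Alpha a, Proper j)) js)"
  let ?d = "map (\<lambda>i. (Proper i, Alpha a)) (rev is)"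
  have "foldr polar (map (\<lambda>i. (Proper i, Alpha a)) (rev (i # is))) (?w js) =
      foldr polar ?d (polar (Proper i, Alpha a) (?w js))"
    by simp
  also have "scong m0 m1 n \<dots> (foldr polar ?d (\<Sum>s<length js. (-1) ^ s *
      (free_gen (Proper i, Proper (js ! s)) * ?w (drop_nth s js))))"
    using Cons.prems assms
    by (intro scong_foldr_polar polar_row) (auto simp: gl_basis_def all_letters_def virtual_letters_def)
  also have "\<dots> = (\<Sum>s<length js. (-1) ^ s *
      (free_gen (Proper i, Proper (js ! s)) * foldr polar ?d (?w (drop_nth s js))))"
    by (simp only: foldr_polar_linear foldr_polar_Proper)
  also have "scong m0 m1 n \<dots> (row_symbol (i # is) js)"
    unfolding row_symbol.simps
  proof (intro scong_sum scong_sign scong_gen Cons.IH)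
    fix s assume "s \<in> {..<length js}"
    then have "js ! s \<in> {1..n}" "length (drop_nth s js) = length js - 1"
      using Cons.prems by (auto simp: subset_iff length_drop_nth)
    then show "(Proper i, Proper (js ! s)) \<in> proper_basis m0 m1 n" "length is = length (drop_nth s js)"
      using Cons.prems by (auto simp: proper_basis_def all_letters_def)
  qed (use Cons.prems set_drop_nth in force)+
  finally show ?case .
qed

lemma free_alg_sum:
  fixes A :: "'g set"
  shows "(\<And>i. i \<in> I \<Longrightarrow> f i \<in> carrier (free_alg A)) \<Longrightarrow> sum f I \<in> carrier (free_alg A)"
  by (induction I rule: infinite_finite_induct) (auto intro: free_alg_closed)

lemma free_alg_sign:
  fixes A :: "'g set"
  shows "f \<in> carrier (free_alg A) \<Longrightarrow> (-1) ^ k * f \<in> carrier (free_alg A)"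
  by (rule minus_one_power_closed) (auto intro: free_alg_closed)

lemma row_symbol_mem:
  "length is = length js \<Longrightarrow> set is \<subseteq> {1..n} \<Longrightarrow> set js \<subseteq> {1..n} \<Longrightarrow>
    row_symbol is js \<in> carrier (free_alg (proper_basis 0 0 n))"
proof (induction "is" arbitrary: js)
  case Nil
  then show ?case by (simp add: free_alg_closed)
next
  case (Cons i "is")
  show ?case
    unfolding row_symbol.simps
  proof (intro free_alg_sum free_alg_sign free_alg_closed(2) free_alg_closed(8) Cons.IH)
    fix s assume "s \<in> {..<length js}"
    then have "js ! s \<in> {1..n}" "length (drop_nth s js) = length js - 1"
      using Cons.prems by (auto simp: subset_iff length_drop_nth)
    then show "(Proper i, Proper (js ! s)) \<in> proper_basis 0 0 n" "length is = length (drop_nth s js)"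
      using Cons.prems by (auto simp: proper_basis_def all_letters_def)
  qed (use Cons.prems set_drop_nth in force)+
qed

lemma symb_row_symbol: "length is = length js \<Longrightarrow> symb (row_symbol is js) = biword (rev is) js"
proof (induction "is" arbitrary: js)
  case Nil
  then show ?case by (simp add: biword_def numeral_2_eq_2)
next
  case (Cons i "is")
  define p where "p = length is"
  have len: "length js = Suc p" using Cons.prems by (simp add: p_def)
  let ?M = "mat (Suc p) (Suc p) (\<lambda>(r, s). matvar (rev (i # is) ! r) (js ! s))"
  have M: "?M \<in> carrier_mat (Suc p) (Suc p)" by simp
  have minor: "mat_delete ?M p s = mat p p (\<lambda>(r, c). matvar (rev is ! r) (drop_nth s js ! c))"
    if "s < Suc p" for s
    using that len
    by (intro eq_matI) (auto simp: mat_delete_def drop_nth_def nth_append p_def min_def)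
  have biword: "biword (rev is) v =
      (-1) ^ (p choose 2) * det (mat p p (\<lambda>(r, c). matvar (rev is ! r) (v ! c)))" for v
    by (simp add: biword_def p_def)
  \<comment> \<open>The letter \<open>i\<close> labels the last row of the matrix, so expansion
    along it gives \<open>(-1) ^ (p + s)\<close>. The surplus \<open>(-1) ^ p\<close> is exactly the
    ratio of the binomial signs of \<open>biword\<close> in sizes \<open>Suc p\<close> and
    \<open>p\<close>.\<close>
  have sign: "(-1) ^ (Suc p choose 2) * ((-1) ^ (p + s) * x) = (-1) ^ s * ((-1) ^ (p choose 2) * x)"
    for s and x :: mpoly
  proof -
    have "Suc p choose 2 = (p choose 2) + p"
      by (simp add: numeral_2_eq_2)
    then show ?thesis
      by (auto simp: minus_one_power_iff)
  qed
  have "biword (rev (i # is)) js = (-1) ^ (Suc p choose 2) * det ?M"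
    by (simp add: biword_def p_def)
  also have "\<dots> = (\<Sum>s<Suc p. (-1) ^ (Suc p choose 2) *
      ((-1) ^ (p + s) * (matvar i (js ! s) * det (mat_delete ?M p s))))"
    unfolding laplace_expansion_row[OF M lessI] cofactor_def sum_distrib_left
    by (intro sum.cong refl) (simp add: p_def nth_append mult_ac)
  also have "\<dots> = (\<Sum>s<Suc p. (-1) ^ s * (matvar i (js ! s) * biword (rev is) (drop_nth s js)))"
    unfolding sign by (intro sum.cong refl) (simp add: biword minor mult_ac del: rev.simps)
  also have "\<dots> = symb (row_symbol (i # is) js)"
    using Cons.IH len
    by (simp add: symb_linear symb_minus_one_power symb_gen length_drop_nth p_def del: sum.lessThan_Suc)
  finally show ?case ..
qed

section \<open>Several rows: signs between rows\<close>

type_synonym row = "nat list \<times> nat \<times> nat list"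

definition row_ops :: "row \<Rightarrow> gl list" where
  "row_ops = (\<lambda>(u, a, v). map (\<lambda>i. (Proper i, Alpha a)) u)"

definition row_vars :: "row \<Rightarrow> gl list" where
  "row_vars = (\<lambda>(u, a, v). map (\<lambda>j. (Alpha a, Proper j)) v)"

text \<open>The exponent counts how often an odd operator of a later row, which acts earlier, passes
  an odd variable of the row \<open>r\<close>; \<open>bitableau_Cons\<close> produces the same
  exponent.\<close>

primrec rows_symbol :: "row list \<Rightarrow> gl free_elt" where
  "rows_symbol [] = 1"
| "rows_symbol (r # rs) = (-1) ^ (length (snd (snd r)) * (\<Sum>r\<leftarrow>rs. length (fst r))) *
     (row_symbol (rev (fst r)) (snd (snd r)) * rows_symbol rs)"

definition row_ok :: "nat \<Rightarrow> nat \<Rightarrow> row \<Rightarrow> bool" where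
  "row_ok m0 n r \<longleftrightarrow> length (fst r) = length (snd (snd r)) \<and> fst (snd r) \<in> {1..m0} \<and>
     set (fst r) \<subseteq> {1..n} \<and> set (snd (snd r)) \<subseteq> {1..n}"

lemma rows_symbol_mem:
  "(\<And>r. r \<in> set rs \<Longrightarrow> row_ok m0 n r) \<Longrightarrow> rows_symbol rs \<in> carrier (free_alg (proper_basis 0 0 n))"
proof (induction rs)
  case (Cons r rs)
  have "row_ok m0 n r" using Cons.prems by simp
  then have "row_symbol (rev (fst r)) (snd (snd r)) \<in> carrier (free_alg (proper_basis 0 0 n))"
    by (intro row_symbol_mem) (auto simp: row_ok_def)
  then show ?case
    using Cons by (simp add: free_alg_sign free_alg_closed)
qed (simp add: free_alg_closed)

lemma polar_row_vars:
  assumes "a \<noteq> b"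
  shows "polar (Proper i, Alpha b) (gens (map (\<lambda>j. (Alpha a, Proper j)) v) * f) =
    (-1) ^ length v * (gens (map (\<lambda>j. (Alpha a, Proper j)) v) * polar (Proper i, Alpha b) f)"
  using assms
  by (induction v) (simp_all add: gens_Nil gens_Cons mult.assoc polar_gen act_def,
    simp add: mult.assoc[symmetric] minus_one_power_commute)

lemma foldr_polar_row_vars:
  assumes "\<And>r. r \<in> set rs \<Longrightarrow> fst (snd r) \<noteq> a"
  shows "foldr polar (concat (map row_ops rs)) (gens (map (\<lambda>j. (Alpha a, Proper j)) v) * f) =
    (-1) ^ (length v * (\<Sum>r\<leftarrow>rs. length (fst r))) * 
    (gens (map (\<lambda>j. (Alpha a, Proper j)) v) * foldr polar (concat (map row_ops rs)) f)"
  using assms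
proof (induction rs arbitrary: f)
  case (Cons r rs)
  let ?w = "gens (map (\<lambda>j. (Alpha a, Proper j)) v)"
  obtain u b v' where r: "r = (u, b, v')" by (cases r)
  have sign: "(-1) ^ k * ((-1) ^ m * h) = (-1) ^ (m + k) * h" for k m and h :: "gl free_elt"
    by (cases "even k"; cases "even m") simp_all
  have "foldr polar (map (\<lambda>i. (Proper i, Alpha b)) u) (?w * g) =
     (-1) ^ (length v * length u) * (?w * foldr polar (map (\<lambda>i. (Proper i, Alpha b)) u) g)" for g
    using Cons.prems[of r] 
    by (induction u) (simp_all add: r polar_minus_one_power polar_row_vars sign add.commute)
  then show ?case
    using Cons by (simp add: r row_ops_def foldr_polar_linear sign distrib_left add.commute)
qed simp

text \<open>The operators of the later rows carry other virtual letters, so they pass the variables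
  of the first row with a sign and act on the rest by induction. The rest is then free of virtual
  row letters, and the operators of the first row act on the first row alone.\<close>

lemma foldr_polar_rows:
  assumes "\<And>r. r \<in> set rs \<Longrightarrow> row_ok m0 n r" "distinct (map (fst \<circ> snd) rs)"
  shows "scong m0 m1 n (foldr polar (concat (map row_ops rs)) (gens (concat (map row_vars rs))))
    (rows_symbol rs)"
  using assms
proof (induction rs)
  case Nil
  then show ?case by (simp add: gens_Nil)
next
  case (Cons r rs)
  obtain u a v where r: "r = (u, a, v)" by (cases r)
  have ok: "row_ok m0 n (u, a, v)" using Cons.prems by (simp add: r)
  then have ok': "length u = length v" "a \<in> {1..m0}" "set u \<subseteq> {1..n}" "set v \<subseteq> {1..n}"
    by (simp_all add: row_ok_def)
  let ?w = "gens (map (\<lambda>j. (Alpha a, Proper j)) v)" and ?d = "map (\<lambda>i. (Proper i, Alpha a)) u"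
  let ?k = "length v * (\<Sum>r\<leftarrow>rs. length (fst r))"
  have mem: "rows_symbol rs \<in> carrier (free_alg (proper_basis 0 0 n))"
    using Cons.prems by (intro rows_symbol_mem) auto
  have d: "set ?d \<subseteq> gl_basis m0 m1 n" and w: "set (map (\<lambda>j. (Alpha a, Proper j)) v) \<subseteq> proper_basis m0 m1 n"
    using ok' by (auto simp: gl_basis_def proper_basis_def all_letters_def virtual_letters_def)
  have "foldr polar (concat (map row_ops (r # rs))) (gens (concat (map row_vars (r # rs)))) =
      foldr polar ?d (foldr polar (concat (map row_ops rs)) (?w * gens (concat (map row_vars rs))))"
    by (simp add: r row_ops_def row_vars_def gens_append)
  also have "\<dots> = (-1) ^ ?k * foldr polar ?d (?w * foldr polar (concat (map row_ops rs)) (gens (concat (map row_vars rs))))"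
    using Cons.prems by (subst foldr_polar_row_vars) (force simp: r, simp add: foldr_polar_linear)
  also have "scong m0 m1 n \<dots> ((-1) ^ ?k * foldr polar ?d (?w * rows_symbol rs))"
    using Cons d w by (intro scong_sign scong_foldr_polar scong_gens) auto
  also have "\<dots> = (-1) ^ ?k * (foldr polar ?d ?w * rows_symbol rs)"
    using mem by (subst foldr_polar_mult_right) auto
  also have "scong m0 m1 n \<dots> ((-1) ^ ?k * (row_symbol (rev u) v * rows_symbol rs))"
    using foldr_polar_row[OF ok'(2), of "rev u" v n m1] ok'
      subsetD[OF carrier_mono[OF proper_basis_0_subset] mem]
    by (intro scong_sign scong_right) auto
  finally show ?case by (simp add: r)
qed

text \<open>In the sign exponent each later row of \<open>S\<close> meets the split-off row once,
  contributing its length times \<open>length v\<close>; what remains is the exponent of the shorter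
  tableaux.\<close>

lemma bitableau_Cons:
  "length S = length T \<Longrightarrow> bitableau (u # S) (v # T) =
    (-1) ^ (length v * sum_list (map length S)) * (biword u v * bitableau S T)"
proof -
  assume len: "length S = length T"
  have Suc: "{1..<length (u # S)} = Suc ` {..<length S}"
    by (auto simp: image_iff Suc_le_eq gr0_conv_Suc)
  have "(\<Sum>k = 1..<length (u # S). length ((u # S) ! k) * (\<Sum>i<k. length ((v # T) ! i)))
     = (\<Sum>k<length S. length (S ! k) * (length v + (\<Sum>i<k. length (T ! i))))"
    unfolding Suc by (simp add: sum.reindex sum.lessThan_Suc_shift del: sum.lessThan_Suc)
  also have "\<dots> = length v * sum_list (map length S) + (\<Sum>k<length S. length (S ! k) * (\<Sum>i<k. length (T ! i)))"
    by (simp add: distrib_left sum.distrib sum_list_sum_nth sum_distrib_left mult.commute lessThan_atLeast0)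
  also have "(\<Sum>k<length S. length (S ! k) * (\<Sum>i<k. length (T ! i))) =
      (\<Sum>k\<in>{1..<length S}. length (S ! k) * (\<Sum>i<k. length (T ! i)))"
    by (rule sum.mono_neutral_right) (auto simp: not_le)
  finally show ?thesis
    by (simp add: bitableau_def power_add prod.lessThan_Suc_shift mult_ac del: prod.lessThan_Suc)
qed

lemma symb_rows_symbol:
  assumes "\<And>r. r \<in> set rs \<Longrightarrow> row_ok m0 n r"
  shows "symb (rows_symbol rs) = bitableau (map fst rs) (map (snd \<circ> snd) rs)"
  using assms
proof (induction rs)
  case Nil
  show ?case by (simp add: bitableau_def)
next
  case (Cons r rs)
  have "row_ok m0 n r" using Cons.prems by simp
  then have "symb (row_symbol (rev (fst r)) (snd (snd r))) = biword (fst r) (snd (snd r))"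
    by (subst symb_row_symbol) (simp_all add: row_ok_def)
  then show ?case
    using Cons by (simp add: bitableau_Cons symb_minus_one_power symb_mult o_def)
qed

text \<open>No factor can be contracted with another, so all correction terms of the normal ordering
  vanish. This applies to the monomials with virtual row letters and proper column letters.\<close>

lemma nord_gens_virtual:
  "(\<And>x y. x \<in> set w \<Longrightarrow> y \<in> set w \<Longrightarrow> snd x \<noteq> fst y) \<Longrightarrow> nord (gens w) = gens w"
proof (induction w)
  case (Cons x w)
  have "polar_word x v = 0" if "set v \<subseteq> set w" for v
    using that by (induction v) (use Cons.prems in \<open>auto simp: act_def\<close>)
  then show ?case
    using Cons by (simp add: gens_Cons nord_gen polar_gens)
qed (simp add: gens_Nil)

lemma polar_mem: "x \<in> gl_basis m0 m1 n \<Longrightarrow> f \<in> carrier (free_alg (proper_basis m0 m1 n)) \<Longrightarrow>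
    polar x f \<in> carrier (free_alg (proper_basis m0 m1 n))"
  using deg_le_polar stable_proper_basis unfolding carrier_free_alg_iff by blast

lemma foldr_polar_mem: "set xs \<subseteq> gl_basis m0 m1 n \<Longrightarrow> f \<in> carrier (free_alg (proper_basis m0 m1 n)) \<Longrightarrow>
    foldr polar xs f \<in> carrier (free_alg (proper_basis m0 m1 n))"
  by (induction xs) (auto intro: polar_mem)

lemma gens_nord_Irr_pre:
  assumes "f \<in> carrier (free_alg (proper_basis m0 m1 n))" "set xs \<subseteq> gl_basis m0 m1 n"
    "\<And>x. x \<in> set xs \<Longrightarrow> snd x \<notin> range Proper"
  shows "gens xs * nord f - nord (foldr polar xs f) \<in> Irr_pre m0 m1 n"
  using assms(2,3)
proof (induction xs)
  case Nil
  show ?case by (simp add: gens_Nil left_submodule.zero[OF left_submodule_Irr_pre])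
next
  case (Cons x xs)
  let ?g = "foldr polar xs f"
  have "free_gen x * (gens xs * nord f - nord ?g) \<in> Irr_pre m0 m1 n"
    using Cons by (intro left_submodule.gen[OF left_submodule_Irr_pre]) auto
  moreover have "free_gen x * nord ?g - nord (polar x ?g) \<in> Irr_pre m0 m1 n"
    using Cons assms(1) by (intro nord_virtual_Irr_pre foldr_polar_mem) auto
  ultimately have "free_gen x * (gens xs * nord f - nord ?g) + (free_gen x * nord ?g - nord (polar x ?g)) \<in> Irr_pre m0 m1 n"
    by (rule left_submodule.add[OF left_submodule_Irr_pre])
  then show ?case by (simp add: gens_Cons algebra_simps)
qed

lemma scong_nord_Irr_pre: "scong m0 m1 n f g \<Longrightarrow> nord f - nord g \<in> Irr_pre m0 m1 n"
  unfolding scong_def nord_linear(2)[symmetric] using nord_scomm_ideal U_ideal_subset_Irr_pre by blast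

text \<open>Modulo \<open>Irr\<close> the product is the normal ordering of the polarized monomial,
  and modulo supercommutators that monomial is \<open>rows_symbol rs\<close>, whose symbol is the
  bitableau.\<close>

lemma virtual_symbol_rows:
  assumes "\<And>r. r \<in> set rs \<Longrightarrow> row_ok m0 n r" "distinct (map (fst \<circ> snd) rs)"
  shows "virtual_symbol m0 m1 n (gens (concat (map row_ops rs)) * gens (concat (map row_vars rs)))
    (bitableau (map fst rs) (map (snd \<circ> snd) rs))"
proof -
  let ?d = "concat (map row_ops rs)" and ?w = "concat (map row_vars rs)"
  have d: "set ?d \<subseteq> gl_basis m0 m1 n" and w: "set ?w \<subseteq> proper_basis m0 m1 n"
  proof -
    have "set (row_ops r) \<subseteq> gl_basis m0 m1 n \<and> set (row_vars r) \<subseteq> proper_basis m0 m1 n"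
      if "r \<in> set rs" for r
      using assms(1)[OF that]
      by (cases r) (auto simp: row_ok_def row_ops_def row_vars_def gl_basis_def
          proper_basis_def all_letters_def virtual_letters_def)
    then show "set ?d \<subseteq> gl_basis m0 m1 n" "set ?w \<subseteq> proper_basis m0 m1 n"
      by (simp_all add: UN_subset_iff)
  qed
  have nord: "nord (gens ?w) = gens ?w"
    by (rule nord_gens_virtual) (auto simp: row_vars_def)
  have "gens ?d * nord (gens ?w) - nord (foldr polar ?d (gens ?w)) \<in> Irr_pre m0 m1 n"
    using d w by (intro gens_nord_Irr_pre free_alg_closed) (auto simp: row_ops_def)
  moreover have "nord (foldr polar ?d (gens ?w)) - nord (rows_symbol rs) \<in> Irr_pre m0 m1 n"
    by (intro scong_nord_Irr_pre foldr_polar_rows assms)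
  ultimately have "(gens ?d * nord (gens ?w) - nord (foldr polar ?d (gens ?w)))
      + (nord (foldr polar ?d (gens ?w)) - nord (rows_symbol rs)) \<in> Irr_pre m0 m1 n"
    by (rule left_submodule.add[OF left_submodule_Irr_pre])
  moreover have "gens ?d * gens ?w \<in> carrier (free_alg (gl_basis m0 m1 n))"
    using d w proper_basis_subset by (intro free_alg_closed) blast+
  ultimately show ?thesis
    unfolding virtual_symbol_def
    using rows_symbol_mem[OF assms(1)] symb_rows_symbol[OF assms(1)]
    by (auto simp: nord)
qed

section \<open>Young-Capelli bitableaux\<close>

text \<open>With column indices as labels, a matching records from which cell each operator of
  \<open>C\<close> over \<open>D\<close> takes its letter. Functions are extensional, so each
  matching is counted once.\<close>

definition matchings :: "('i \<Rightarrow> 'c) \<Rightarrow> ('k \<Rightarrow> 'c) \<Rightarrow> 'i set \<Rightarrow> 'k set \<Rightarrow> ('i \<Rightarrow> 'k) set" where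
  "matchings b c X K = {f \<in> X \<rightarrow>\<^sub>E K. inj_on f X \<and> (\<forall>i \<in> X. c (f i) = b i)}"

lemma finite_matchings: "finite X \<Longrightarrow> finite K \<Longrightarrow> finite (matchings b c X K)"
  by (rule finite_subset[of _ "X \<rightarrow>\<^sub>E K"]) (auto simp: matchings_def intro: finite_PiE)

text \<open>The image \<open>k\<close> of \<open>i\<close> is chosen first and the rest is matched
  into what remains; resetting \<open>i\<close> to \<open>undefined\<close> makes the restriction
  extensional again.\<close>

lemma sum_matchings_insert:
  assumes "finite X" "finite K" "i \<notin> X"
  shows "(\<Sum>f \<in> matchings b c (insert i X) K. g f) =
    (\<Sum>k \<in> {k \<in> K. c k = b i}. \<Sum>f \<in> matchings b c X (K - {k}). g (f(i := k)))"
proof -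
  have "(\<Sum>k \<in> {k \<in> K. c k = b i}. \<Sum>f \<in> matchings b c X (K - {k}). g (f(i := k))) =
    (\<Sum>(k, f) \<in> Sigma {k \<in> K. c k = b i} (\<lambda>k. matchings b c X (K - {k})). g (f(i := k)))"
    using assms by (intro sum.Sigma) (auto intro: finite_matchings)
  also have "\<dots> = (\<Sum>f \<in> matchings b c (insert i X) K. g f)"
  proof (rule sum.reindex_bij_witness[where i = "\<lambda>f. (f i, f(i := undefined))" and j = "\<lambda>(k, f). f(i := k)"])
    fix f assume f: "f \<in> matchings b c (insert i X) K"
    have "f(i := undefined) \<in> matchings b c X (K - {f i})"
      using f assms(3) by (auto simp: matchings_def PiE_iff extensional_def inj_on_def)
    then show "(f i, f(i := undefined)) \<in> (SIGMA k:{k \<in> K. c k = b i}. matchings b c X (K - {k}))"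
      using f by (auto simp: matchings_def PiE_iff)
  next
    fix p assume "p \<in> (SIGMA k:{k \<in> K. c k = b i}. matchings b c X (K - {k}))"
    then obtain k f where p: "p = (k, f)" "k \<in> K" "c k = b i" "f \<in> matchings b c X (K - {k})"
      by auto
    then have "f i = undefined"
      using assms(3) by (auto simp: matchings_def PiE_iff extensional_def)
    then show "((case p of (k, f) \<Rightarrow> f(i := k)) i, (case p of (k, f) \<Rightarrow> f(i := k))(i := undefined)) = p"
      by (auto simp: p(1))
    show "(case p of (k, f) \<Rightarrow> f(i := k)) \<in> matchings b c (insert i X) K"
      using p assms(3) by (force simp: matchings_def PiE_iff extensional_def inj_on_def)
  qed auto
  finally show ?thesis ..
qed

text \<open>The variables \<open>(Beta, Proper)\<close> are even, so the odd operator reaches each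
  of them without a sign, and the new odd variable moves to the front past even ones only.\<close>

lemma polar_columns:
  assumes "a \<in> {1..m0}" "distinct ks" "\<And>k. k \<in> set ks \<Longrightarrow> c k \<in> {1..m1} \<and> t k \<in> {1..n}"
  shows "scong m0 m1 n (polar (Alpha a, Beta b) (gens (map (\<lambda>k. (Beta (c k), Proper (t k))) ks)))
    (\<Sum>k \<in> {k \<in> set ks. c k = b}. free_gen (Alpha a, Proper (t k)) *
        gens (map (\<lambda>k. (Beta (c k), Proper (t k))) (remove1 k ks)))"
  using assms(2,3)
proof (induction ks)
  case Nil
  then show ?case by (simp add: gens_Nil)
next
  case (Cons k ks)
  let ?y = "\<lambda>k. (Beta (c k), Proper (t k))" and ?z = "\<lambda>k. free_gen (Alpha a, Proper (t k))"
  let ?K = "{k' \<in> set ks. c k' = b}"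
  let ?e = "if c k = b then ?z k * gens (map ?y ks) else 0"
  have mem: "?y k' \<in> proper_basis m0 m1 n" "(Alpha a, Proper (t k')) \<in> proper_basis m0 m1 n"
    if "k' \<in> set (k # ks)" for k'
    using Cons.prems(2)[OF that] assms(1)
    by (auto simp: proper_basis_def all_letters_def virtual_letters_def)
  have "polar (Alpha a, Beta b) (gens (map ?y (k # ks))) =
      ?e + free_gen (?y k) * polar (Alpha a, Beta b) (gens (map ?y ks))"
    by (simp add: gens_Cons polar_gen act_def)
  also have "scong m0 m1 n \<dots>
      (?e + free_gen (?y k) * (\<Sum>k' \<in> ?K. ?z k' * gens (map ?y (remove1 k' ks))))"
    using Cons mem by (intro scong_add scong_gen scong_refl) auto
  also have "\<dots> = ?e + (\<Sum>k' \<in> ?K. free_gen (?y k) * (?z k' * gens (map ?y (remove1 k' ks))))"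
    by (simp add: sum_distrib_left)
  also have "scong m0 m1 n \<dots> (?e + (\<Sum>k' \<in> ?K. ?z k' * (free_gen (?y k) * gens (map ?y (remove1 k' ks)))))"
  proof (intro scong_add scong_sum scong_refl)
    fix k' assume k': "k' \<in> ?K"
    have "set (map ?y (remove1 k' ks)) \<subseteq> proper_basis m0 m1 n"
      using mem(1) by (auto dest: notin_set_remove1)
    then show "scong m0 m1 n (free_gen (?y k) * (?z k' * gens (map ?y (remove1 k' ks))))
        (?z k' * (free_gen (?y k) * gens (map ?y (remove1 k' ks))))"
      using scong_swap[OF mem(1)[of k] mem(2)[of k'] free_alg_closed(9)] k' by simp
  qed
  also have "\<dots> = ?e + (\<Sum>k' \<in> ?K. ?z k' * gens (map ?y (remove1 k' (k # ks))))"
    using Cons.prems(1) by (intro arg_cong[of _ _ "(+) ?e"] sum.cong) (auto simp: gens_Cons)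
  also have "\<dots> = (\<Sum>k' \<in> {k' \<in> set (k # ks). c k' = b}. ?z k' * gens (map ?y (remove1 k' (k # ks))))"
  proof -
    have "{k' \<in> set (k # ks). c k' = b} = (if c k = b then insert k ?K else ?K)"
      by auto
    then show ?thesis using Cons.prems(1) by simp
  qed
  finally show ?case .
qed

lemma foldr_polar_Alpha:
  "foldr polar (map (\<lambda>i. (Alpha (a i), Beta (b i))) is) (free_gen (Alpha a', Proper j) * f) =
   (-1) ^ length is * (free_gen (Alpha a', Proper j) * foldr polar (map (\<lambda>i. (Alpha (a i), Beta (b i))) is) f)"
  by (induction "is") (simp_all add: polar_minus_one_power polar_gen act_def)

text \<open>Moving an odd variable from the front to the end of a product of odd variables costs the
  same sign as \<open>foldr_polar_Alpha\<close>, where the remaining operators pass that variable.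
  The two signs cancel.\<close>

lemma scong_gens_snoc:
  assumes "\<And>i. i \<in> set is \<Longrightarrow> (Alpha (a i), Proper (t i)) \<in> proper_basis m0 m1 n"
    "(Alpha a', Proper t') \<in> proper_basis m0 m1 n"
  shows "scong m0 m1 n ((-1) ^ length is * (free_gen (Alpha a', Proper t') * gens (map (\<lambda>i. (Alpha (a i), Proper (t i))) is)))
    (gens (map (\<lambda>i. (Alpha (a i), Proper (t i))) is @ [(Alpha a', Proper t')]))"
  using assms(1)
proof (induction "is")
  case Nil
  show ?case by (simp add: gens_Cons gens_Nil)
next
  case (Cons i "is")
  let ?z = "(Alpha a', Proper t')" and ?y = "\<lambda>i. (Alpha (a i), Proper (t i))"
  have "set (map ?y is) \<subseteq> proper_basis m0 m1 n" "?y i \<in> proper_basis m0 m1 n"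
    using Cons.prems by auto
  then have "scong m0 m1 n ((-1) ^ Suc (length is) * (free_gen ?z * (free_gen (?y i) * gens (map ?y is))))
     ((-1) ^ Suc (length is) * (ksign ?z (?y i) * (free_gen (?y i) * (free_gen ?z * gens (map ?y is)))))"
    using assms(2) by (intro scong_sign scong_swap free_alg_closed)
  also have "\<dots> = free_gen (?y i) * ((-1) ^ length is * (free_gen ?z * gens (map ?y is)))"
    by (cases "even (length is)") simp_all
  also have "scong m0 m1 n \<dots> (free_gen (?y i) * gens (map ?y is @ [?z]))"
    using Cons by (intro scong_gen Cons.IH) auto
  finally show ?case by (simp add: gens_Cons)
qed

text \<open>Reverse induction, since the last operator acts first. The variable it creates appears
  in front while its operator stands last in the list, so it is moved to the end.\<close>

lemma foldr_polar_columns: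
  assumes "distinct is" "distinct ks" "length is = length ks"
    "\<And>i. i \<in> set is \<Longrightarrow> a i \<in> {1..m0} \<and> b i \<in> {1..m1}"
    "\<And>k. k \<in> set ks \<Longrightarrow> c k \<in> {1..m1} \<and> t k \<in> {1..n}"
  shows "scong m0 m1 n (foldr polar (map (\<lambda>i. (Alpha (a i), Beta (b i))) is)
      (gens (map (\<lambda>k. (Beta (c k), Proper (t k))) ks)))
    (\<Sum>f \<in> matchings b c (set is) (set ks). gens (map (\<lambda>i. (Alpha (a i), Proper (t (f i)))) is))"
  using assms
proof (induction "is" arbitrary: ks rule: rev_induct)
  case Nil
  have "matchings b c {} {} = {\<lambda>_. undefined}" by (auto simp: matchings_def)
  then show ?case using Nil by (simp add: gens_Nil)
next
  case (snoc i "is")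
  let ?x = "\<lambda>i. (Alpha (a i), Beta (b i))" and ?y = "\<lambda>k. (Beta (c k), Proper (t k))"
  let ?w = "\<lambda>f. gens (map (\<lambda>i. (Alpha (a i), Proper (t (f i)))) is)"
  let ?z = "\<lambda>k. (Alpha (a i), Proper (t k))"
  let ?K = "{k \<in> set ks. c k = b i}"
  have z: "(Alpha (a i'), Proper (t k)) \<in> proper_basis m0 m1 n"
    if "i' \<in> set (is @ [i])" "k \<in> set ks" for i' k
    using snoc.prems(4)[OF that(1)] snoc.prems(5)[OF that(2)]
    by (auto simp: proper_basis_def all_letters_def virtual_letters_def)
  have B: "set (map ?x is) \<subseteq> gl_basis m0 m1 n"
    using snoc.prems(4) by (auto simp: gl_basis_def all_letters_def virtual_letters_def)
  have "foldr polar (map ?x (is @ [i])) (gens (map ?y ks)) = foldr polar (map ?x is) (polar (?x i) (gens (map ?y ks)))"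
    by simp
  also have "scong m0 m1 n \<dots> (foldr polar (map ?x is)
      (\<Sum>k\<in>?K. free_gen (?z k) * gens (map ?y (remove1 k ks))))"
    using snoc.prems B by (intro scong_foldr_polar polar_columns) auto
  also have "\<dots> = (\<Sum>k\<in>?K. (-1) ^ length is *
      (free_gen (?z k) * foldr polar (map ?x is) (gens (map ?y (remove1 k ks)))))"
    by (simp add: foldr_polar_linear foldr_polar_Alpha)
  also have "scong m0 m1 n \<dots> (\<Sum>k\<in>?K. (-1) ^ length is *
      (free_gen (?z k) * (\<Sum>f \<in> matchings b c (set is) (set ks - {k}). ?w f)))"
  proof (intro scong_sum scong_sign scong_gen)
    fix k assume k: "k \<in> ?K"
    then show "?z k \<in> proper_basis m0 m1 n" using z by auto
    have "set (remove1 k ks) = set ks - {k}" "length is = length (remove1 k ks)"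
      using snoc.prems k by (auto simp: length_remove1)
    then show "scong m0 m1 n (foldr polar (map ?x is) (gens (map ?y (remove1 k ks))))
        (\<Sum>f \<in> matchings b c (set is) (set ks - {k}). ?w f)"
      using snoc.IH[of "remove1 k ks"] snoc.prems by (simp add: distinct_remove1)
  qed
  also have "\<dots> = (\<Sum>k\<in>?K. \<Sum>f \<in> matchings b c (set is) (set ks - {k}).
      (-1) ^ length is * (free_gen (?z k) * ?w f))"
    by (simp add: sum_distrib_left)
  also have "scong m0 m1 n \<dots> (\<Sum>k\<in>?K. \<Sum>f \<in> matchings b c (set is) (set ks - {k}).
      gens (map (\<lambda>i. (Alpha (a i), Proper (t (f i)))) is @ [?z k]))"
    by (intro scong_sum scong_gens_snoc z) (auto simp: matchings_def PiE_iff)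
  also have "\<dots> = (\<Sum>k\<in>?K. \<Sum>f \<in> matchings b c (set is) (set ks - {k}).
      gens (map (\<lambda>j. (Alpha (a j), Proper (t ((f(i := k)) j)))) (is @ [i])))"
    using snoc.prems(1) by (intro sum.cong refl arg_cong[of _ _ gens]) auto
  also have "\<dots> = (\<Sum>f \<in> matchings b c (set (is @ [i])) (set ks).
      gens (map (\<lambda>j. (Alpha (a j), Proper (t (f j)))) (is @ [i])))"
    using snoc.prems(1) sum_matchings_insert[of "set is" "set ks" i
        "\<lambda>f. gens (map (\<lambda>j. (Alpha (a j), Proper (t (f j)))) (is @ [i]))" b c] by simp
  finally show ?case .
qed

section \<open>Cells of a diagram and column permutations\<close>

definition cells :: "nat list \<Rightarrow> (nat \<times> nat) list" where
  "cells l = concat (map (\<lambda>r. map (Pair r) [0..<l ! r]) [0..<length l])"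

lemma set_cells: "set (cells l) = {(r, c). r < length l \<and> c < l ! r}"
  by (auto simp: cells_def)

lemma distinct_cells: "distinct (cells l)"
proof -
  have "distinct (concat (map (\<lambda>r. map (Pair r) [0..<l ! r]) [0..<m]))" for m
    by (induction m) (auto simp: distinct_map inj_on_def)
  then show ?thesis by (simp add: cells_def)
qed

lemma is_shape_nth_mono: "is_shape l \<Longrightarrow> r' \<le> r \<Longrightarrow> r < length l \<Longrightarrow> l ! r \<le> l ! r'"
  using sorted_wrt_nth_less[of "(\<ge>)" l r' r] by (cases "r' = r") (auto simp: is_shape_def)

text \<open>Row lengths decrease, so the rows meeting a column form an initial segment and are
  determined by their number.\<close>

lemma less_col_height_iff:
  assumes "is_shape l"
  shows "r < col_height l c \<longleftrightarrow> r < length l \<and> c < l ! r"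
proof -
  let ?S = "{r. r < nrows l \<and> c < l ! r}"
  have fin: "finite ?S" by simp
  have down: "r' \<in> ?S" if "r \<in> ?S" "r' \<le> r" for r r'
    using that is_shape_nth_mono[OF assms that(2)] by (auto simp: nrows_def)
  have "?S = {..<card ?S}"
  proof (cases "?S = {}")
    case True
    show ?thesis unfolding True by simp
  next
    case False
    have "?S = {..Max ?S}"
      using Max_in[OF fin False] Max_ge[OF fin] down by blast
    then show ?thesis by (metis card_atMost lessThan_Suc_atMost)
  qed
  then show ?thesis
    unfolding col_height_def nrows_def by blast
qed

lemma less_ncols: "is_shape l \<Longrightarrow> r < length l \<Longrightarrow> c < l ! r \<Longrightarrow> c < ncols l"
  using is_shape_nth_mono[of l 0 r] by (cases l) (auto simp: ncols_def)

lemma sum_matchings_cells: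
  assumes l: "is_shape l"
  shows "(\<Sum>f \<in> matchings snd snd (set (cells l)) (set (cells l)). g f) =
    (\<Sum>\<sigma> \<in> col_perms l. g (restrict (\<lambda>(r, c). (\<sigma> c r, c)) (set (cells l))))"
proof (rule sum.reindex_bij_witness[symmetric,
    where i = "\<lambda>f. \<lambda>c\<in>{..<ncols l}. \<lambda>r. if r < col_height l c then fst (f (r, c)) else r"
      and j = "\<lambda>\<sigma>. restrict (\<lambda>(r, c). (\<sigma> c r, c)) (set (cells l))"])
  let ?X = "set (cells l)"
  let ?j = "\<lambda>\<sigma>. restrict (\<lambda>(r, c). (\<sigma> c r, c)) ?X"
  \<comment> \<open>Default values: row indices beyond the column are fixed, as
    \<open>permutes\<close> demands, and columns beyond \<open>ncols l\<close> are undefined, as the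
    extensional product in \<open>col_perms\<close> demands.\<close>
  let ?i = "\<lambda>f. \<lambda>c\<in>{..<ncols l}. \<lambda>r. if r < col_height l c then fst (f (r, c)) else r"
  have X: "(r, c) \<in> ?X \<longleftrightarrow> r < col_height l c" for r c
    by (simp add: set_cells less_col_height_iff[OF l])
  have col: "r < col_height l c \<Longrightarrow> c < ncols l" for r c
    using less_ncols[OF l] by (auto simp: less_col_height_iff[OF l])
  {
    fix \<sigma> assume \<sigma>: "\<sigma> \<in> col_perms l"
    then have perm: "\<sigma> c permutes {..<col_height l c}" if "c < ncols l" for c
      using that by (auto simp: col_perms_def PiE_iff)
    have lt: "\<sigma> c r < col_height l c" if "r < col_height l c" for r c
      using permutes_in_image[OF perm[OF col[OF that]]] that by auto
    show "?j \<sigma> \<in> matchings snd snd ?X ?X"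
      unfolding matchings_def
    proof (intro CollectI conjI ballI)
      show "?j \<sigma> \<in> ?X \<rightarrow>\<^sub>E ?X" using lt by (auto simp: PiE_iff X)
      show "inj_on (?j \<sigma>) ?X"
      proof (rule inj_onI)
        fix p q assume pq: "p \<in> ?X" "q \<in> ?X" "?j \<sigma> p = ?j \<sigma> q"
        obtain r c s d where rc: "p = (r, c)" "q = (s, d)" by (cases p, cases q)
        then have "\<sigma> c r = \<sigma> c s" "c = d" using pq by auto
        moreover have "inj (\<sigma> c)"
          using pq(1) by (intro permutes_inj[OF perm[OF col]]) (simp add: rc X)
        ultimately show "p = q" by (simp add: rc inj_eq)
      qed
    qed auto
    show "?i (?j \<sigma>) = \<sigma>"
    proof (rule ext)
      fix c show "?i (?j \<sigma>) c = \<sigma> c"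
      proof (cases "c < ncols l")
        case True
        then show ?thesis
          using permutes_not_in[OF perm[OF True]] by (auto simp: fun_eq_iff X)
      next
        case False
        then show ?thesis using \<sigma> by (auto simp: col_perms_def PiE_iff extensional_def)
      qed
    qed
  }
  {
    fix f assume f: "f \<in> matchings snd snd ?X ?X"
    then have fX: "f (r, c) = (fst (f (r, c)), c)" "fst (f (r, c)) < col_height l c"
      if "r < col_height l c" for r c
    proof -
      have "f (r, c) \<in> ?X" "snd (f (r, c)) = c"
        using f that X[of r c] by (auto simp: matchings_def PiE_iff)
      then show "f (r, c) = (fst (f (r, c)), c)" "fst (f (r, c)) < col_height l c"
        using X[of "fst (f (r, c))" c] prod.collapse[of "f (r, c)"] by simp_all
    qed
    have inj: "inj_on f ?X" using f by (auto simp: matchings_def)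
    show "?i f \<in> col_perms l"
      unfolding col_perms_def
    proof (intro PiE_I CollectI)
      fix c assume c: "c \<in> {..<ncols l}"
      let ?p = "\<lambda>r. if r < col_height l c then fst (f (r, c)) else r"
      have "inj_on ?p {..<col_height l c}"
      proof (rule inj_onI)
        fix r s assume rs: "r \<in> {..<col_height l c}" "s \<in> {..<col_height l c}" "?p r = ?p s"
        then have "f (r, c) = f (s, c)" using fX(1)[of r c] fX(1)[of s c] by auto
        then show "r = s" using inj_onD[OF inj, of "(r, c)" "(s, c)"] rs X by auto
      qed
      moreover have "?p ` {..<col_height l c} \<subseteq> {..<col_height l c}"
        using fX(2) by auto
      ultimately have "bij_betw ?p {..<col_height l c} {..<col_height l c}"
        unfolding bij_betw_def by (intro conjI endo_inj_surj finite_lessThan)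
      then have "?p permutes {..<col_height l c}"
        by (rule bij_imp_permutes) auto
      then show "?i f c permutes {..<col_height l c}" using c by simp
    qed simp
    show "?j (?i f) = f"
    proof (rule ext)
      fix p show "?j (?i f) p = f p"
      proof (cases "p \<in> ?X")
        case True
        obtain r c where p: "p = (r, c)" by (cases p)
        then have "r < col_height l c" using True X by simp
        then show ?thesis using True col[of r c] fX(1)[of r c] by (simp add: p)
      next
        case False
        moreover from f have "f \<in> ?X \<rightarrow>\<^sub>E ?X" by (simp add: matchings_def)
        ultimately show ?thesis using PiE_arb[of f ?X "\<lambda>_. ?X" p] by simp
      qed
    qed
  }
qed simp

section \<open>Reading words of the tableaux\<close>

lemma zip_concat_map:
  "(\<And>r. r \<in> set rs \<Longrightarrow> length (f r) = length (g r)) \<Longrightarrow>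
   zip (concat (map f rs)) (concat (map g rs)) = concat (map (\<lambda>r. zip (f r) (g r)) rs)"
  by (induction rs) simp_all

lemma proper_tab_eq: "proper_tab T = map (\<lambda>r. map Proper (T ! r)) [0..<length T]"
  by (rule nth_equalityI) (simp_all add: proper_tab_def)

lemma D_tab_eq: "D_tab l = map (\<lambda>r. map (\<lambda>c. Beta (Suc c)) [0..<l ! r]) [0..<length l]"
  by (rule nth_equalityI) (simp_all add: D_tab_def)

definition tab_rows :: "nat list list \<Rightarrow> nat list list \<Rightarrow> row list" where
  "tab_rows S T = map (\<lambda>r. (S ! r, Suc r, T ! r)) [0..<length S]"

lemma shape_eqD:
  assumes "shape S = shape T"
  shows "length S = length T" "r < length S \<Longrightarrow> length (S ! r) = length (T ! r)"
  using assms unfolding shape_def by (metis length_map, metis length_map nth_map)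

lemma zip_proper_C:
  "zip (concat (proper_tab S)) (concat (C_tab (shape S))) = concat (map row_ops (tab_rows S T))"
proof -
  have "zip (map Proper w) (replicate (length w) x) = map (\<lambda>i. (Proper i, x)) w" for w and x :: letter
    by (induction w) simp_all
  then show ?thesis
    unfolding proper_tab_eq C_tab_def nrows_def
    by (simp add: shape_def tab_rows_def row_ops_def o_def, subst zip_concat_map, simp,
        intro arg_cong[of _ _ concat] map_cong, auto)
qed

lemma zip_C_proper:
  assumes "shape S = shape T"
  shows "zip (concat (C_tab (shape S))) (concat (proper_tab T)) = concat (map row_vars (tab_rows S T))"
proof -
  have "zip (replicate (length w) x) (map Proper w) = map (\<lambda>i. (x, Proper i)) w" for w and x :: letter
    by (induction w) simp_all
  then show ?thesis
    unfolding assms proper_tab_eq C_tab_def nrows_def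
    using shape_eqD[OF assms]
    by (simp add: shape_def tab_rows_def row_vars_def o_def, subst zip_concat_map, simp,
        intro arg_cong[of _ _ concat] map_cong, auto)
qed

lemma zip_C_D:
  "zip (concat (C_tab l)) (concat (D_tab l)) =
   map (\<lambda>i. (Alpha (Suc (fst i)), Beta (Suc (snd i)))) (cells l)"
proof -
  have "zip (replicate k x) (map g [0..<k]) = map (\<lambda>c. (x, g c)) [0..<k]" for k and x :: letter and g :: "nat \<Rightarrow> letter"
    by (rule nth_equalityI) simp_all
  then show ?thesis
    unfolding D_tab_eq C_tab_def nrows_def
    by (simp add: zip_concat_map cells_def map_concat o_def)
qed

lemma zip_D_proper:
  "zip (concat (D_tab (shape T))) (concat (proper_tab T)) =
   map (\<lambda>i. (Beta (Suc (snd i)), Proper (T ! fst i ! snd i))) (cells (shape T))"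
proof -
  have "zip (map g [0..<length w]) (map Proper w) = map (\<lambda>c. (g c, Proper (w ! c))) [0..<length w]"
    for w and g :: "nat \<Rightarrow> letter"
    by (rule nth_equalityI) simp_all
  then show ?thesis
    unfolding D_tab_eq proper_tab_eq
    by (simp add: cells_def map_concat o_def shape_def, subst zip_concat_map, simp,
        intro arg_cong[of _ _ concat] map_cong, auto)
qed

text \<open>The permuted tableau has the rows lengths of \<open>T\<close>, so it is read along the
  same cells; the entries are then those picked up by the matchings in
  \<open>sum_matchings_cells\<close>.\<close>

lemma zip_C_permute_cols:
  "zip (concat (C_tab (shape T))) (concat (proper_tab (permute_cols \<sigma> T))) =
   map (\<lambda>i. (Alpha (Suc (fst i)), Proper (T ! \<sigma> (snd i) (fst i) ! snd i))) (cells (shape T))"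
proof -
  have "zip (replicate k x) (map g [0..<k]) = map (\<lambda>c. (x, g c)) [0..<k]" for k and x :: letter and g :: "nat \<Rightarrow> letter"
    by (rule nth_equalityI) simp_all
  then show ?thesis
    unfolding proper_tab_def permute_cols_def C_tab_def nrows_def
    by (simp add: cells_def map_concat o_def shape_def, subst zip_concat_map, simp,
        intro arg_cong[of _ _ concat] map_cong, auto)
qed

lemma shape_permute_cols [simp]: "shape (permute_cols \<sigma> T) = shape T"
  by (rule nth_equalityI) (simp_all add: shape_def permute_cols_def)

lemma tableaux_nth:
  "T \<in> tableaux A \<Longrightarrow> r < length T \<Longrightarrow> c < length (T ! r) \<Longrightarrow> T ! r ! c \<in> A"
  unfolding tableaux_def by (auto dest!: bspec[OF _ nth_mem] simp: subset_iff)

text \<open>A permuted row index stays below the height of its column, hence inside the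
  diagram.\<close>

lemma permute_cols_tableaux:
  assumes "T \<in> tableaux A" "\<sigma> \<in> col_perms (shape T)"
  shows "permute_cols \<sigma> T \<in> tableaux A"
proof -
  have l: "is_shape (shape T)" using assms(1) by (simp add: tableaux_def)
  have "T ! \<sigma> c r ! c \<in> A" if rc: "r < length T" "c < length (T ! r)" for r c
  proof -
    have h: "r < col_height (shape T) c" and c: "c < ncols (shape T)"
      using rc less_ncols[OF l, of r c] by (auto simp: less_col_height_iff[OF l]) (simp_all add: shape_def)
    have "\<sigma> c permutes {..<col_height (shape T) c}"
      using assms(2) c by (auto simp: col_perms_def PiE_iff)
    then have "\<sigma> c r < col_height (shape T) c"
      using h permutes_in_image by fastforce
    then show ?thesis
      using assms(1) unfolding less_col_height_iff[OF l]
      by (intro tableaux_nth) (auto simp: shape_def)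
  qed
  then show ?thesis
    using l unfolding tableaux_def mem_Collect_eq shape_permute_cols
    by (auto simp: permute_cols_def)
qed

lemma tab_rows_ok:
  assumes "S \<in> tableaux {1..n}" "T \<in> tableaux {1..n}" "shape S = shape T" "nrows (shape S) \<le> m0"
    "r \<in> set (tab_rows S T)"
  shows "row_ok m0 n r"
proof -
  obtain k where k: "k < length S" "r = (S ! k, Suc k, T ! k)"
    using assms(5) by (auto simp: tab_rows_def)
  moreover have "k < length T" "length (S ! k) = length (T ! k)"
    using k(1) shape_eqD[OF assms(3)] by auto
  moreover have "set (S ! k) \<subseteq> {1..n}" "set (T ! k) \<subseteq> {1..n}"
    using assms(1,2) k(1) \<open>k < length T\<close> nth_mem unfolding tableaux_def by blast+
  ultimately show ?thesis
    using assms(4) by (auto simp: row_ok_def nrows_def shape_def)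
qed

lemma tab_rows_proj:
  "map fst (tab_rows S T) = S" "length S = length T \<Longrightarrow> map (snd \<circ> snd) (tab_rows S T) = T"
  "distinct (map (fst \<circ> snd) (tab_rows S T))"
  by (auto simp: tab_rows_def o_def map_nth distinct_map inj_on_def intro: nth_equalityI)

lemma virtual_symbol_capelli:
  assumes "S \<in> tableaux {1..n}" "T \<in> tableaux {1..n}" "shape S = shape T" "nrows (shape S) \<le> m0"
  shows "virtual_symbol m0 m1 n
    (gens (zip (concat (proper_tab S)) (concat (C_tab (shape S)))) *
     gens (zip (concat (C_tab (shape S))) (concat (proper_tab T)))) (bitableau S T)"
  using virtual_symbol_rows[of "tab_rows S T" m0 n m1, OF tab_rows_ok[OF assms] tab_rows_proj(3)]
  unfolding tab_rows_proj(1) tab_rows_proj(2)[OF shape_eqD(1)[OF assms(3)]]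
    zip_proper_C[of S T] zip_C_proper[OF assms(3)] by simp

lemma set_concat_proper_tab: "T \<in> tableaux {1..n} \<Longrightarrow> set (concat (proper_tab T)) \<subseteq> all_letters m0 m1 n"
  by (fastforce simp: tableaux_def proper_tab_def all_letters_def)

lemma set_concat_C_tab: "nrows l \<le> m0 \<Longrightarrow> set (concat (C_tab l)) \<subseteq> all_letters m0 m1 n"
  by (auto simp: C_tab_def all_letters_def virtual_letters_def)

lemma set_concat_D_tab:
  assumes "is_shape l" "ncols l \<le> m1"
  shows "set (concat (D_tab l)) \<subseteq> all_letters m0 m1 n"
proof -
  have "Suc c \<le> m1" if "r < length l" "c < l ! r" for r c
    using less_ncols[OF assms(1) that] assms(2) by simp
  then show ?thesis
    by (auto simp: D_tab_eq all_letters_def virtual_letters_def)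
qed

lemma set_zip_subset: "set xs \<subseteq> L \<Longrightarrow> set ys \<subseteq> L' \<Longrightarrow> set (zip xs ys) \<subseteq> L \<times> L'"
  by (auto dest: set_zip_leftD set_zip_rightD)

text \<open>This evaluates the values prescribed for \<open>bitableaux_corr\<close>, uniformly in
  \<open>m0\<close> and \<open>m1\<close>: they depend on the polynomial
  \<open>bitableau S T\<close> alone.\<close>

lemma capelli_bitableau_eq_corr:
  assumes "S \<in> tableaux {1..n}" "T \<in> tableaux {1..n}" "shape S = shape T"
    and "enough_virtual m0 m1 (shape S)"
  shows "capelli_bitableau m0 m1 n S T = corr n (bitableau S T)" "bitableau S T \<in> carrier (poly_alg n)"
proof -
  have l: "nrows (shape S) \<le> m0" using assms(4) by (simp add: enough_virtual_def)
  let ?C = "concat (C_tab (shape S))"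
  have sub: "set (zip (concat (proper_tab S)) ?C) \<subseteq> gl_basis m0 m1 n"
    "set (zip ?C (concat (proper_tab T))) \<subseteq> gl_basis m0 m1 n"
    unfolding gl_basis_def
    by (intro set_zip_subset set_concat_proper_tab set_concat_C_tab assms l)+
  note sym = virtual_symbol_capelli[OF assms(1-3) l, of m1]
  show "bitableau S T \<in> carrier (poly_alg n)"
    by (rule virt_proj_virtual_symbol(2)[OF sym])
  show "capelli_bitableau m0 m1 n S T = corr n (bitableau S T)"
    using virt_proj_virtual_symbol(1)[OF sym] sub
    by (simp add: capelli_bitableau_def tab_prod_def U_prod_eq ucoset_mult free_alg_closed)
qed

text \<open>Applying the odd operators of \<open>C\<close> over \<open>D\<close> to the even monomial of \<open>D\<close> over \<open>T\<close> distributes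
  the letters of \<open>C\<close> over the cells of each column in all possible ways; no signs arise.\<close>

lemma gens_C_D_T_Irr_pre:
  assumes "T \<in> tableaux {1..n}" "enough_virtual m0 m1 (shape T)"
  shows "gens (zip (concat (C_tab (shape T))) (concat (D_tab (shape T)))) *
      gens (zip (concat (D_tab (shape T))) (concat (proper_tab T))) -
      (\<Sum>\<sigma> \<in> col_perms (shape T). gens (zip (concat (C_tab (shape T))) (concat (proper_tab (permute_cols \<sigma> T)))))
    \<in> Irr_pre m0 m1 n"
proof -
  let ?l = "shape T"
  let ?cs = "cells ?l"
  let ?t = "\<lambda>i. T ! fst i ! snd i"
  let ?d = "map (\<lambda>i. (Alpha (Suc (fst i)), Beta (Suc (snd i)))) ?cs"
  let ?w = "map (\<lambda>i. (Beta (Suc (snd i)), Proper (?t i))) ?cs"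
  let ?u = "\<lambda>\<sigma>. map (\<lambda>i. (Alpha (Suc (fst i)), Proper (T ! \<sigma> (snd i) (fst i) ! snd i))) ?cs"
  have l: "is_shape ?l" using assms(1) by (simp add: tableaux_def)
  have cell: "Suc (fst i) \<in> {1..m0} \<and> Suc (snd i) \<in> {1..m1} \<and> ?t i \<in> {1..n}" if i: "i \<in> set ?cs" for i
  proof -
    obtain r c where rc: "i = (r, c)" "r < length ?l" "c < ?l ! r"
      using i by (auto simp: set_cells)
    moreover have "c < ncols ?l" by (rule less_ncols[OF l rc(2,3)])
    moreover have "?t i \<in> {1..n}"
      using rc by (intro tableaux_nth[OF assms(1)]) (auto simp: shape_def)
    ultimately show ?thesis
      using assms(2) by (auto simp: enough_virtual_def nrows_def)
  qed
  have d: "set ?d \<subseteq> gl_basis m0 m1 n" and w: "set ?w \<subseteq> proper_basis m0 m1 n"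
    using cell by (force simp: gl_basis_def proper_basis_def all_letters_def virtual_letters_def)+
  have nord_w: "nord (gens ?w) = gens ?w" and nord_u: "nord (gens (?u \<sigma>)) = gens (?u \<sigma>)" for \<sigma>
    by (rule nord_gens_virtual, auto)+
  have "scong m0 m1 n (foldr polar ?d (gens ?w))
      (\<Sum>f \<in> matchings (\<lambda>i. Suc (snd i)) (\<lambda>i. Suc (snd i)) (set ?cs) (set ?cs).
        gens (map (\<lambda>i. (Alpha (Suc (fst i)), Proper (?t (f i)))) ?cs))"
    using cell by (intro foldr_polar_columns distinct_cells refl) auto
  also have "matchings (\<lambda>i. Suc (snd i)) (\<lambda>i. Suc (snd i)) (set ?cs) (set ?cs) =
      matchings snd snd (set ?cs) (set ?cs)"
    by (simp add: matchings_def)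
  also have "(\<Sum>f \<in> matchings snd snd (set ?cs) (set ?cs).
        gens (map (\<lambda>i. (Alpha (Suc (fst i)), Proper (?t (f i)))) ?cs)) = (\<Sum>\<sigma> \<in> col_perms ?l. gens (?u \<sigma>))"
    unfolding sum_matchings_cells[OF l]
    by (intro sum.cong refl arg_cong[of _ _ gens] map_cong) (auto split: prod.splits)
  finally have "nord (foldr polar ?d (gens ?w)) - nord (\<Sum>\<sigma> \<in> col_perms ?l. gens (?u \<sigma>)) \<in> Irr_pre m0 m1 n"
    by (rule scong_nord_Irr_pre)
  moreover have "gens ?d * nord (gens ?w) - nord (foldr polar ?d (gens ?w)) \<in> Irr_pre m0 m1 n"
    using d w by (intro gens_nord_Irr_pre free_alg_closed) auto
  ultimately have "(gens ?d * nord (gens ?w) - nord (foldr polar ?d (gens ?w)))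
      + (nord (foldr polar ?d (gens ?w)) - nord (\<Sum>\<sigma> \<in> col_perms ?l. gens (?u \<sigma>))) \<in> Irr_pre m0 m1 n"
    by (intro left_submodule.add[OF left_submodule_Irr_pre])
  then show ?thesis
    by (simp add: zip_C_D zip_D_proper zip_C_permute_cols nord_w nord_u nord_linear)
qed

lemma gens_left_Irr_pre:
  assumes "set xs \<subseteq> gl_basis m0 m1 n" "f \<in> Irr_pre m0 m1 n"
  shows "gens xs * f \<in> Irr_pre m0 m1 n"
  using assms
  by (induction xs) (auto simp: gens_Nil gens_Cons mult.assoc intro: left_submodule.gen[OF left_submodule_Irr_pre])

text \<open>The congruence that removes \<open>D\<close> is multiplied on the left by the word of
  \<open>S\<close> over \<open>C\<close>, which a left ideal permits. The result is a sum of Capelli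
  products of \<open>S\<close> with the column permutations of \<open>T\<close>, and their symbols
  add up to the symmetrized bitableau.\<close>

lemma young_capelli_bitableau_eq_corr:
  assumes "S \<in> tableaux {1..n}" "T \<in> tableaux {1..n}" "shape S = shape T"
    and "enough_virtual m0 m1 (shape S)"
  shows "young_capelli_bitableau m0 m1 n S T = corr n (right_sym_bitableau S T)"
    "right_sym_bitableau S T \<in> carrier (poly_alg n)"
proof -
  let ?l = "shape T"
  let ?SC = "zip (concat (proper_tab S)) (concat (C_tab ?l))"
  let ?CD = "zip (concat (C_tab ?l)) (concat (D_tab ?l))"
  let ?DT = "zip (concat (D_tab ?l)) (concat (proper_tab T))"
  let ?CT = "\<lambda>\<sigma>. zip (concat (C_tab ?l)) (concat (proper_tab (permute_cols \<sigma> T)))"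
  let ?f = "gens ?SC * (gens ?CD * gens ?DT)"
  have l: "is_shape ?l" "nrows ?l \<le> m0" "ncols ?l \<le> m1"
    using assms by (simp_all add: tableaux_def enough_virtual_def)
  have sub: "set ?SC \<subseteq> gl_basis m0 m1 n" "set ?CD \<subseteq> gl_basis m0 m1 n" "set ?DT \<subseteq> gl_basis m0 m1 n"
    unfolding gl_basis_def
    by (intro set_zip_subset set_concat_proper_tab set_concat_C_tab set_concat_D_tab assms l)+
  then have f: "?f \<in> carrier (free_alg (gl_basis m0 m1 n))"
    by (intro free_alg_closed)
  have "virtual_symbol m0 m1 n (gens ?SC * gens (?CT \<sigma>)) (bitableau S (permute_cols \<sigma> T))"
    if "\<sigma> \<in> col_perms ?l" for \<sigma>
    using virtual_symbol_capelli[OF assms(1) permute_cols_tableaux[OF assms(2) that], of m0 m1] assms(3) l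
    by simp
  then have "virtual_symbol m0 m1 n (\<Sum>\<sigma> \<in> col_perms ?l. gens ?SC * gens (?CT \<sigma>)) (right_sym_bitableau S T)"
    unfolding right_sym_bitableau_def by (rule virtual_symbol_sum)
  moreover have "gens ?SC * (gens ?CD * gens ?DT - (\<Sum>\<sigma> \<in> col_perms ?l. gens (?CT \<sigma>))) \<in> Irr_pre m0 m1 n"
    using sub(1) gens_C_D_T_Irr_pre[OF assms(2), of m0 m1] assms(3,4) by (intro gens_left_Irr_pre) auto
  then have "?f - (\<Sum>\<sigma> \<in> col_perms ?l. gens ?SC * gens (?CT \<sigma>)) \<in> Irr_pre m0 m1 n"
    by (simp add: right_diff_distrib sum_distrib_left)
  ultimately have sym: "virtual_symbol m0 m1 n ?f (right_sym_bitableau S T)"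
    using f by (rule virtual_symbol_cong)
  show "right_sym_bitableau S T \<in> carrier (poly_alg n)"
    by (rule virt_proj_virtual_symbol(2)[OF sym])
  show "young_capelli_bitableau m0 m1 n S T = corr n (right_sym_bitableau S T)"
    using virt_proj_virtual_symbol(1)[OF sym] sub assms(3)
    by (simp add: young_capelli_bitableau_def tab_prod_def U_prod_eq ucoset_mult free_alg_closed mult.assoc)
qed

section \<open>Bitableaux span the polynomial algebra\<close>

lemma bitableau_single_column:
  "\<exists>e. bitableau (map (\<lambda>x. [fst x]) w) (map (\<lambda>x. [snd x]) w) = (-1) ^ e * Poly_Mapping.single (mono_of w) 1"
proof (induction w)
  case Nil
  show ?case by (intro exI[of _ 0]) (simp add: bitableau_def mono_of_def)
next
  case (Cons x w)
  then obtain e where e: "bitableau (map (\<lambda>x. [fst x]) w) (map (\<lambda>x. [snd x]) w)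
      = (-1) ^ e * Poly_Mapping.single (mono_of w) 1" ..
  have "biword [fst x] [snd x] = matvar (fst x) (snd x)"
    using symb_row_symbol[of "[fst x]" "[snd x]"] symb_gen[of "(Proper (fst x), Proper (snd x))" 1] by simp
  then show ?case
    using e by (intro exI[of _ "length (map (\<lambda>x. [fst x]) w) + e"])
      (simp add: bitableau_Cons o_def sum_list_triv power_add matvar_def mono_of_def mult_single mult_ac)
qed

lemma single_column_tableaux:
  assumes "\<And>x. x \<in> set w \<Longrightarrow> g x \<in> A"
  shows "map (\<lambda>x. [g x]) w \<in> tableaux A"
proof -
  have s: "shape (map (\<lambda>x. [g x]) w) = replicate (length w) 1"
    by (simp add: shape_def o_def map_replicate_const)
  show "map (\<lambda>x. [g x]) w \<in> tableaux A"
    using assms by (auto simp: tableaux_def s is_shape_def sorted_wrt_iff_nth_less)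
qed

text \<open>In a one-column shape every row is a single variable, so the bitableaux of these shapes
  are monomials up to sign and every monomial arises. Hence values on bitableaux determine a linear
  map.\<close>

lemma linear_map_poly_alg_eqI:
  assumes \<Phi>: "linear_map class_ring (poly_alg n) (U_gl n) \<Phi>"
    and \<Psi>: "linear_map class_ring (poly_alg n) (U_gl n) \<Psi>"
    and eq: "\<And>S T. S \<in> tableaux {1..n} \<Longrightarrow> T \<in> tableaux {1..n} \<Longrightarrow> shape S = shape T \<Longrightarrow>
      \<Phi> (bitableau S T) = \<Psi> (bitableau S T)"
    and p: "p \<in> carrier (poly_alg n)"
  shows "\<Phi> p = \<Psi> p"
proof -
  interpret \<Phi>: linear_map class_ring "poly_alg n" "U_gl n" \<Phi> by (rule \<Phi>)
  interpret \<Psi>: linear_map class_ring "poly_alg n" "U_gl n" \<Psi> by (rule \<Psi>)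
  have smult: "c \<odot>\<^bsub>poly_alg n\<^esub> q = cst c * q" and add: "q \<oplus>\<^bsub>poly_alg n\<^esub> q' = q + q'" for c q q'
    by (simp_all add: poly_alg_def)
  have scal: "\<Phi> (cst c * q) = \<Psi> (cst c * q)" if "q \<in> carrier (poly_alg n)" "\<Phi> q = \<Psi> q" for c q
    using \<Phi>.f_smult[of c q] \<Psi>.f_smult[of c q] that by (simp add: smult)
  have mon: "Poly_Mapping.single m c \<in> carrier (poly_alg n) \<and>
      \<Phi> (Poly_Mapping.single m c) = \<Psi> (Poly_Mapping.single m c)"
    if m: "Poly_Mapping.keys m \<subseteq> {1..n} \<times> {1..n}" for m c
  proof -
    let ?w = "word_of m"
    let ?S = "map (\<lambda>x. [fst x]) ?w" and ?T = "map (\<lambda>x. [snd x]) ?w"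
    have w: "set ?w \<subseteq> {1..n} \<times> {1..n}"
      using m keys_mono_of[of ?w] by (simp add: mono_of_word_of)
    have S: "?S \<in> tableaux {1..n}" and T: "?T \<in> tableaux {1..n}"
      using w by (auto intro!: single_column_tableaux)
    have sh: "shape ?S = shape ?T"
      by (simp add: shape_def)
    obtain e where "bitableau ?S ?T = (-1) ^ e * Poly_Mapping.single m 1"
      using bitableau_single_column[of ?w] by (auto simp: mono_of_word_of)
    then have "Poly_Mapping.single m c = cst (c * (-1) ^ e) * bitableau ?S ?T"
      by (cases "even e") (simp_all add: mult_single single_uminus)
    moreover have "bitableau ?S ?T \<in> carrier (poly_alg n)"
      using S T sh by (rule capelli_bitableau_eq_corr(2)[of _ _ _ "nrows (shape ?S)" "ncols (shape ?S)"])
        (simp add: enough_virtual_def)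
    ultimately show ?thesis
      using scal[OF _ eq[OF S T sh]] by (simp add: poly_alg_closed)
  qed
  have "(\<Sum>m\<in>M. Poly_Mapping.single m (Poly_Mapping.lookup p m)) \<in> carrier (poly_alg n) \<and>
      \<Phi> (\<Sum>m\<in>M. Poly_Mapping.single m (Poly_Mapping.lookup p m)) =
      \<Psi> (\<Sum>m\<in>M. Poly_Mapping.single m (Poly_Mapping.lookup p m))"
    if "finite M" "M \<subseteq> Poly_Mapping.keys p" for M
    using that
  proof (induction M rule: finite_induct)
    case empty
    have "0 = cst 0 * (1 :: mpoly)" by simp
    then show ?case
      using mon[of 0 0] by simp
  next
    case (insert m M)
    let ?a = "Poly_Mapping.single m (Poly_Mapping.lookup p m)"
    let ?b = "\<Sum>m\<in>M. Poly_Mapping.single m (Poly_Mapping.lookup p m)"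
    have "Poly_Mapping.keys m \<subseteq> {1..n} \<times> {1..n}"
      using insert.prems p by (auto simp: poly_alg_def)
    note a = mon[OF this, of "Poly_Mapping.lookup p m"]
    have b: "?b \<in> carrier (poly_alg n)" "\<Phi> ?b = \<Psi> ?b" using insert by auto
    have "\<Phi> (?a + ?b) = \<Psi> (?a + ?b)"
      using \<Phi>.f_add[of ?a ?b] \<Psi>.f_add[of ?a ?b] a b by (simp add: add)
    then show ?case
      using a b insert.hyps by (simp add: poly_alg_closed)
  qed
  from this[of "Poly_Mapping.keys p"] show ?thesis
    using poly_mapping_eq_sum_single[of p] by simp
qed

text \<open>\<open>corr\<close> has the prescribed properties; they fix a map on bitableaux, by
  linearity on the carrier, and by extensionality elsewhere.\<close>

lemma bitableaux_corr_eq: "bitableaux_corr n = restrict (corr n) (carrier (poly_alg n))"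
  unfolding bitableaux_corr_def
proof (rule the_equality)
  let ?\<Phi> = "restrict (corr n) (carrier (poly_alg n))"
  show "linear_map class_ring (poly_alg n) (U_gl n) ?\<Phi> \<and> ?\<Phi> \<in> extensional (carrier (poly_alg n)) \<and>
    (\<forall>S\<in>tableaux {1..n}. \<forall>T\<in>tableaux {1..n}. shape S = shape T \<longrightarrow>
      (\<forall>m0 m1. enough_virtual m0 m1 (shape S) \<longrightarrow> ?\<Phi> (bitableau S T) = capelli_bitableau m0 m1 n S T))"
    using corr_linear_map capelli_bitableau_eq_corr by auto
  fix \<Phi> assume \<Phi>: "linear_map class_ring (poly_alg n) (U_gl n) \<Phi> \<and> \<Phi> \<in> extensional (carrier (poly_alg n)) \<and>
    (\<forall>S\<in>tableaux {1..n}. \<forall>T\<in>tableaux {1..n}. shape S = shape T \<longrightarrow>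
      (\<forall>m0 m1. enough_virtual m0 m1 (shape S) \<longrightarrow> \<Phi> (bitableau S T) = capelli_bitableau m0 m1 n S T))"
  have bit: "\<Phi> (bitableau S T) = ?\<Phi> (bitableau S T)"
    if ST: "S \<in> tableaux {1..n}" "T \<in> tableaux {1..n}" "shape S = shape T" for S T
  proof -
    \<comment> \<open>The prescribed values are quantified over all sufficient alphabets; the
      smallest one supplies an instance.\<close>
    have "enough_virtual (nrows (shape S)) (ncols (shape S)) (shape S)"
      by (simp add: enough_virtual_def)
    then show ?thesis
      using \<Phi> ST capelli_bitableau_eq_corr[OF ST] by simp
  qed
  show "\<Phi> = ?\<Phi>"
  proof (rule extensionalityI)
    show "\<Phi> \<in> extensional (carrier (poly_alg n))" using \<Phi> by (elim conjE)
    show "?\<Phi> \<in> extensional (carrier (poly_alg n))" by (rule restrict_extensional)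
    have lin: "linear_map class_ring (poly_alg n) (U_gl n) \<Phi>" using \<Phi> by (elim conjE)
    show "\<Phi> p = ?\<Phi> p" if p: "p \<in> carrier (poly_alg n)" for p
      using lin corr_linear_map bit p by (rule linear_map_poly_alg_eqI)
  qed
qed

theorem theorem4p2:
  fixes n m0 m1 :: nat and S T :: "nat list list"
  assumes "n \<ge> 1"
    and "S \<in> tableaux {1..n}" and "T \<in> tableaux {1..n}" and "shape S = shape T"
    and "enough_virtual m0 m1 (shape S)"
  shows "bitableaux_corr n (right_sym_bitableau S T) = young_capelli_bitableau m0 m1 n S T
    \<and> koszul_map n (young_capelli_bitableau m0 m1 n S T) = right_sym_bitableau S T"
proof
  note young = young_capelli_bitableau_eq_corr[OF assms(2-5)]
  show eq: "bitableaux_corr n (right_sym_bitableau S T) = young_capelli_bitableau m0 m1 n S T"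
    using young by (simp add: bitableaux_corr_eq)
  \<comment> \<open>\<open>koszul_map\<close> is an \<open>inv_into\<close>: injectivity on the
    carrier, together with membership of the symmetrized bitableau there, inverts the first
    equation.\<close>
  have "inj_on (bitableaux_corr n) (carrier (poly_alg n))"
    by (simp add: bitableaux_corr_eq inj_on_restrict_eq corr_inj)
  then show "koszul_map n (young_capelli_bitableau m0 m1 n S T) = right_sym_bitableau S T"
    unfolding koszul_map_def eq[symmetric] using young(2) by (rule inv_into_f_f)
qed

end
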